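(* Let $\mu\in C^0(\mathbb{R}^2)$ be $1$-periodic in its second variable, i.e. $\mu(q,y+1)=\mu(q,y)$ for all $q,y\in\mathbb{R}$, and suppose there are constants $0<\underline m\le \overline m<\infty$ with $\underline m\le \mu(q,y)\le \overline m$ for all $(q,y)\in\mathbb{R}^2$. Let $\mathcal{E}\in C^1(\mathbb{R})$ be independent of $\varepsilon$, and for $\varepsilon>0$ let $$\mathcal{R}_\varepsilon(q,v)=\frac{\mu(q,q/\varepsilon)}{2}\,v^2,\qquad \mathcal{R}_{\mathrm{eff}}(q,v)=\frac{\overline\mu(q)}{2}\,v^2,\qquad \overline\mu(q)=\int_0^1\mu(q,y)\,\mathrm{d}y .$$ Then, as $\varepsilon\to0$, the family of gradient systems $(\mathbb{R},\mathcal{E},\mathcal{R}_\varepsilon)$ converges in the sense of contact EDP convergence with tilting to $(\mathbb{R},\mathcal{E},\mathcal{R}_{\mathrm{eff}})$, where $\mathcal{R}_{\mathrm{eff}}(q,\cdot)$ is quadratic and is independent of $\mathcal{E}$. If $\mu(q,\cdot)$ is not constant, then the family $(\mathbb{R},\mathcal{E},\mathcal{R}_\varepsilon)$ converges in the simple EDP sense to $(\mathbb{R},\mathcal{E},\widetilde{\mathcal{R}}_0)$ for a non-quadratic dissipation potential $\widetilde{\mathcal{R}}_0(q,\cdot)$ that depends on $\mathcal{E}$, and the family does not converge in the sense of EDP convergence with tilting.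
   Context: Gradient systems. A gradient system is a triple $(\mathbf{Q},\mathcal{E},\mathcal{R})$ where $\mathbf{Q}$ is a smooth finite-dimensional Riemannian manifold (here $\mathbf{Q}=\mathbb{R}$, so $T_q\mathbf{Q}=T_q^*\mathbf{Q}=\mathbb{R}$), $\mathcal{E}:\mathbf{Q}\to\mathbb{R}$ is continuously differentiable, and $\mathcal{R}:T\mathbf{Q}\to[0,\infty]$ is a dissipation potential: for each $q$, $\mathcal{R}(q,\cdot)$ is convex and lower semicontinuous and $\mathcal{R}(q,0)=\min_v\mathcal{R}(q,v)=0$. Its dual is $\mathcal{R}^*(q,\xi)=\sup_{v\in T_q\mathbf{Q}}\langle\xi,v\rangle-\mathcal{R}(q,v)$. $T\mathbf{Q}\oplus T^*\mathbf{Q}$ is the set of triples $(q,v,\xi)$ with $q\in\mathbf{Q}$, $v\in T_q\mathbf{Q}$, $\xi\in T_q^*\mathbf{Q}$. All limits and $\Gamma$-limits are for $\varepsilon\to0$. $\mathrm{D}$ denotes the differential. Dissipation functionals. For a family $(\mathbf{Q},\mathcal{E}_\varepsilon,\mathcal{R}_\varepsilon)$, $T>0$, $\mathcal{F}\in C^1(\mathbf{Q};\mathbb{R})$ and $q\in \mathrm{AC}([0,T];\mathbf{Q})$ put $$\mathfrak{D}_\varepsilon^T(q,\mathcal{F})=\int_0^T\Big[\mathcal{R}_\varepsilon(q,\dot q)+\mathcal{R}_\varepsilon^*\big(q,-\mathrm{D}\mathcal{E}_\varepsilon(q)-\mathrm{D}\mathcal{F}(q)\big)\Big]\mathrm{d}t,\qquad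 \mathfrak{D}_\varepsilon^T(q)=\mathfrak{D}_\varepsilon^T(q,0).$$ For $\Gamma$-convergence in $C([0,T];\mathbf{Q})$ these functionals, and their limits, are understood as $+\infty$ on curves that are not absolutely continuous. Simple EDP convergence. $(\mathbf{Q},\mathcal{E}_\varepsilon,\mathcal{R}_\varepsilon)$ converges in the simple EDP sense to a gradient system $(\mathbf{Q},\mathcal{E}_0,\widetilde{\mathcal{R}}_0)$ if $\mathcal{E}_\varepsilon$ $\Gamma$-converges to $\mathcal{E}_0$ in $\mathbf{Q}$ and, for each $T>0$, $\mathfrak{D}_\varepsilon^T$ $\Gamma$-converges in $C([0,T];\mathbf{Q})$ to $\mathfrak{D}_0^T(q)=\int_0^T[\widetilde{\mathcal{R}}_0(q,\dot q)+\widetilde{\mathcal{R}}_0^*(q,-\mathrm{D}\mathcal{E}_0(q))]\,\mathrm{d}t$. Basic assumptions. A family $(\mathbf{Q},\mathcal{E}_\varepsilon,\mathcal{R}_\varepsilon)$ satisfies the basic assumptions if: (1) $\mathcal{E}_\varepsilon$ $\Gamma$-converges to $\mathcal{E}_0$ in $\mathbf{Q}$. (2) For all $T>0$ there is a functional $\mathfrak{D}_0^T:\mathrm{AC}([0,T];\mathbf{Q})\times C^1(\mathbf{Q};\mathbb{R})\to[0,\infty]$ such that, for each $\mathcal{F}\in C^1(\mathbf{Q};\mathbb{R})$, $\mathfrak{D}_\varepsilon^T(\cdot,\mathcal{F})$ $\Gamma$-converges to $\mathfrak{D}_0^T(\cdot,\mathcal{F})$ in the topology of $C([0,T];\mathbf{Q})$.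 (3) There is a function $\mathcal{N}_0:T\mathbf{Q}\oplus T^*\mathbf{Q}\to[0,\infty]$, independent of $T$, such that $\mathfrak{D}_0^T(q,\mathcal{F})=\int_0^T\mathcal{N}_0(q(t),\dot q(t),-\mathrm{D}\mathcal{F}(q(t)))\,\mathrm{d}t$ for all $\mathcal{F}\in C^1(\mathbf{Q};\mathbb{R})$; and for all $(q,\eta)\in T^*\mathbf{Q}$ the map $v\mapsto\mathcal{N}_0(q,v,\eta)$ is convex and lower semicontinuous. Define $\mathcal{M}_0(q,v,\xi)=\mathcal{N}_0(q,v,\xi+\mathrm{D}\mathcal{E}_0(q))$. (4) $\mathcal{M}_0(q,v,\xi)\ge\langle\xi,v\rangle$ for all $(q,v,\xi)\in T\mathbf{Q}\oplus T^*\mathbf{Q}$. (5) $\mathcal{M}_0(q,v,\xi)\ge\mathcal{M}_0(q,0,\xi)$ for all $(q,v,\xi)\in T\mathbf{Q}\oplus T^*\mathbf{Q}$. EDP convergence with tilting (tilt-EDP convergence) to $(\mathbf{Q},\mathcal{E}_0,\widehat{\mathcal{R}}_0)$ means: the family satisfies the basic assumptions and, for all $q\in\mathbf{Q}$, $\mathcal{M}_0(q,v,\xi)=\widehat{\mathcal{R}}_0(q,v)+\widehat{\mathcal{R}}_0^*(q,\xi)$ for all $v,\xi$, where $\widehat{\mathcal{R}}_0$ is a dissipation potential. Contact EDP convergence with tilting (contact-EDP convergence) to $(\mathbf{Q},\mathcal{E}_0,\mathcal{R}_{\mathrm{eff}})$ means: the family satisfies the basic assumptions and, for all $q\in\mathbf{Q}$,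 $\{(v,\xi):\mathcal{M}_0(q,v,\xi)=\langle\xi,v\rangle\}=\mathrm{graph}(\partial_v\mathcal{R}_{\mathrm{eff}}(q,\cdot))$, where $\mathcal{R}_{\mathrm{eff}}$ is a dissipation potential and $\partial_v$ is the convex subdifferential in $v$. That the potential $\widetilde{\mathcal{R}}_0$ "depends on $\mathcal{E}$" means that, with $\mu$ fixed, it is not the same dissipation potential for all energies $\mathcal{E}\in C^1(\mathbb{R})$.
   Formalization: Non-quadraticity of R̃_0(q,·) is claimed only at points q where μ(q,·) is not constant and DE(q) ≠ 0; where DE(q) = 0 it fails (for constant E, R̃_0(q,v) = (∫√μ(q,y)dy)² v²/2 for a.e. q, which is quadratic). *)

theory Defs
  imports "HOL-Analysis.Analysis"
begin

definition econvex :: "(real \<Rightarrow> ereal) \<Rightarrow> bool" where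
  "econvex f \<longleftrightarrow> (\<forall>v w t. 0 < t \<and> t < 1 \<longrightarrow>
     f ((1 - t) * v + t * w) \<le> ereal (1 - t) * f v + ereal t * f w)"

definition lsc :: "(real \<Rightarrow> ereal) \<Rightarrow> bool" where
  "lsc f \<longleftrightarrow> (\<forall>v. f v \<le> Liminf (at v) f)"

definition subdifferential :: "(real \<Rightarrow> ereal) \<Rightarrow> real \<Rightarrow> real set" where
  "subdifferential f v =
     {\<xi>. \<bar>f v\<bar> \<noteq> \<infinity> \<and> (\<forall>w. f v + ereal (\<xi> * (w - v)) \<le> f w)}"

definition is_quadratic :: "(real \<Rightarrow> ereal) \<Rightarrow> bool" where
  "is_quadratic f \<longleftrightarrow> (\<exists>c. \<forall>v. f v = ereal (c / 2 * v\<^sup>2))"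

text \<open>Tangent and cotangent spaces of the real line are identified with the type of reals.\<close>

definition dissipation_potential :: "(real \<Rightarrow> real \<Rightarrow> ereal) \<Rightarrow> bool" where
  "dissipation_potential R \<longleftrightarrow>
     (\<forall>q. econvex (R q) \<and> lsc (R q) \<and> R q 0 = 0 \<and> (\<forall>v. 0 \<le> R q v))"

definition dual_potential :: "(real \<Rightarrow> real \<Rightarrow> ereal) \<Rightarrow> real \<Rightarrow> real \<Rightarrow> ereal" where
  "dual_potential R q \<xi> = (SUP v. ereal (\<xi> * v) - R q v)"

definition gradient_system :: "(real \<Rightarrow> real) \<Rightarrow> (real \<Rightarrow> real \<Rightarrow> ereal) \<Rightarrow> bool" where
  "gradient_system E R \<longleftrightarrow> E C1_differentiable_on UNIV \<and> dissipation_potential R"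

definition AC_curves :: "real \<Rightarrow> (real \<Rightarrow> real) set" where
  "AC_curves T = {q. \<forall>e>0. \<exists>d>0. \<forall>(n::nat) a b.
     (\<forall>i<n. 0 \<le> a i \<and> a i \<le> b i \<and> b i \<le> T) \<and>
     disjoint_family_on (\<lambda>i. {a i<..<b i}) {..<n} \<and> (\<Sum>i<n. b i - a i) < d
     \<longrightarrow> (\<Sum>i<n. \<bar>q (b i) - q (a i)\<bar>) < e}"

text \<open>The space of continuous curves on \<open>{0..T}\<close> with the supremum distance.
  Its elements are \<open>undefined\<close> outside \<open>{0..T}\<close>.\<close>

definition C_curves :: "real \<Rightarrow> (real \<Rightarrow> real) topology" where
  "C_curves T = mtopology_of (cfunspace (top_of_set {0..T}) euclidean_metric)"

text \<open>The integral over \<open>{0..T}\<close> of a function with values in \<open>[0,\<infinity>]\<close>. On a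
  non-measurable function \<open>nn_integral\<close> is only a lower integral; therefore the notions of
  convergence below ask for measurability of the integrands explicitly.\<close>

definition time_integral :: "real \<Rightarrow> (real \<Rightarrow> ereal) \<Rightarrow> ereal" where
  "time_integral T f = enn2ereal (\<integral>\<^sup>+ t. e2ennreal (f t) \<partial>lebesgue_on {0..T})"

text \<open>Absolutely continuous curves are differentiable almost everywhere; where \<open>q\<close> has no
  derivative, \<open>deriv q t\<close> is an arbitrary value, which does not affect the integral.\<close>

definition diss_rate ::
  "(real \<Rightarrow> real) \<Rightarrow> (real \<Rightarrow> real \<Rightarrow> ereal) \<Rightarrow> (real \<Rightarrow> real) \<Rightarrow> (real \<Rightarrow> real) \<Rightarrow> real \<Rightarrow> ereal" where
  "diss_rate E R F q t =
     R (q t) (deriv q t) + dual_potential R (q t) (- deriv E (q t) - deriv F (q t))"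

definition diss_functional ::
  "(real \<Rightarrow> real) \<Rightarrow> (real \<Rightarrow> real \<Rightarrow> ereal) \<Rightarrow> real \<Rightarrow> (real \<Rightarrow> real) \<Rightarrow> (real \<Rightarrow> real) \<Rightarrow> ereal" where
  "diss_functional E R T F q = time_integral T (diss_rate E R F q)"

definition diss_measurable ::
  "(real \<Rightarrow> real) \<Rightarrow> (real \<Rightarrow> real \<Rightarrow> ereal) \<Rightarrow> (real \<Rightarrow> real) \<Rightarrow> bool" where
  "diss_measurable E R F \<longleftrightarrow>
     (\<forall>T>0. \<forall>q\<in>AC_curves T. diss_rate E R F q \<in> borel_measurable (lebesgue_on {0..T}))"

definition ext_AC :: "real \<Rightarrow> ((real \<Rightarrow> real) \<Rightarrow> ereal) \<Rightarrow> (real \<Rightarrow> real) \<Rightarrow> ereal" where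
  "ext_AC T D q = (if q \<in> AC_curves T then D q else \<infinity>)"

text \<open>Liminf inequality and existence of recovery families. In a metrizable space this
  agrees with the neighbourhood definition of Gamma-convergence.\<close>

definition gamma_converges :: "'a topology \<Rightarrow> (real \<Rightarrow> 'a \<Rightarrow> ereal) \<Rightarrow> ('a \<Rightarrow> ereal) \<Rightarrow> bool" where
  "gamma_converges X f f0 \<longleftrightarrow> (\<forall>x\<in>topspace X.
     (\<forall>u. limitin X u x (at_right 0) \<longrightarrow> f0 x \<le> Liminf (at_right 0) (\<lambda>\<epsilon>. f \<epsilon> (u \<epsilon>))) \<and>
     (\<exists>u. limitin X u x (at_right 0) \<and> Limsup (at_right 0) (\<lambda>\<epsilon>. f \<epsilon> (u \<epsilon>)) \<le> f0 x))"

definition energies_gamma_converge :: "(real \<Rightarrow> real \<Rightarrow> real) \<Rightarrow> (real \<Rightarrow> real) \<Rightarrow> bool" where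
  "energies_gamma_converge E E0 \<longleftrightarrow>
     gamma_converges euclidean (\<lambda>\<epsilon> q. ereal (E \<epsilon> q)) (\<lambda>q. ereal (E0 q))"

definition simple_EDP_converges ::
  "(real \<Rightarrow> real \<Rightarrow> real) \<Rightarrow> (real \<Rightarrow> real \<Rightarrow> real \<Rightarrow> ereal) \<Rightarrow>
   (real \<Rightarrow> real) \<Rightarrow> (real \<Rightarrow> real \<Rightarrow> ereal) \<Rightarrow> bool" where
  "simple_EDP_converges E R E0 R0 \<longleftrightarrow>
     (\<forall>\<epsilon>>0. gradient_system (E \<epsilon>) (R \<epsilon>) \<and> diss_measurable (E \<epsilon>) (R \<epsilon>) (\<lambda>_. 0)) \<and>
     gradient_system E0 R0 \<and> diss_measurable E0 R0 (\<lambda>_. 0) \<and>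
     energies_gamma_converge E E0 \<and>
     (\<forall>T>0. gamma_converges (C_curves T)
        (\<lambda>\<epsilon>. ext_AC T (diss_functional (E \<epsilon>) (R \<epsilon>) T (\<lambda>_. 0)))
        (ext_AC T (diss_functional E0 R0 T (\<lambda>_. 0))))"

definition M_of :: "(real \<Rightarrow> real) \<Rightarrow> (real \<Rightarrow> real \<Rightarrow> real \<Rightarrow> ereal) \<Rightarrow> real \<Rightarrow> real \<Rightarrow> real \<Rightarrow> ereal" where
  "M_of E0 N0 q v \<xi> = N0 q v (\<xi> + deriv E0 q)"

text \<open>The limit functionals \<open>D0 T q F\<close> and their integrand \<open>N0\<close> are part of the data of the
  basic assumptions; \<open>D0\<close> is quantified here, \<open>N0\<close> in the two notions based on them.\<close>

definition basic_assumptions ::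
  "(real \<Rightarrow> real \<Rightarrow> real) \<Rightarrow> (real \<Rightarrow> real \<Rightarrow> real \<Rightarrow> ereal) \<Rightarrow>
   (real \<Rightarrow> real) \<Rightarrow> (real \<Rightarrow> real \<Rightarrow> real \<Rightarrow> ereal) \<Rightarrow> bool" where
  "basic_assumptions E R E0 N0 \<longleftrightarrow>
     (\<forall>\<epsilon>>0. gradient_system (E \<epsilon>) (R \<epsilon>) \<and>
        (\<forall>F. F C1_differentiable_on UNIV \<longrightarrow> diss_measurable (E \<epsilon>) (R \<epsilon>) F)) \<and>
     energies_gamma_converge E E0 \<and>
     (\<forall>q v \<eta>. 0 \<le> N0 q v \<eta>) \<and>
     (\<exists>D0. \<forall>T>0. \<forall>F. F C1_differentiable_on UNIV \<longrightarrow>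
        gamma_converges (C_curves T)
          (\<lambda>\<epsilon>. ext_AC T (diss_functional (E \<epsilon>) (R \<epsilon>) T F))
          (ext_AC T (\<lambda>q. D0 T q F)) \<and>
        (\<forall>q\<in>AC_curves T.
          (\<lambda>t. N0 (q t) (deriv q t) (- deriv F (q t))) \<in> borel_measurable (lebesgue_on {0..T}) \<and>
          D0 T q F = time_integral T (\<lambda>t. N0 (q t) (deriv q t) (- deriv F (q t))))) \<and>
     (\<forall>q \<eta>. econvex (\<lambda>v. N0 q v \<eta>) \<and> lsc (\<lambda>v. N0 q v \<eta>)) \<and>
     (\<forall>q v \<xi>. M_of E0 N0 q v \<xi> \<ge> ereal (\<xi> * v)) \<and>
     (\<forall>q v \<xi>. M_of E0 N0 q v \<xi> \<ge> M_of E0 N0 q 0 \<xi>)"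

definition tilt_EDP_converges ::
  "(real \<Rightarrow> real \<Rightarrow> real) \<Rightarrow> (real \<Rightarrow> real \<Rightarrow> real \<Rightarrow> ereal) \<Rightarrow>
   (real \<Rightarrow> real) \<Rightarrow> (real \<Rightarrow> real \<Rightarrow> ereal) \<Rightarrow> bool" where
  "tilt_EDP_converges E R E0 R0 \<longleftrightarrow> gradient_system E0 R0 \<and>
     (\<exists>N0. basic_assumptions E R E0 N0 \<and>
       (\<forall>q v \<xi>. M_of E0 N0 q v \<xi> = R0 q v + dual_potential R0 q \<xi>))"

definition contact_EDP_converges ::
  "(real \<Rightarrow> real \<Rightarrow> real) \<Rightarrow> (real \<Rightarrow> real \<Rightarrow> real \<Rightarrow> ereal) \<Rightarrow>
   (real \<Rightarrow> real) \<Rightarrow> (real \<Rightarrow> real \<Rightarrow> ereal) \<Rightarrow> bool" where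
  "contact_EDP_converges E R E0 Reff \<longleftrightarrow> gradient_system E0 Reff \<and>
     (\<exists>N0. basic_assumptions E R E0 N0 \<and>
       (\<forall>q. {(v, \<xi>). M_of E0 N0 q v \<xi> = ereal (\<xi> * v)} =
             {(v, \<xi>). \<xi> \<in> subdifferential (Reff q) v}))"

definition R_osc :: "(real \<Rightarrow> real \<Rightarrow> real) \<Rightarrow> real \<Rightarrow> real \<Rightarrow> real \<Rightarrow> ereal" where
  "R_osc \<mu> \<epsilon> q v = ereal (\<mu> q (q / \<epsilon>) / 2 * v\<^sup>2)"

definition R_eff :: "(real \<Rightarrow> real \<Rightarrow> real) \<Rightarrow> real \<Rightarrow> real \<Rightarrow> ereal" where
  "R_eff \<mu> q v = ereal (integral {0..1} (\<mu> q) / 2 * v\<^sup>2)"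

end

theory Submission
  imports Defs
begin

text \<open>
  With the force \<open>\<xi>\<close> and the coefficient \<open>a = \<mu> q\<close> frozen, Young's inequality bounds the cost
  \<open>a y / 2 * w\<^sup>2 + \<xi>\<^sup>2 / (2 * a y)\<close> from below by \<open>\<nu> + \<bar>w\<bar> * sqrt (\<xi>\<^sup>2 - 2 * \<nu> * a y)\<close> whenever
  \<open>2 * \<nu> * a \<le> \<xi>\<^sup>2\<close>. The last term is the derivative of an oscillating potential along the curve,
  so it homogenizes to a cell average, and the limit density is the supremum over \<open>\<nu>\<close> of
  \<open>\<nu> + \<bar>v\<bar> * (\<integral> sqrt (\<xi>\<^sup>2 - 2 * \<nu> * a))\<close>. Conversely, moving at the speed for which Young's
  inequality is an equality, with \<open>\<nu>\<close> fitted to the prescribed travel time, attains this value;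
  if the required mean speed is too small for that, the remaining time is spent near a maximum
  of \<open>a\<close>. The dependence of \<open>\<mu>\<close> and of the force on the slow variable is removed by freezing
  both on the cells of a uniform time mesh.

  The density touches \<open>\<xi> * v\<close> exactly where \<open>\<nu> = 0\<close> is optimal, that is for \<open>\<xi> = v * (\<integral> a)\<close>,
  which gives contact convergence. For \<open>\<xi> \<noteq> 0\<close> and nonconstant \<open>a\<close> it has a kink at \<open>v = 0\<close>, and it
  is not a sum of a function of \<open>v\<close> and a function of \<open>\<xi>\<close> because
  \<open>(\<integral> sqrt a)\<^sup>2 / 2 + (\<integral> a)\<^sup>2 / (2 * max a) < \<integral> a\<close>.
\<close>

section \<open>Almost everywhere differentiability of monotone functions\<close>

text \<open>Curves are only absolutely continuous and may turn back within a period, so the lower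
  bound rests on the chain rule and the fundamental theorem for such curves; that is the purpose of
  the differentiation theory of monotone functions. At a fixed mesh the cell bound sees a curve only
  through its values at the nodes, so uniform convergence passes to the limit directly; derivatives
  return when the mesh is refined, through difference quotients and Fatou's lemma. On the recovery
  side the transit time can diverge as \<open>\<nu>\<close> approaches its largest admissible value,
  so that value is only approximated. Both negative statements reduce to the same contradiction:
  linear energies in one case, and tilts that cancel the energy in the other, make the force an
  arbitrary constant, and uniqueness of Gamma-limits then fixes the integrated density of any
  candidate potential.\<close>

lemma mono_sum_disjoint_increments:
  fixes F :: "real \<Rightarrow> real"
  assumes "mono F" "finite I" "s \<le> t"
    and "\<And>i. i \<in> I \<Longrightarrow> s \<le> fst i \<and> fst i < snd i \<and> snd i \<le> t"
    and "pairwise (\<lambda>i j. disjnt {fst i..snd i} {fst j..snd j}) I"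
  shows "(\<Sum>i\<in>I. F (snd i) - F (fst i)) \<le> F t - F s"
  using assms(2-)
proof (induction "card I" arbitrary: I t)
  case 0
  then show ?case using \<open>mono F\<close> by (simp add: monoD)
next
  case (Suc n)
  then have "I \<noteq> {}" by auto
  \<comment> \<open>The interval with the largest right end is split off: by disjointness of the
    closed intervals all others end before it begins, so induction applies with \<open>fst k\<close>
    in place of \<open>t\<close>.\<close>
  obtain k where k: "k \<in> I" "\<And>i. i \<in> I \<Longrightarrow> snd i \<le> snd k"
    using Max_in[of "snd ` I"] Max_ge[of "snd ` I"] Suc.prems(1) \<open>I \<noteq> {}\<close> by fastforce
  have below: "snd i \<le> fst k" if "i \<in> I - {k}" for i
  proof (rule ccontr)
    assume "\<not> snd i \<le> fst k"
    then have "snd i \<in> {fst i..snd i} \<inter> {fst k..snd k}"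
      using that k(2)[of i] Suc.prems(3)[of i] by auto
    moreover have "disjnt {fst i..snd i} {fst k..snd k}"
      using Suc.prems(4) that k(1) by (auto simp: pairwise_def)
    ultimately show False by (auto simp: disjnt_def)
  qed
  have "(\<Sum>i\<in>I - {k}. F (snd i) - F (fst i)) \<le> F (fst k) - F s"
  proof (rule Suc.hyps(1))
    show "n = card (I - {k})" using Suc.hyps(2) Suc.prems(1) k(1) by simp
    show "s \<le> fst k" using Suc.prems(3) k(1) by auto
    show "pairwise (\<lambda>i j. disjnt {fst i..snd i} {fst j..snd j}) (I - {k})"
      by (rule pairwise_mono[OF Suc.prems(4)]) auto
  qed (use Suc.prems below in auto)
  moreover have "(\<Sum>i\<in>I. F (snd i) - F (fst i))
      = (F (snd k) - F (fst k)) + (\<Sum>i\<in>I - {k}. F (snd i) - F (fst i))"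
    using Suc.prems(1) k(1) by (rule sum.remove)
  moreover have "F (snd k) \<le> F t"
    using \<open>mono F\<close> Suc.prems(3) k(1) by (auto simp: monoD)
  ultimately show ?case by linarith
qed

text \<open>The intervals are the closed balls of the Vitali covering theorem, with the midpoint as
  centre and half the length as radius. Passing to open intervals loses only the endpoints of a
  countable family, a null set.\<close>

lemma vitali_intervals:
  fixes K :: "(real \<times> real) set"
  assumes "\<And>i. i \<in> K \<Longrightarrow> fst i < snd i"
    and "\<And>x d. x \<in> S \<Longrightarrow> 0 < d \<Longrightarrow> \<exists>i\<in>K. fst i < x \<and> x < snd i \<and> snd i - fst i < d"
  obtains C where "countable C" "C \<subseteq> K"
    "pairwise (\<lambda>i j. disjnt {fst i..snd i} {fst j..snd j}) C"
    "negligible (S - (\<Union>i\<in>C. {fst i<..<snd i}))"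
proof -
  let ?c = "\<lambda>i::real \<times> real. (fst i + snd i) / 2"
  let ?r = "\<lambda>i::real \<times> real. (snd i - fst i) / 2"
  have cb: "cball (?c i) (?r i) = {fst i..snd i}" for i :: "real \<times> real"
    by (auto simp: cball_eq_atLeastAtMost field_simps)
  have "\<exists>i. i \<in> K \<and> x \<in> cball (?c i) (?r i) \<and> ?r i < d" if "x \<in> S" "0 < d" for x d
    unfolding cb using assms(2)[OF that] assms(1) by force
  then obtain C where C: "countable C" "C \<subseteq> K"
     "pairwise (\<lambda>i j. disjnt (cball (?c i) (?r i)) (cball (?c j) (?r j))) C"
     "negligible(S - (\<Union>i \<in> C. cball (?c i) (?r i)))"
    using Vitali_covering_theorem_cballs[of K ?r S ?c] assms(1) by auto
  have "countable (fst ` C \<union> snd ` C)" using C(1) by auto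
  then have "negligible ((S - (\<Union>i \<in> C. cball (?c i) (?r i))) \<union> (fst ` C \<union> snd ` C))"
    using C(4) by (intro negligible_Un) (simp_all add: negligible_iff_null_sets
        null_sets_completionI[OF countable_imp_null_set_lborel])
  then have "negligible (S - (\<Union>i\<in>C. {fst i<..<snd i}))"
  proof (rule negligible_subset, intro subsetI)
    fix x assume x: "x \<in> S - (\<Union>i\<in>C. {fst i<..<snd i})"
    have "x = fst i \<or> x = snd i" if "i \<in> C" "x \<in> {fst i..snd i}" for i
      using x that by (auto simp: less_le)
    then show "x \<in> (S - (\<Union>i \<in> C. cball (?c i) (?r i))) \<union> (fst ` C \<union> snd ` C)"
      using x unfolding cb by blast
  qed
  then show thesis using that C unfolding cb by blast
qed

text \<open>A Vitali subfamily covers \<open>S\<close> up to a null set. Every finite part of it has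
  total length at most \<open>B\<close>, and this bound passes to the countable union, which also
  makes the measure of \<open>S\<close> finite.\<close>

lemma vitali_measure_bound:
  fixes K :: "(real \<times> real) set"
  assumes K: "\<And>i. i \<in> K \<Longrightarrow> fst i < snd i"
    and cover: "\<And>x d. x \<in> S \<Longrightarrow> 0 < d \<Longrightarrow> \<exists>i\<in>K. fst i < x \<and> x < snd i \<and> snd i - fst i < d"
    and S: "S \<in> sets lebesgue"
    and B: "\<And>I. finite I \<Longrightarrow> I \<subseteq> K \<Longrightarrow> pairwise (\<lambda>i j. disjnt {fst i..snd i} {fst j..snd j}) I
      \<Longrightarrow> (\<Sum>i\<in>I. snd i - fst i) \<le> B"
  shows "S \<in> lmeasurable" "measure lebesgue S \<le> B"
proof -
  obtain C where C: "countable C" "C \<subseteq> K"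
    "pairwise (\<lambda>i j. disjnt {fst i..snd i} {fst j..snd j}) C"
    "negligible (S - (\<Union>i\<in>C. {fst i<..<snd i}))"
    using vitali_intervals[OF K cover] by blast
  have "0 \<le> B" using B[of "{}"] by simp
  have fin: "measure lebesgue (\<Union>i\<in>I. {fst i..snd i}) \<le> B" if "I \<subseteq> C" "finite I" for I
  proof -
    have "measure lebesgue (\<Union>i\<in>I. {fst i..snd i}) \<le> (\<Sum>i\<in>I. measure lebesgue {fst i..snd i})"
      by (rule measure_UNION_le) (use that in auto)
    also have "\<dots> = (\<Sum>i\<in>I. snd i - fst i)"
      using that C(2) K by (intro sum.cong) (auto simp: less_imp_le subset_iff)
    also have "\<dots> \<le> B"
      using that C by (intro B) (auto intro: pairwise_subset)
    finally show ?thesis .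
  qed
  let ?U = "\<Union>i\<in>C. {fst i..snd i}"
  have U: "?U \<in> lmeasurable" "measure lebesgue ?U \<le> B"
    by (rule fmeasurable_UN_bound[OF C(1) _ fin] measure_UN_bound[OF C(1) _ fin]; auto)+
  have neg: "negligible (S - ?U)"
    using C(4) by (rule negligible_subset) auto
  have "S \<subseteq> ?U \<union> (S - ?U)" by auto
  moreover have "?U \<union> (S - ?U) \<in> lmeasurable"
    by (rule fmeasurable.Un[OF U(1) negligible_imp_measurable[OF neg]])
  ultimately show "S \<in> lmeasurable" using S by (metis fmeasurableI2)
  have "measure lebesgue S \<le> measure lebesgue (?U \<union> (S - ?U))"
    using \<open>?U \<union> (S - ?U) \<in> lmeasurable\<close> S by (intro measure_mono_fmeasurable) auto
  also have "\<dots> \<le> measure lebesgue ?U + measure lebesgue (S - ?U)"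
    using U(1) neg by (intro measure_Un_le) (auto simp: negligible_imp_sets)
  also have "\<dots> \<le> B" using U(2) neg by (simp add: negligible_imp_measure0)
  finally show "measure lebesgue S \<le> B" .
qed

text \<open>Slopes are taken over intervals that contain \<open>x\<close> in their interior, unlike
  one-sided Dini derivates. For fixed \<open>d\<close> the condition then defines a union of open
  intervals, so these sets are measurable for every \<open>F\<close>.\<close>

definition slope_below :: "(real \<Rightarrow> real) \<Rightarrow> real \<Rightarrow> real set" where
  "slope_below F \<alpha> = {x. \<forall>d>0. \<exists>a b. a < x \<and> x < b \<and> b - a < d \<and> F b - F a < \<alpha> * (b - a)}"

definition slope_above :: "(real \<Rightarrow> real) \<Rightarrow> real \<Rightarrow> real set" where
  "slope_above F \<beta> = {x. \<forall>d>0. \<exists>a b. a < x \<and> x < b \<and> b - a < d \<and> F b - F a > \<beta> * (b - a)}"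

lemma slope_belowD:
  "x \<in> slope_below F \<alpha> \<Longrightarrow> d > 0 \<Longrightarrow> \<exists>a b. a < x \<and> x < b \<and> b - a < d \<and> F b - F a < \<alpha> * (b - a)"
  and slope_aboveD:
  "x \<in> slope_above F \<beta> \<Longrightarrow> d > 0 \<Longrightarrow> \<exists>a b. a < x \<and> x < b \<and> b - a < d \<and> \<beta> * (b - a) < F b - F a"
  unfolding slope_below_def slope_above_def by (drule CollectD, elim allE, erule mp, assumption)+

text \<open>Restricting \<open>d\<close> to the values \<open>1 / Suc n\<close> leaves a countable
  intersection of open sets, whatever \<open>P\<close> is.\<close>

lemma bracket_set_lebesgue:
  "{x::real. \<forall>d>0. \<exists>a b. a < x \<and> x < b \<and> b - a < d \<and> P a b} \<in> sets lebesgue"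
proof -
  have "{x. \<forall>d>0. \<exists>a b. a < x \<and> x < b \<and> b - a < d \<and> P a b} =
    (\<Inter>n::nat. {x. \<exists>a b. a < x \<and> x < b \<and> b - a < 1 / Suc n \<and> P a b})" (is "?L = (\<Inter>n. ?R n)")
  proof (intro equalityI subsetI)
    fix x assume x: "x \<in> (\<Inter>n. ?R n)"
    show "x \<in> ?L"
    proof (rule CollectI, intro allI impI)
      fix d :: real assume "d > 0"
      then obtain n where "1 / Suc n < d" by (metis nat_approx_posE)
      then show "\<exists>a b. a < x \<and> x < b \<and> b - a < d \<and> P a b"
        using INT_D[OF x UNIV_I, of n] by (fast elim: less_trans)
    qed
  next
    fix x assume x: "x \<in> ?L"
    have "x \<in> ?R n" for n using x by simp
    then show "x \<in> (\<Inter>n. ?R n)" by blast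
  qed
  moreover have "open (?R n)" for n
  proof -
    have "?R n = (\<Union>i\<in>{(a, b). b - a < 1 / Suc n \<and> P a b}. {fst i<..<snd i})" (is "_ = ?U")
    proof (intro equalityI subsetI)
      fix x assume "x \<in> ?R n"
      then obtain a b where "a < x" "x < b" "b - a < 1 / Suc n" "P a b" by blast
      then show "x \<in> ?U" by (intro UN_I[of "(a, b)"]) auto
    next
      fix x assume "x \<in> ?U"
      then obtain a b where "a < x" "x < b" "b - a < 1 / Suc n" "P a b" by auto
      then show "x \<in> ?R n" by blast
    qed
    moreover have "open (\<Union>i\<in>{(a, b). b - a < 1 / Suc n \<and> P a b}. {fst i<..<snd i})" by auto
    ultimately show ?thesis by (rule ssubst)
  qed
  ultimately show ?thesis by simp
qed

lemma slope_below_lebesgue: "slope_below F \<alpha> \<in> sets lebesgue"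
  and slope_above_lebesgue: "slope_above F \<beta> \<in> sets lebesgue"
  unfolding slope_below_def slope_above_def by (rule bracket_set_lebesgue)+

lemma negligible_bounded_parts:
  fixes S :: "real set"
  assumes "\<And>n::nat. negligible (S \<inter> {- real n<..<real n})"
  shows "negligible S"
proof -
  have "S = (\<Union>n. S \<inter> {- real n<..<real n})"
  proof (intro equalityI subsetI)
    fix x assume "x \<in> S"
    moreover obtain n :: nat where "\<bar>x\<bar> < real n" using reals_Archimedean2 by blast
    ultimately show "x \<in> (\<Union>n. S \<inter> {- real n<..<real n})" by (intro UN_I[of n]) auto
  qed auto
  moreover have "negligible (\<Union>n. S \<inter> {- real n<..<real n})"
    by (rule negligible_Union_nat) (rule assms)
  ultimately show ?thesis by simp
qed

lemma bounded_part_lmeasurable: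
  fixes S :: "real set"
  assumes "S \<in> sets lebesgue"
  shows "S \<inter> {a<..<b} \<in> lmeasurable"
  by (rule bounded_set_imp_lmeasurable) (use assms bounded_subset[OF bounded_box[of a b]] in auto)

lemma lmeasurable_outer_open:
  fixes A :: "real set"
  assumes A: "A \<in> lmeasurable" and "\<eta> > 0"
  shows "\<exists>V. open V \<and> A \<subseteq> V \<and> V \<in> lmeasurable \<and> measure lebesgue V < measure lebesgue A + \<eta>"
proof -
  obtain V where V: "open V" "A \<subseteq> V" "V - A \<in> lmeasurable" "emeasure lebesgue (V - A) < ennreal \<eta>"
    using sets_lebesgue_outer_open[of A \<eta>] A \<open>\<eta> > 0\<close> by auto
  have "V = A \<union> (V - A)" using V(2) by auto
  then have "V \<in> lmeasurable" "measure lebesgue V \<le> measure lebesgue A + measure lebesgue (V - A)"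
    using fmeasurable.Un[OF A V(3)] measure_Un_le[of A lebesgue "V - A"] A V(3) by auto
  moreover have "measure lebesgue (V - A) < \<eta>"
    using V(3,4) \<open>\<eta> > 0\<close> by (simp add: emeasure_eq_measure2 ennreal_less_iff)
  ultimately show ?thesis using V(1,2) by (intro exI[of _ V]) auto
qed

text \<open>Two nested Vitali coverings. Disjoint intervals of slope below \<open>\<alpha>\<close>
  cover almost all of \<open>A\<close> inside an open set barely larger than \<open>A\<close>;
  inside them, disjoint intervals of slope above \<open>\<beta>\<close> cover almost all of it
  again. Monotonicity bounds the inner increments by the outer ones, so \<open>\<beta> * measure
  lebesgue A \<le> \<alpha> * (measure lebesgue A + \<eta>)\<close>.\<close>

lemma negligible_slope_gap:
  assumes "mono F" "\<alpha> < \<beta>"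
  shows "negligible (slope_below F \<alpha> \<inter> slope_above F \<beta>)"
proof (rule negligible_bounded_parts)
  fix n :: nat
  define A where "A = slope_below F \<alpha> \<inter> slope_above F \<beta> \<inter> {- real n<..<real n}"
  have "A \<in> lmeasurable" unfolding A_def
    by (intro bounded_part_lmeasurable sets.Int slope_below_lebesgue slope_above_lebesgue)
  have "negligible A"
  proof (cases "\<alpha> > 0")
    case False
    \<comment> \<open>A monotone function has no increment below a nonpositive multiple of the
      length.\<close>
    have "slope_below F \<alpha> = {}"
    proof (rule ccontr)
      assume "slope_below F \<alpha> \<noteq> {}"
      then obtain x a b where "a < x" "x < b" "F b - F a < \<alpha> * (b - a)"
        unfolding slope_below_def using zero_less_one by blast
      moreover have "\<alpha> * (b - a) \<le> 0" using False calculation by (simp add: mult_nonpos_nonneg)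
      moreover have "F a \<le> F b" using \<open>mono F\<close> calculation by (simp add: monoD)
      ultimately show False by linarith
    qed
    then show ?thesis by (simp add: A_def)
  next
    case True
    have *: "\<beta> * measure lebesgue A \<le> \<alpha> * (measure lebesgue A + \<eta>)" if "\<eta> > 0" for \<eta>
    proof -
      obtain V where V: "open V" "A \<subseteq> V" "V \<in> lmeasurable" "measure lebesgue V < measure lebesgue A + \<eta>"
        using lmeasurable_outer_open[OF \<open>A \<in> lmeasurable\<close> \<open>\<eta> > 0\<close>] by blast
      define K where "K = {i. fst i < snd i \<and> {fst i..snd i} \<subseteq> V \<and> F (snd i) - F (fst i) < \<alpha> * (snd i - fst i)}"
      have cov: "\<exists>i\<in>K. fst i < x \<and> x < snd i \<and> snd i - fst i < d" if "x \<in> A" "0 < d" for x d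
      proof -
        obtain e where e: "e > 0" "ball x e \<subseteq> V" using V(1,2) \<open>x \<in> A\<close> openE by blast
        obtain a b where ab: "a < x" "x < b" "b - a < min d e" "F b - F a < \<alpha> * (b - a)"
          using slope_belowD[of x F \<alpha> "min d e"] \<open>x \<in> A\<close> \<open>0 < d\<close> e(1) unfolding A_def by auto
        have "{a..b} \<subseteq> ball x e" using ab by (auto simp: dist_real_def)
        then show ?thesis using ab e unfolding K_def by (intro bexI[of _ "(a, b)"]) auto
      qed
      obtain C where C: "countable C" "C \<subseteq> K"
        "pairwise (\<lambda>i j. disjnt {fst i..snd i} {fst j..snd j}) C"
        "negligible (A - (\<Union>i\<in>C. {fst i<..<snd i}))"
        using vitali_intervals[OF _ cov] unfolding K_def by auto
      define A' where "A' = A \<inter> (\<Union>i\<in>C. {fst i<..<snd i})"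
      \<comment> \<open>Each interval of the second covering must lie inside a single selected
        interval of the first; otherwise its increment could not be charged to that
        interval.\<close>
      define K' where "K' = {j. fst j < snd j \<and> (\<exists>i\<in>C. fst i < fst j \<and> snd j < snd i) \<and>
        F (snd j) - F (fst j) > \<beta> * (snd j - fst j)}"
      have cov': "\<exists>i\<in>K'. fst i < x \<and> x < snd i \<and> snd i - fst i < d" if "x \<in> A'" "0 < d" for x d
      proof -
        obtain i where i: "i \<in> C" "fst i < x" "x < snd i" using \<open>x \<in> A'\<close> unfolding A'_def by auto
        define e where "e = min d (min (x - fst i) (snd i - x))"
        have "e > 0" using i \<open>0 < d\<close> by (simp add: e_def)
        then obtain a b where ab: "a < x" "x < b" "b - a < e" "F b - F a > \<beta> * (b - a)"
          using slope_aboveD[of x F \<beta> e] \<open>x \<in> A'\<close> unfolding A'_def A_def by auto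
        then have "fst i < a" "b < snd i" "b - a < d" unfolding e_def by linarith+
        then show ?thesis using ab i unfolding K'_def by (intro bexI[of _ "(a, b)"]) auto
      qed
      have lenV: "(\<Sum>i\<in>I. snd i - fst i) \<le> measure lebesgue V" if "finite I" "I \<subseteq> C" for I
      proof -
        have "(\<Sum>i\<in>I. snd i - fst i) = (\<Sum>i\<in>I. measure lebesgue {fst i..snd i})"
          using that C(2) unfolding K_def by (intro sum.cong) auto
        also have "\<dots> = measure lebesgue (\<Union>i\<in>I. {fst i..snd i})"
        proof (rule measure_finite_Union[symmetric])
          show "disjoint_family_on (\<lambda>i. {fst i..snd i}) I"
            using C(3) that(2) unfolding pairwise_def disjoint_family_on_def disjnt_def by blast
        qed (use that in \<open>auto simp: emeasure_lborel_Icc_eq\<close>)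
        also have "\<dots> \<le> measure lebesgue V"
          using that C(2) V(3) unfolding K_def by (intro measure_mono_fmeasurable) auto
        finally show ?thesis .
      qed
      have bound: "(\<Sum>j\<in>I. snd j - fst j) \<le> \<alpha> * measure lebesgue V / \<beta>"
        if I: "finite I" "I \<subseteq> K'" "pairwise (\<lambda>i j. disjnt {fst i..snd i} {fst j..snd j}) I" for I
      proof -
        have "\<exists>i\<in>C. fst i < fst j \<and> snd j < snd i" if "j \<in> I" for j
          using that I(2) unfolding K'_def by auto
        \<comment> \<open>\<open>f\<close> charges every inner interval to an outer one; summing
          over its fibres compares the increments one outer interval at a time.\<close>
        then obtain f where f: "\<And>j. j \<in> I \<Longrightarrow> f j \<in> C \<and> fst (f j) < fst j \<and> snd j < snd (f j)"
          by metis
        have "\<beta> * (\<Sum>j\<in>I. snd j - fst j) \<le> (\<Sum>j\<in>I. F (snd j) - F (fst j))"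
          unfolding sum_distrib_left using I(2) unfolding K'_def by (intro sum_mono) auto
        also have "\<dots> = (\<Sum>i\<in>f ` I. \<Sum>j\<in>{j\<in>I. f j = i}. F (snd j) - F (fst j))"
          by (rule sum.image_gen[OF I(1)])
        also have "\<dots> \<le> (\<Sum>i\<in>f ` I. F (snd i) - F (fst i))"
        proof (rule sum_mono)
          fix i assume i: "i \<in> f ` I"
          show "(\<Sum>j\<in>{j\<in>I. f j = i}. F (snd j) - F (fst j)) \<le> F (snd i) - F (fst i)"
          proof (rule mono_sum_disjoint_increments[OF \<open>mono F\<close>])
            show "fst i \<le> snd i" using i f C(2) unfolding K_def by force
            show "fst i \<le> fst j \<and> fst j < snd j \<and> snd j \<le> snd i" if "j \<in> {j\<in>I. f j = i}" for j
              using f[of j] that I(2) unfolding K'_def by force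
            show "pairwise (\<lambda>i j. disjnt {fst i..snd i} {fst j..snd j}) {j \<in> I. f j = i}"
              by (rule pairwise_mono[OF I(3)]) auto
          qed (use I in auto)
        qed
        also have "\<dots> \<le> (\<Sum>i\<in>f ` I. \<alpha> * (snd i - fst i))"
          using f C(2) unfolding K_def by (intro sum_mono) (auto simp: subset_iff intro!: less_imp_le)
        also have "\<dots> \<le> \<alpha> * measure lebesgue V"
          unfolding sum_distrib_left[symmetric]
        proof (rule mult_left_mono)
          have "f ` I \<subseteq> C" using f by blast
          then show "(\<Sum>i\<in>f ` I. snd i - fst i) \<le> measure lebesgue V"
            using lenV[of "f ` I"] I(1) by blast
        qed (use True in simp)
        finally show ?thesis using True \<open>\<alpha> < \<beta>\<close> by (simp add: field_simps)
      qed
      have A': "A' \<in> sets lebesgue" unfolding A'_def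
        using \<open>A \<in> lmeasurable\<close> C(1) by (auto intro!: sets.Int sets.countable_UN')
      have "measure lebesgue A' \<le> \<alpha> * measure lebesgue V / \<beta>"
        by (rule vitali_measure_bound(2)[OF _ cov' A' bound]) (auto simp: K'_def)
      moreover have "measure lebesgue A' = measure lebesgue A"
      proof (rule measure_negligible_symdiff[OF \<open>A \<in> lmeasurable\<close>])
        show "negligible (A - A' \<union> (A' - A))"
          using C(4) by (rule negligible_subset) (auto simp: A'_def)
      qed
      ultimately have "\<beta> * measure lebesgue A \<le> \<alpha> * measure lebesgue V"
        using True \<open>\<alpha> < \<beta>\<close> by (simp add: field_simps)
      also have "\<dots> \<le> \<alpha> * (measure lebesgue A + \<eta>)" using V(4) True by simp
      finally show ?thesis .
    qed
    have "(\<beta> - \<alpha>) * measure lebesgue A \<le> \<alpha> * \<eta>" if "\<eta> > 0" for \<eta>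
      using *[OF that] by (simp add: algebra_simps)
    \<comment> \<open>For this \<open>\<eta>\<close> the right side is half of the left one, which
      forces measure zero.\<close>
    from this[of "(\<beta> - \<alpha>) * measure lebesgue A / (2 * \<alpha>)"]
    have "measure lebesgue A = 0"
      using True \<open>\<alpha> < \<beta>\<close> measure_nonneg[of lebesgue A]
      by (cases "measure lebesgue A = 0") (auto simp: field_simps)
    then show ?thesis using \<open>A \<in> lmeasurable\<close> by (simp add: negligible_iff_measure)
  qed
  then show "negligible (slope_below F \<alpha> \<inter> slope_above F \<beta> \<inter> {- real n<..<real n})"
    unfolding A_def .
qed

text \<open>Disjoint intervals of slope above \<open>k\<close> inside a bounded window have total
  length at most the increment of \<open>F\<close> over the window divided by \<open>k\<close>; then
  \<open>k\<close> tends to infinity.\<close>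

lemma negligible_slope_infinite:
  assumes "mono F"
  shows "negligible (\<Inter>k::nat. slope_above F (real k))"
proof (rule negligible_bounded_parts)
  fix n :: nat
  define A where "A = (\<Inter>k::nat. slope_above F (real k)) \<inter> {- real n<..<real n}"
  have "A \<in> lmeasurable" unfolding A_def
    by (intro bounded_part_lmeasurable sets.countable_INT') (auto simp: slope_above_lebesgue)
  have "measure lebesgue A \<le> (F (real n) - F (- real n)) / k" if "k > 0" for k :: nat
  proof -
    define K where "K = {i :: real \<times> real. - real n < fst i \<and> fst i < snd i \<and> snd i < real n \<and>
      F (snd i) - F (fst i) > k * (snd i - fst i)}"
    show ?thesis
    proof (rule vitali_measure_bound(2)[of K A])
      fix x d :: real assume "x \<in> A" "0 < d"
      define e where "e = min d (min (x + real n) (real n - x))"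
      have "e > 0" using \<open>x \<in> A\<close> \<open>0 < d\<close> by (simp add: e_def A_def)
      then obtain a b :: real where ab: "a < x" "x < b" "b - a < e" "F b - F a > k * (b - a)"
        using slope_aboveD[of x F "real k" e] \<open>x \<in> A\<close> unfolding A_def by blast
      then have "- real n < a" "b < real n" "b - a < d" unfolding e_def by linarith+
      then show "\<exists>i\<in>K. fst i < x \<and> x < snd i \<and> snd i - fst i < d"
        using ab unfolding K_def by (intro bexI[of _ "(a, b)"]) auto
    next
      fix I assume I: "finite I" "I \<subseteq> K" "pairwise (\<lambda>i j. disjnt {fst i..snd i} {fst j..snd j}) I"
      have "k * (\<Sum>j\<in>I. snd j - fst j) \<le> (\<Sum>j\<in>I. F (snd j) - F (fst j))"
        unfolding sum_distrib_left using I(2) unfolding K_def by (intro sum_mono) auto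
      also have "\<dots> \<le> F (real n) - F (- real n)"
        using I unfolding K_def
        by (intro mono_sum_disjoint_increments[OF \<open>mono F\<close>]) (auto simp: subset_iff less_imp_le)
      finally show "(\<Sum>j\<in>I. snd j - fst j) \<le> (F (real n) - F (- real n)) / k"
        using \<open>k > 0\<close> by (simp add: field_simps)
    qed (use \<open>A \<in> lmeasurable\<close> in \<open>auto simp: K_def\<close>)
  qed
  then have "\<forall>\<^sub>F k in sequentially. measure lebesgue A \<le> (F (real n) - F (- real n)) / real k"
    by (auto intro: eventually_sequentiallyI[of 1])
  moreover have "(\<lambda>k. (F (real n) - F (- real n)) / real k) \<longlonglongrightarrow> 0"
    by (rule lim_const_over_n)
  ultimately have "measure lebesgue A \<le> 0"
    by (intro tendsto_lowerbound[OF _ _ sequentially_bot])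
  then have "measure lebesgue A = 0" by (simp add: measure_le_0_iff)
  then have "negligible A" using \<open>A \<in> lmeasurable\<close> by (simp add: negligible_iff_measure)
  then show "negligible ((\<Inter>k::nat. slope_above F (real k)) \<inter> {- real n<..<real n})"
    unfolding A_def .
qed

text \<open>The derivative is \<open>L\<close>, the infimum of the slopes that are eventually not
  exceeded. If some \<open>\<alpha> < L\<close> were undercut over arbitrarily short intervals
  around \<open>x\<close>, two rationals between \<open>\<alpha>\<close> and \<open>L\<close> would
  contradict the gap hypothesis; so all slopes over short intervals around \<open>x\<close> are
  close to \<open>L\<close>.\<close>

lemma mono_differentiable_if_slopes:
  fixes F :: "real \<Rightarrow> real"
  assumes F: "mono F"
    and fin: "x \<notin> slope_above F \<gamma>"
    and gap: "\<And>\<alpha> \<beta>. \<alpha> \<in> \<rat> \<Longrightarrow> \<beta> \<in> \<rat> \<Longrightarrow> \<alpha> < \<beta> \<Longrightarrow> x \<notin> slope_below F \<alpha> \<inter> slope_above F \<beta>"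
  shows "F differentiable (at x)"
proof -
  have mono_above: "x \<notin> slope_above F \<beta>'" if "x \<notin> slope_above F \<beta>" "\<beta> \<le> \<beta>'" for \<beta> \<beta>'
  proof
    assume "x \<in> slope_above F \<beta>'"
    moreover have "\<beta> * (b - a) \<le> \<beta>' * (b - a)" if "a < x" "x < b" for a b
      using \<open>\<beta> \<le> \<beta>'\<close> that by (intro mult_right_mono) auto
    ultimately have "x \<in> slope_above F \<beta>"
      unfolding slope_above_def mem_Collect_eq by (meson le_less_trans)
    then show False using that by simp
  qed
  define U where "U = {\<beta>. x \<notin> slope_above F \<beta>}"
  define L where "L = Inf U"
  have "U \<noteq> {}" using fin by (auto simp: U_def)
  \<comment> \<open>\<open>-1\<close> stands for any negative number: it bounds \<open>U\<close>
    from below and later makes \<open>L + 1\<close> nonnegative.\<close>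
  have lb: "-1 \<le> \<beta>" if "\<beta> \<in> U" for \<beta>
  proof (rule ccontr)
    assume "\<not> -1 \<le> \<beta>"
    have "x \<in> slope_above F \<beta>" unfolding slope_above_def
    proof safe
      fix d :: real assume "d > 0"
      have "F (x - d/3) \<le> F (x + d/3)" using F \<open>d > 0\<close> by (simp add: monoD)
      moreover have "\<beta> * ((x + d/3) - (x - d/3)) < 0"
        using \<open>\<not> -1 \<le> \<beta>\<close> \<open>d > 0\<close> by (intro mult_neg_pos) auto
      ultimately show "\<exists>a b. a < x \<and> x < b \<and> b - a < d \<and> \<beta> * (b - a) < F b - F a"
        using \<open>d > 0\<close> by (intro exI[of _ "x - d/3"] exI[of _ "x + d/3"]) (auto simp: field_simps)
    qed
    then show False using that by (simp add: U_def)
  qed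
  have bdd: "bdd_below U" using lb by (rule bdd_belowI)
  have above: "\<exists>d>0. \<forall>a b. a < x \<and> x < b \<and> b - a < d \<longrightarrow> F b - F a \<le> \<beta> * (b - a)" if "L < \<beta>" for \<beta>
  proof -
    obtain \<beta>' where "\<beta>' \<in> U" "\<beta>' < \<beta>"
      using \<open>L < \<beta>\<close> \<open>U \<noteq> {}\<close> bdd unfolding L_def by (auto simp: cInf_less_iff)
    then have "x \<notin> slope_above F \<beta>" using mono_above unfolding U_def by auto
    then obtain d where "d > 0" "\<And>a b. a < x \<and> x < b \<and> b - a < d \<Longrightarrow> \<not> \<beta> * (b - a) < F b - F a"
      unfolding slope_above_def by blast
    then show ?thesis by (intro exI[of _ d]) (auto simp: not_less)
  qed
  have below: "\<exists>d>0. \<forall>a b. a < x \<and> x < b \<and> b - a < d \<longrightarrow> \<alpha> * (b - a) \<le> F b - F a" if "\<alpha> < L" for \<alpha>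
  proof -
    obtain \<beta> where b: "\<beta> \<in> \<rat>" "\<alpha> < \<beta>" "\<beta> < L" using Rats_dense_in_real[OF \<open>\<alpha> < L\<close>] by blast
    obtain \<alpha>' where a: "\<alpha>' \<in> \<rat>" "\<alpha> < \<alpha>'" "\<alpha>' < \<beta>" using Rats_dense_in_real[of \<alpha> \<beta>] b(2) by blast
    have "x \<in> slope_above F \<beta>"
      using b(3) cInf_lower[OF _ bdd] unfolding L_def U_def by force
    then have "x \<notin> slope_below F \<alpha>'" using gap[OF a(1) b(1) a(3)] by simp
    then obtain d where d: "d > 0" "\<And>a b. a < x \<and> x < b \<and> b - a < d \<Longrightarrow> \<alpha>' * (b - a) \<le> F b - F a"
      unfolding slope_below_def mem_Collect_eq not_all not_imp not_ex by (metis not_less)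
    have "\<alpha> * (b - c) \<le> F b - F c" if "c < x \<and> x < b \<and> b - c < d" for c b
    proof -
      have "\<alpha> * (b - c) \<le> \<alpha>' * (b - c)" using a(2) that by (intro mult_right_mono) auto
      then show ?thesis using d(2)[OF that] by linarith
    qed
    then show ?thesis using d(1) by blast
  qed
  obtain d1 where d1: "d1 > 0" "\<And>a b. a < x \<Longrightarrow> x < b \<Longrightarrow> b - a < d1 \<Longrightarrow> F b - F a \<le> (L + 1) * (b - a)"
    using above[of "L + 1"] by auto
  have "0 \<le> L + 1" using cInf_greatest[OF \<open>U \<noteq> {}\<close> lb] by (simp add: L_def)
  \<comment> \<open>Slopes are controlled only over intervals around \<open>x\<close>; continuity
    lets one endpoint tend to \<open>x\<close>, which yields the one-sided difference
    quotients.\<close>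
  have "isCont F x"
    unfolding continuous_at_eps_delta
  proof safe
    fix e :: real assume "e > 0"
    \<comment> \<open>\<open>d1 / 2\<close> keeps the interval of radius \<open>r < d\<close>
      shorter than \<open>d1\<close>; the divisor is \<open>L + 2\<close> because
      \<open>L + 1\<close> is only known to be nonnegative.\<close>
    define d where "d = min (d1 / 2) (e / (2 * (L + 2)))"
    have "L + 2 > 0" using \<open>0 \<le> L + 1\<close> by simp
    then have "d > 0" using d1(1) \<open>e > 0\<close> by (simp add: d_def)
    have small: "(L + 1) * (2 * d) < e"
    proof -
      have "(L + 1) * (2 * d) < (L + 2) * (2 * d)" using \<open>d > 0\<close> by simp
      also have "\<dots> \<le> (L + 2) * (2 * (e / (2 * (L + 2))))"
        using \<open>L + 2 > 0\<close> by (intro mult_left_mono) (auto simp: d_def)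
      also have "\<dots> = e" using \<open>L + 2 > 0\<close> by (simp add: field_simps)
      finally show ?thesis .
    qed
    have "\<bar>F y - F x\<bar> < e" if "\<bar>y - x\<bar> < d" for y
    proof -
      define r where "r = (\<bar>y - x\<bar> + d) / 2"
      have r: "\<bar>y - x\<bar> < r" "r < d" "0 < r" using that abs_ge_zero[of "y - x"] by (simp_all add: r_def field_simps)
      have "F (x + r) - F (x - r) \<le> (L + 1) * ((x + r) - (x - r))"
        using r by (intro d1(2)) (auto simp: d_def)
      also have "\<dots> = (L + 1) * (2 * r)" by simp
      also have "\<dots> \<le> (L + 1) * (2 * d)" using r \<open>0 \<le> L + 1\<close> by (intro mult_left_mono) auto
      finally have "F (x + r) - F (x - r) < e" using small by linarith
      moreover have "F (x - r) \<le> F y" "F y \<le> F (x + r)" "F (x - r) \<le> F x" "F x \<le> F (x + r)"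
        using F r by (auto simp: monoD)
      ultimately show ?thesis by linarith
    qed
    then show "\<exists>d>0. \<forall>y. dist y x < d \<longrightarrow> dist (F y) (F x) < e"
      using \<open>d > 0\<close> by (auto simp: dist_real_def)
  qed
  have onesided: "\<exists>d>0. \<forall>y. \<bar>y - x\<bar> < d \<longrightarrow> \<bar>F y - F x - L * (y - x)\<bar> \<le> e * \<bar>y - x\<bar>" if "e > 0" for e
  proof -
    obtain d2 where d2: "d2 > 0" "\<And>a b. a < x \<Longrightarrow> x < b \<Longrightarrow> b - a < d2 \<Longrightarrow> F b - F a \<le> (L + e) * (b - a)"
      using above[of "L + e"] \<open>e > 0\<close> by auto
    obtain d3 where d3: "d3 > 0" "\<And>a b. a < x \<Longrightarrow> x < b \<Longrightarrow> b - a < d3 \<Longrightarrow> (L - e) * (b - a) \<le> F b - F a"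
      using below[of "L - e"] \<open>e > 0\<close> by auto
    define d where "d = min d2 d3"
    have d: "\<bar>F b - F a - L * (b - a)\<bar> \<le> e * (b - a)" if "a < x" "x < b" "b - a < d" for a b
      using d2(2)[of a b] d3(2)[of a b] that by (auto simp: d_def algebra_simps abs_le_iff)
    have "\<bar>F y - F x - L * (y - x)\<bar> \<le> e * \<bar>y - x\<bar>" if y: "\<bar>y - x\<bar> < d" for y
    proof (cases y x rule: linorder_cases)
      case greater
      have lim: "((\<lambda>a. e * (y - a) - \<bar>F y - F a - L * (y - a)\<bar>) \<longlongrightarrow>
          e * (y - x) - \<bar>F y - F x - L * (y - x)\<bar>) (at_left x)"
        by (intro tendsto_intros tendsto_within_subset[OF isContD[OF \<open>isCont F x\<close>]]) simp
      have "\<forall>\<^sub>F a in at_left x. 0 \<le> e * (y - a) - \<bar>F y - F a - L * (y - a)\<bar>"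
        using y greater d[of _ y] by (auto simp: eventually_at_left[of "y - d"] intro!: exI[of _ "y - d"])
      then have "0 \<le> e * (y - x) - \<bar>F y - F x - L * (y - x)\<bar>"
        by (rule tendsto_lowerbound[OF lim]) simp
      then show ?thesis using greater by simp
    next
      case less
      have lim: "((\<lambda>b. e * (b - y) - \<bar>F b - F y - L * (b - y)\<bar>) \<longlongrightarrow>
          e * (x - y) - \<bar>F x - F y - L * (x - y)\<bar>) (at_right x)"
        by (intro tendsto_intros tendsto_within_subset[OF isContD[OF \<open>isCont F x\<close>]]) simp
      have "\<forall>\<^sub>F b in at_right x. 0 \<le> e * (b - y) - \<bar>F b - F y - L * (b - y)\<bar>"
        using y less d[of y] by (auto simp: eventually_at_right[of _ "y + d"] intro!: exI[of _ "y + d"])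
      then have "0 \<le> e * (x - y) - \<bar>F x - F y - L * (x - y)\<bar>"
        by (rule tendsto_lowerbound[OF lim]) simp
      moreover have "F x - F y - L * (x - y) = - (F y - F x - L * (y - x))" by (simp add: algebra_simps)
      ultimately show ?thesis using less by (simp only: abs_minus_cancel) simp
    qed simp
    then show ?thesis using d2(1) d3(1) by (intro exI[of _ d]) (auto simp: d_def)
  qed
  have "(F has_derivative (*) L) (at x)"
    unfolding has_derivative_at_alt using onesided by (auto intro: bounded_linear_mult_right)
  then show ?thesis by (rule differentiableI)
qed

text \<open>Lebesgue's theorem. Rational pairs of slopes suffice, so the exceptional set is a
  countable union of null sets.\<close>

lemma mono_differentiable_ae:
  fixes F :: "real \<Rightarrow> real"
  assumes "mono F"
  shows "negligible {x. \<not> F differentiable (at x)}"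
proof -
  define N where "N = (\<Union>p\<in>{p\<in>\<rat> \<times> \<rat>. fst p < snd p}. slope_below F (fst p) \<inter> slope_above F (snd p))"
  have "countable {p\<in>\<rat> \<times> \<rat> :: (real \<times> real) set. fst p < snd p}"
    by (rule countable_subset[of _ "\<rat> \<times> \<rat>"]) (auto simp: countable_rat)
  then have "negligible N" unfolding N_def
    by (intro negligible_countable_Union) (auto intro: negligible_slope_gap[OF assms])
  then have "negligible (N \<union> (\<Inter>k::nat. slope_above F (real k)))"
    using negligible_slope_infinite[OF assms] by (rule negligible_Un)
  moreover have "{x. \<not> F differentiable (at x)} \<subseteq> N \<union> (\<Inter>k::nat. slope_above F (real k))"
  proof
    fix x assume x: "x \<in> {x. \<not> F differentiable (at x)}"
    show "x \<in> N \<union> (\<Inter>k::nat. slope_above F (real k))"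
    proof (rule ccontr)
      assume c: "x \<notin> N \<union> (\<Inter>k::nat. slope_above F (real k))"
      then obtain k :: nat where "x \<notin> slope_above F (real k)" by auto
      then have "F differentiable (at x)"
        using c by (intro mono_differentiable_if_slopes[OF assms]) (force simp: N_def)+
      then show False using x by simp
    qed
  qed
  ultimately show ?thesis by (rule negligible_subset)
qed

section \<open>Absolutely continuous curves\<close>

lemma sum_lengths_le_measure:
  fixes a b :: "'i \<Rightarrow> real"
  assumes "finite I" "\<And>i. i \<in> I \<Longrightarrow> a i \<le> b i" "disjoint_family_on (\<lambda>i. {a i<..<b i}) I"
    and "V \<in> lmeasurable" "\<And>i. i \<in> I \<Longrightarrow> {a i<..<b i} \<subseteq> V"
  shows "(\<Sum>i\<in>I. b i - a i) \<le> measure lebesgue V"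
proof -
  have "(\<Sum>i\<in>I. b i - a i) = (\<Sum>i\<in>I. measure lebesgue {a i<..<b i})"
    using assms(2) by (intro sum.cong) auto
  also have "\<dots> = measure lebesgue (\<Union>i\<in>I. {a i<..<b i})"
    by (rule measure_finite_Union[symmetric]) (use assms in \<open>auto simp: emeasure_lborel_Ioo\<close>)
  also have "\<dots> \<le> measure lebesgue V"
    using assms by (intro measure_mono_fmeasurable) auto
  finally show ?thesis .
qed

text \<open>The definition indexes intervals by an initial segment of the naturals. Arbitrary finite
  index sets occur below, in particular the tagged cells of a division.\<close>

lemma AC_curvesD:
  assumes "q \<in> AC_curves T" "e > 0"
  shows "\<exists>d>0. \<forall>(I::'i set) a b. finite I \<longrightarrow> (\<forall>i\<in>I. 0 \<le> a i \<and> a i \<le> b i \<and> b i \<le> T) \<longrightarrow>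
    disjoint_family_on (\<lambda>i. {a i<..<b i}) I \<longrightarrow> (\<Sum>i\<in>I. b i - a i) < d \<longrightarrow>
    (\<Sum>i\<in>I. \<bar>q (b i) - q (a i)\<bar>) < e"
proof -
  obtain d where d: "d > 0" "\<And>(n::nat) a b. (\<forall>i<n. 0 \<le> a i \<and> a i \<le> b i \<and> b i \<le> T) \<and>
     disjoint_family_on (\<lambda>i. {a i<..<b i}) {..<n} \<and> (\<Sum>i<n. b i - a i) < d
     \<Longrightarrow> (\<Sum>i<n. \<bar>q (b i) - q (a i)\<bar>) < e"
    using assms unfolding AC_curves_def by blast
  show ?thesis
  proof (intro exI[of _ d] conjI allI impI d(1))
    fix I :: "'i set" and a b :: "'i \<Rightarrow> real"
    assume I: "finite I" "\<forall>i\<in>I. 0 \<le> a i \<and> a i \<le> b i \<and> b i \<le> T"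
      "disjoint_family_on (\<lambda>i. {a i<..<b i}) I" "(\<Sum>i\<in>I. b i - a i) < d"
    obtain h where h: "bij_betw h {..<card I} I"
      using ex_bij_betw_nat_finite[OF I(1)] by (auto simp: atLeast0LessThan)
    have s: "(\<Sum>i\<in>I. g i) = (\<Sum>j<card I. g (h j))" for g :: "'i \<Rightarrow> real"
      by (rule sum.reindex_bij_betw[OF h, symmetric])
    have "(\<Sum>j<card I. \<bar>q (b (h j)) - q (a (h j))\<bar>) < e"
    proof (rule d(2)[of "card I" "\<lambda>j. a (h j)" "\<lambda>j. b (h j)"], intro conjI allI impI)
      fix j assume "j < card I"
      then have "h j \<in> I" using h by (auto simp: bij_betw_def)
      then show "0 \<le> a (h j)" "a (h j) \<le> b (h j)" "b (h j) \<le> T" using I(2) by auto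
    next
      show "disjoint_family_on (\<lambda>j. {a (h j)<..<b (h j)}) {..<card I}"
        unfolding disjoint_family_on_def
      proof (intro ballI impI)
        fix j k assume jk: "j \<in> {..<card I}" "k \<in> {..<card I}" "j \<noteq> k"
        then have "h j \<noteq> h k" "h j \<in> I" "h k \<in> I"
          using h by (auto simp: bij_betw_def inj_on_def)
        then show "{a (h j)<..<b (h j)} \<inter> {a (h k)<..<b (h k)} = {}"
          using I(3) unfolding disjoint_family_on_def by blast
      qed
    next
      show "(\<Sum>j<card I. b (h j) - a (h j)) < d" using I(4) s[of "\<lambda>i. b i - a i"] by simp
    qed
    then show "(\<Sum>i\<in>I. \<bar>q (b i) - q (a i)\<bar>) < e" using s[of "\<lambda>i. \<bar>q (b i) - q (a i)\<bar>"] by simp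
  qed
qed

lemma AC_curves_uniform:
  assumes "q \<in> AC_curves T" "e > 0"
  shows "\<exists>d>0. \<forall>s t. 0 \<le> s \<longrightarrow> s \<le> t \<longrightarrow> t \<le> T \<longrightarrow> t - s < d \<longrightarrow> \<bar>q t - q s\<bar> < e"
proof -
  obtain d where d: "d > 0" "\<forall>(I::nat set) a b. finite I \<longrightarrow> (\<forall>i\<in>I. 0 \<le> a i \<and> a i \<le> b i \<and> b i \<le> T) \<longrightarrow>
    disjoint_family_on (\<lambda>i. {a i<..<b i}) I \<longrightarrow> (\<Sum>i\<in>I. b i - a i) < d \<longrightarrow>
    (\<Sum>i\<in>I. \<bar>q (b i) - q (a i)\<bar>) < e"
    using AC_curvesD[OF assms, where 'i = nat] by (elim exE conjE)
  show ?thesis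
  proof (intro exI[of _ d] conjI allI impI d(1))
    fix s t assume "0 \<le> s" "s \<le> t" "t \<le> T" "t - s < d"
    then show "\<bar>q t - q s\<bar> < e"
      using d(2)[rule_format, of "{0}" "\<lambda>_. s" "\<lambda>_. t"] by (simp add: disjoint_family_on_def)
  qed
qed

lemma AC_curves_continuous:
  assumes "q \<in> AC_curves T"
  shows "continuous_on {0..T} q"
  unfolding continuous_on_iff
proof (intro ballI allI impI)
  fix x e :: real assume x: "x \<in> {0..T}" "e > 0"
  obtain d where d: "d > 0" "\<And>s t. 0 \<le> s \<Longrightarrow> s \<le> t \<Longrightarrow> t \<le> T \<Longrightarrow> t - s < d \<Longrightarrow> \<bar>q t - q s\<bar> < e"
    using AC_curves_uniform[OF assms x(2)] by blast
  have "dist (q y) (q x) < e" if y: "y \<in> {0..T}" "dist y x < d" for y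
  proof (cases "x \<le> y")
    case True
    then show ?thesis using d(2)[of x y] x y by (auto simp: dist_real_def)
  next
    case False
    then show ?thesis using d(2)[of y x] x y by (auto simp: dist_real_def abs_minus_commute)
  qed
  then show "\<exists>d>0. \<forall>y\<in>{0..T}. dist y x < d \<longrightarrow> dist (q y) (q x) < e"
    using d(1) by blast
qed

text \<open>Sums over disjoint families of intervals rather than over partitions: the supremum is
  still the total variation, and the families are those of \<open>AC_curves\<close>.\<close>

definition variation_sums :: "(real \<Rightarrow> real) \<Rightarrow> real \<Rightarrow> real set" where
  "variation_sums f x = {\<Sum>i<n. \<bar>f (b i) - f (a i)\<bar> | (n::nat) a b.
     (\<forall>i<n. 0 \<le> a i \<and> a i \<le> b i \<and> b i \<le> x) \<and> disjoint_family_on (\<lambda>i. {a i<..<b i}) {..<n}}"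

text \<open>Absolute continuity with tolerance 1 bounds the variation over any window of length
  \<open>\<delta>\<close> by 1, and finitely many windows cover \<open>{0..T}\<close>. The induction
  adds one window at a time.\<close>

lemma AC_curves_variation_bound:
  assumes "q \<in> AC_curves T" "0 \<le> T"
  shows "\<exists>B. \<forall>s\<in>variation_sums q T. s \<le> B"
proof -
  obtain d where d: "d > 0" "\<forall>(I::nat set) a b. finite I \<longrightarrow> (\<forall>i\<in>I. 0 \<le> a i \<and> a i \<le> b i \<and> b i \<le> T) \<longrightarrow>
    disjoint_family_on (\<lambda>i. {a i<..<b i}) I \<longrightarrow> (\<Sum>i\<in>I. b i - a i) < d \<longrightarrow>
    (\<Sum>i\<in>I. \<bar>q (b i) - q (a i)\<bar>) < 1"
    using AC_curvesD[OF assms(1) zero_less_one, where 'i = nat] by (elim exE conjE)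
  define \<delta> where "\<delta> = d / 2"
  have "\<delta> > 0" "\<delta> < d" using d(1) by (auto simp: \<delta>_def)
  have *: "(\<Sum>i<n. \<bar>q (b i) - q (a i)\<bar>) \<le> real k"
    if "\<forall>i<n. 0 \<le> a i \<and> a i \<le> b i \<and> b i \<le> min (real k * \<delta>) T" "disjoint_family_on (\<lambda>i. {a i<..<b i}) {..<n}"
    for k n :: nat and a b :: "nat \<Rightarrow> real"
    using that
  proof (induction k arbitrary: a b)
    case 0
    then have "a i = b i" if "i < n" for i using that \<open>0 \<le> T\<close> by force
    then show ?case by simp
  next
    case (Suc k)
    define c where "c = min (real k * \<delta>) T"
    have c: "0 \<le> c" "c \<le> T" using \<open>0 < \<delta>\<close> \<open>0 \<le> T\<close> by (auto simp: c_def)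
    \<comment> \<open>Clipping both endpoints at \<open>c\<close>, with \<open>min\<close> here and
      with \<open>max\<close> below, cuts every interval at \<open>c\<close>, also one that
      straddles it, and keeps the families disjoint.\<close>
    have "(\<Sum>i<n. \<bar>q (min (b i) c) - q (min (a i) c)\<bar>) \<le> real k"
    proof (rule Suc.IH)
      show "\<forall>i<n. 0 \<le> min (a i) c \<and> min (a i) c \<le> min (b i) c \<and> min (b i) c \<le> min (real k * \<delta>) T"
        using Suc.prems(1) c unfolding c_def by auto
      show "disjoint_family_on (\<lambda>i. {min (a i) c<..<min (b i) c}) {..<n}"
        by (rule disjoint_family_on_bisimulation[OF Suc.prems(2)]) (auto simp: min_def split: if_splits)
    qed
    moreover have "(\<Sum>i<n. \<bar>q (max (b i) c) - q (max (a i) c)\<bar>) < 1"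
    proof (rule d(2)[rule_format])
      show "0 \<le> max (a i) c \<and> max (a i) c \<le> max (b i) c \<and> max (b i) c \<le> T" if "i \<in> {..<n}" for i
        using Suc.prems(1) that c by auto
      show disj: "disjoint_family_on (\<lambda>i. {max (a i) c<..<max (b i) c}) {..<n}"
        by (rule disjoint_family_on_bisimulation[OF Suc.prems(2)]) (auto simp: max_def split: if_splits)
      have "(\<Sum>i<n. max (b i) c - max (a i) c) \<le> measure lebesgue {c..c + \<delta>}"
      proof (rule sum_lengths_le_measure[OF _ _ disj])
        show "{max (a i) c<..<max (b i) c} \<subseteq> {c..c + \<delta>}" if "i \<in> {..<n}" for i
        proof -
          have "b i \<le> min (real (Suc k) * \<delta>) T" using Suc.prems(1) that by blast
          also have "\<dots> \<le> c + \<delta>" using \<open>0 < \<delta>\<close> by (auto simp: c_def min_def algebra_simps)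
          finally show ?thesis using \<open>0 < \<delta>\<close> by auto
        qed
      qed (use Suc.prems(1) in \<open>auto simp: max_def\<close>)
      then show "(\<Sum>i<n. max (b i) c - max (a i) c) < d" using \<open>\<delta> < d\<close> \<open>0 < \<delta>\<close> by simp
    qed simp
    moreover have "(\<Sum>i<n. \<bar>q (b i) - q (a i)\<bar>) \<le>
      (\<Sum>i<n. \<bar>q (min (b i) c) - q (min (a i) c)\<bar>) + (\<Sum>i<n. \<bar>q (max (b i) c) - q (max (a i) c)\<bar>)"
      unfolding sum.distrib[symmetric] using Suc.prems(1)
      by (intro sum_mono) (auto simp: min_def max_def split: if_splits)
    ultimately show ?case by simp
  qed
  obtain k :: nat where k: "T \<le> real k * \<delta>"
    using reals_Archimedean3[OF \<open>0 < \<delta>\<close>] less_imp_le by blast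
  have "s \<le> real k" if "s \<in> variation_sums q T" for s
    using that *[of _ _ _ k] k unfolding variation_sums_def by (auto simp: min_absorb2)
  then show ?thesis by blast
qed

text \<open>Jordan decomposition: the variation up to \<open>t\<close> and its difference with
  \<open>q\<close> are both increasing.\<close>

lemma AC_curves_mono_diff:
  assumes q: "q \<in> AC_curves T" and "0 \<le> T"
  obtains G H where "mono G" "mono H" "\<And>t. t \<in> {0..T} \<Longrightarrow> q t = G t - H t"
proof -
  obtain B where B: "\<And>s. s \<in> variation_sums q T \<Longrightarrow> s \<le> B"
    using AC_curves_variation_bound[OF assms] by blast
  have sub: "variation_sums q x \<subseteq> variation_sums q T" if "x \<le> T" for x
  proof
    fix s assume "s \<in> variation_sums q x"
    then obtain n a b where "s = (\<Sum>i<n. \<bar>q (b i) - q (a i)\<bar>)"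
      "\<forall>i<n::nat. 0 \<le> a i \<and> a i \<le> b i \<and> b i \<le> x" "disjoint_family_on (\<lambda>i. {a i<..<b i}) {..<n}"
      unfolding variation_sums_def by blast
    moreover from this(2) have "\<forall>i<n. 0 \<le> a i \<and> a i \<le> b i \<and> b i \<le> T"
      using \<open>x \<le> T\<close> by force
    ultimately show "s \<in> variation_sums q T" unfolding variation_sums_def by blast
  qed
  have bdd: "bdd_above (variation_sums q x)" if "x \<le> T" for x
    using B sub[OF that] by (intro bdd_aboveI[of _ B]) blast
  have "0 \<in> variation_sums q x" for x
    unfolding variation_sums_def by (auto simp: disjoint_family_on_def intro!: exI[of _ 0])
  then have ne: "variation_sums q x \<noteq> {}" for x by blast
  define V where "V x = Sup (variation_sums q x)" for x
  \<comment> \<open>Appending the interval from \<open>x\<close> to \<open>y\<close> to a family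
    below \<open>x\<close> gives a family below \<open>y\<close>.\<close>
  have step: "V x + \<bar>q y - q x\<bar> \<le> V y" if xy: "0 \<le> x" "x \<le> y" "y \<le> T" for x y
  proof -
    have "s + \<bar>q y - q x\<bar> \<in> variation_sums q y" if s: "s \<in> variation_sums q x" for s
    proof -
      obtain n a b where nab: "s = (\<Sum>i<n. \<bar>q (b i) - q (a i)\<bar>)"
        "\<forall>i<n::nat. 0 \<le> a i \<and> a i \<le> b i \<and> b i \<le> x" "disjoint_family_on (\<lambda>i. {a i<..<b i}) {..<n}"
        using s unfolding variation_sums_def by blast
      let ?a = "a(n := x)" and ?b = "b(n := y)"
      have "s + \<bar>q y - q x\<bar> = (\<Sum>i<Suc n. \<bar>q (?b i) - q (?a i)\<bar>)"
        using nab(1) by simp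
      moreover have "\<forall>i<Suc n. 0 \<le> ?a i \<and> ?a i \<le> ?b i \<and> ?b i \<le> y"
        using nab(2) xy by (auto simp: less_Suc_eq intro: order_trans)
      moreover have "disjoint_family_on (\<lambda>i. {?a i<..<?b i}) {..<Suc n}"
      proof -
        have "{a i<..<b i} \<inter> {x<..<y} = {}" if "i < n" for i
          using nab(2) that by force
        moreover have "{x<..<y} \<inter> {a i<..<b i} = {}" if "i < n" for i
          using calculation[OF that] by blast
        ultimately show ?thesis using nab(3)
          unfolding disjoint_family_on_def lessThan_Suc by (simp del: Int_greaterThanLessThan)
      qed
      ultimately show ?thesis unfolding variation_sums_def by blast
    qed
    then have "s \<le> V y - \<bar>q y - q x\<bar>" if "s \<in> variation_sums q x" for s
      using cSup_upper[OF _ bdd[OF \<open>y \<le> T\<close>]] that unfolding V_def by force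
    then have "V x \<le> V y - \<bar>q y - q x\<bar>"
      unfolding V_def by (intro cSup_least[OF ne])
    then show ?thesis by simp
  qed
  \<comment> \<open>Clamping to \<open>{0..T}\<close> extends both parts to monotone functions on
    the whole line, the setting of the differentiation theorem.\<close>
  define c where "c t = max 0 (min T t)" for t :: real
  have c: "0 \<le> c t" "c t \<le> T" "s \<le> t \<Longrightarrow> c s \<le> c t" "t \<in> {0..T} \<Longrightarrow> c t = t" for s t
    using \<open>0 \<le> T\<close> by (auto simp: c_def)
  show thesis
  proof (rule that[of "\<lambda>t. V (c t)" "\<lambda>t. V (c t) - q (c t)"])
    show "mono (\<lambda>t. V (c t))"
      using step[OF c(1) c(3) c(2)] by (intro monoI) (smt (verit))
    show "mono (\<lambda>t. V (c t) - q (c t))"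
      using step[OF c(1) c(3) c(2)] by (intro monoI) (smt (verit))
    show "q t = V (c t) - (V (c t) - q (c t))" if "t \<in> {0..T}" for t
      using c(4)[OF that] by simp
  qed
qed

text \<open>Jordan decomposition and Lebesgue's theorem. The endpoints are discarded because
  \<open>q\<close> agrees with the decomposition only on \<open>{0..T}\<close>, not in a
  neighbourhood of them.\<close>

lemma AC_curves_differentiable_ae:
  assumes "q \<in> AC_curves T"
  shows "negligible {t\<in>{0..T}. \<not> q differentiable (at t)}"
proof (cases "0 \<le> T")
  case True
  obtain G H where GH: "mono G" "mono H" "\<And>t. t \<in> {0..T} \<Longrightarrow> q t = G t - H t"
    using AC_curves_mono_diff[OF assms True] by blast
  have "negligible ({x. \<not> G differentiable (at x)} \<union> {x. \<not> H differentiable (at x)} \<union> {0, T})"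
    by (intro negligible_Un mono_differentiable_ae GH) auto
  moreover have "{t\<in>{0..T}. \<not> q differentiable (at t)} \<subseteq>
      {x. \<not> G differentiable (at x)} \<union> {x. \<not> H differentiable (at x)} \<union> {0, T}"
  proof
    fix t assume t: "t \<in> {t\<in>{0..T}. \<not> q differentiable (at t)}"
    have "q differentiable (at t)" if d: "G differentiable (at t)" "H differentiable (at t)" "t \<in> {0<..<T}"
    proof -
      have "(\<lambda>x. G x - H x) differentiable (at t)" using d by (intro differentiable_diff)
      then obtain D where "((\<lambda>x. G x - H x) has_derivative D) (at t)" by (auto simp: differentiable_def)
      then have "(q has_derivative D) (at t)"
        by (rule has_derivative_transform_within_open[of _ _ _ _ "{0<..<T}"]) (use d GH(3) in auto)
      then show ?thesis by (rule differentiableI)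
    qed
    then show "t \<in> {x. \<not> G differentiable (at x)} \<union> {x. \<not> H differentiable (at x)} \<union> {0, T}"
      using t by force
  qed
  ultimately show ?thesis by (rule negligible_subset)
qed auto

text \<open>A gauge argument. A cell tagged at a point of differentiability has an error
  proportional to its length. Cells tagged in the null set \<open>N\<close> lie in an open set of
  small measure, where absolute continuity makes the sum of the increments small.\<close>

theorem AC_curves_FTC:
  assumes q: "q \<in> AC_curves T" and ab: "0 \<le> a" "a \<le> b" "b \<le> T"
  shows "(deriv q has_integral q b - q a) {a..b}"
proof -
  define N where "N = {t\<in>{0..T}. \<not> q differentiable (at t)}"
  have "negligible N" unfolding N_def by (rule AC_curves_differentiable_ae[OF q])
  \<comment> \<open>With value 0 on \<open>N\<close>, a cell tagged there contributes nothing to the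
    Riemann sum, so its error is just the increment of \<open>q\<close>.\<close>
  define f where "f x = (if x \<in> N then 0 else deriv q x)" for x
  have "(f has_integral q b - q a) {a..b}"
    unfolding has_integral_factor_content_real
  proof (intro allI impI)
    fix e :: real assume "e > 0"
    show "\<exists>\<gamma>. gauge \<gamma> \<and> (\<forall>p. p tagged_division_of {a..b} \<and> \<gamma> fine p \<longrightarrow>
      norm (sum (\<lambda>(x,k). measure lborel k *\<^sub>R f x) p - (q b - q a)) \<le> e * measure lborel {a..b})"
    proof (cases "a = b")
      case True
      have "norm (sum (\<lambda>(x,k). measure lborel k *\<^sub>R f x) p - (q b - q a)) \<le> e * measure lborel {a..b}"
        if "p tagged_division_of {a..b}" for p
      proof -
        have "sum (\<lambda>(x,k). measure lborel k *\<^sub>R f x) p = 0"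
          using True that by (intro sum_content_null[of a b]) auto
        then show ?thesis using True by simp
      qed
      then show ?thesis using gauge_trivial by blast
    next
      case False
      then have "a < b" using ab by simp
      \<comment> \<open>One half of the permitted error for the cells tagged in \<open>N\<close>,
        one half for the others.\<close>
      define e' where "e' = e * (b - a) / 2"
      have "e' > 0" using \<open>e > 0\<close> \<open>a < b\<close> by (simp add: e'_def)
      obtain d where d: "d > 0" "\<forall>(I::(real \<times> real set) set) a b. finite I \<longrightarrow>
        (\<forall>i\<in>I. 0 \<le> a i \<and> a i \<le> b i \<and> b i \<le> T) \<longrightarrow>
        disjoint_family_on (\<lambda>i. {a i<..<b i}) I \<longrightarrow> (\<Sum>i\<in>I. b i - a i) < d \<longrightarrow>
        (\<Sum>i\<in>I. \<bar>q (b i) - q (a i)\<bar>) < e'"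
        using AC_curvesD[OF q \<open>e' > 0\<close>, where 'i = "real \<times> real set"] by (elim exE conjE)
      have "N \<in> lmeasurable" "measure lebesgue N = 0"
        using \<open>negligible N\<close> by (auto simp: negligible_imp_measurable negligible_imp_measure0)
      then obtain V where V: "open V" "N \<subseteq> V" "V \<in> lmeasurable" "measure lebesgue V < d"
        using lmeasurable_outer_open[OF _ \<open>d > 0\<close>, of N] by auto
      have "\<exists>\<delta>>0. \<forall>y. \<bar>y - x\<bar> < \<delta> \<longrightarrow> \<bar>q y - q x - (y - x) * deriv q x\<bar> \<le> e / 2 * \<bar>y - x\<bar>"
        if "x \<in> {0..T} - N" for x
      proof -
        have "(q has_real_derivative deriv q x) (at x)"
          using that unfolding N_def by (auto simp: DERIV_deriv_iff_real_differentiable)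
        then have "\<forall>e>0. \<exists>\<delta>>0. \<forall>y. norm (y - x) < \<delta> \<longrightarrow>
            norm (q y - q x - deriv q x * (y - x)) \<le> e * norm (y - x)"
          unfolding has_field_derivative_def has_derivative_at_alt by blast
        from this[rule_format, of "e / 2"] show ?thesis
          using \<open>e > 0\<close> by (simp add: mult.commute)
      qed
      then obtain \<delta> where \<delta>: "\<And>x. x \<in> {0..T} - N \<Longrightarrow> \<delta> x > 0"
        "\<And>x y. x \<in> {0..T} - N \<Longrightarrow> \<bar>y - x\<bar> < \<delta> x \<Longrightarrow> \<bar>q y - q x - (y - x) * deriv q x\<bar> \<le> e / 2 * \<bar>y - x\<bar>"
        by metis
      define \<gamma> where "\<gamma> x = (if x \<in> N then V else if x \<in> {0..T} then ball x (\<delta> x) else ball x 1)" for x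
      have "gauge \<gamma>"
        unfolding gauge_def \<gamma>_def using V(1,2) \<delta>(1) by auto
      moreover have "norm (sum (\<lambda>(x,k). measure lborel k *\<^sub>R f x) p - (q b - q a)) \<le> e * measure lborel {a..b}"
        if p: "p tagged_division_of {a..b} \<and> \<gamma> fine p" for p
      proof -
        note p = conjunct1[OF p] conjunct2[OF p]
        have "finite p" using p(1) by blast
        have cell: "\<exists>u v. k = {u..v} \<and> u \<le> x \<and> x \<le> v \<and> a \<le> u \<and> v \<le> b" if "(x, k) \<in> p" for x k
        proof -
          obtain u v where "k = cbox u v" using tagged_division_ofD(4)[OF p(1) \<open>(x, k) \<in> p\<close>] by blast
          moreover have "x \<in> k" "k \<subseteq> {a..b}" using tagged_division_ofD(2,3)[OF p(1) that] by auto
          ultimately show ?thesis by (intro exI[of _ u] exI[of _ v]) auto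
        qed
        define err where "err = (\<lambda>(x,k). measure lborel k * f x - (q (Sup k) - q (Inf k)))"
        define P where "P = {i\<in>p. fst i \<in> N}"
        have "sum (\<lambda>(x,k). measure lborel k *\<^sub>R f x) p - (q b - q a) = sum err p"
          unfolding additive_tagged_division_1[OF \<open>a \<le> b\<close> p(1), symmetric] sum_subtractf[symmetric] err_def
          by (simp add: case_prod_unfold)
        also have "\<dots> = sum err P + sum err (p - P)"
          using \<open>finite p\<close> by (subst sum.subset_diff[of P p]) (auto simp: P_def)
        finally have eq: "sum (\<lambda>(x,k). measure lborel k *\<^sub>R f x) p - (q b - q a) = sum err P + sum err (p - P)" .
        have "\<bar>sum err P\<bar> \<le> (\<Sum>i\<in>P. \<bar>q (Sup (snd i)) - q (Inf (snd i))\<bar>)"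
        proof (rule order_trans[OF sum_abs], rule sum_mono)
          fix i assume "i \<in> P"
          then show "\<bar>err i\<bar> \<le> \<bar>q (Sup (snd i)) - q (Inf (snd i))\<bar>"
            by (auto simp: P_def err_def f_def case_prod_unfold)
        qed
        also have "\<dots> < e'"
        proof (rule d(2)[rule_format])
          show "finite P" using \<open>finite p\<close> by (simp add: P_def)
          show PI: "0 \<le> Inf (snd i) \<and> Inf (snd i) \<le> Sup (snd i) \<and> Sup (snd i) \<le> T" if "i \<in> P" for i
            using cell[of "fst i" "snd i"] that ab unfolding P_def by auto
          show disj: "disjoint_family_on (\<lambda>i. {Inf (snd i)<..<Sup (snd i)}) P"
            unfolding disjoint_family_on_def
          proof (intro ballI impI)
            fix i j assume ij: "i \<in> P" "j \<in> P" "i \<noteq> j"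
            have int: "{Inf (snd i)<..<Sup (snd i)} = interior (snd i)" if "i \<in> P" for i
              using cell[of "fst i" "snd i"] that unfolding P_def by auto
            have "interior (snd i) \<inter> interior (snd j) = {}"
              using tagged_division_ofD(5)[OF p(1), of "fst i" "snd i" "fst j" "snd j"] ij
              unfolding P_def by (cases i; cases j) auto
            then show "{Inf (snd i)<..<Sup (snd i)} \<inter> {Inf (snd j)<..<Sup (snd j)} = {}"
              using int ij by simp
          qed
          have "(\<Sum>i\<in>P. Sup (snd i) - Inf (snd i)) \<le> measure lebesgue V"
          proof (rule sum_lengths_le_measure[OF \<open>finite P\<close> _ disj V(3)])
            fix i assume i: "i \<in> P"
            then have "snd i \<subseteq> V"
              using fineD[OF p(2), of "fst i" "snd i"] unfolding P_def \<gamma>_def by auto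
            moreover have "{Inf (snd i)<..<Sup (snd i)} \<subseteq> snd i"
            proof -
              have "(fst i, snd i) \<in> p" using i by (simp add: P_def)
              then obtain u v where "snd i = {u..v}" "u \<le> v" using cell by (meson order_trans)
              then show ?thesis by (simp add: greaterThanLessThan_subseteq_atLeastAtMost_iff)
            qed
            ultimately show "{Inf (snd i)<..<Sup (snd i)} \<subseteq> V" by simp
          qed (use PI in auto)
          then show "(\<Sum>i\<in>P. Sup (snd i) - Inf (snd i)) < d" using V(4) by simp
        qed
        finally have 1: "\<bar>sum err P\<bar> \<le> e'" by simp
        have "\<bar>sum err (p - P)\<bar> \<le> (\<Sum>i\<in>p - P. e / 2 * measure lborel (snd i))"
        proof (rule order_trans[OF sum_abs], rule sum_mono)
          fix i assume i: "i \<in> p - P"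
          obtain x k where xk: "i = (x, k)" by (cases i)
          then have "(x, k) \<in> p" "x \<notin> N" using i by (auto simp: P_def)
          then obtain u v where uv: "k = {u..v}" "u \<le> x" "x \<le> v" "a \<le> u" "v \<le> b" using cell by blast
          have x: "x \<in> {0..T} - N" using uv ab \<open>x \<notin> N\<close> by auto
          have "k \<subseteq> ball x (\<delta> x)"
            using fineD[OF p(2) \<open>(x, k) \<in> p\<close>] x by (simp add: \<gamma>_def)
          moreover have "u \<in> k" "v \<in> k" using uv by auto
          ultimately have "\<bar>u - x\<bar> < \<delta> x" "\<bar>v - x\<bar> < \<delta> x"
            by (auto simp: dist_real_def abs_minus_commute)
          then have "\<bar>q u - q x - (u - x) * deriv q x\<bar> \<le> e / 2 * (x - u)"
            "\<bar>q v - q x - (v - x) * deriv q x\<bar> \<le> e / 2 * (v - x)"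
            using \<delta>(2)[OF x, of u] \<delta>(2)[OF x, of v] uv by auto
          \<comment> \<open>Straddle argument: the tag lies between \<open>u\<close> and
            \<open>v\<close>, so the errors of the two sides add up to a multiple of
            \<open>v - u\<close>.\<close>
          moreover have "(v - u) * deriv q x - (q v - q u)
              = (q u - q x - (u - x) * deriv q x) - (q v - q x - (v - x) * deriv q x)"
            by (simp add: algebra_simps)
          moreover have "e / 2 * (x - u) + e / 2 * (v - x) = e / 2 * (v - u)"
            unfolding distrib_left[symmetric] by simp
          ultimately have "\<bar>(v - u) * deriv q x - (q v - q u)\<bar> \<le> e / 2 * (v - u)"
            by linarith
          then show "\<bar>err i\<bar> \<le> e / 2 * measure lborel (snd i)"
            using uv \<open>x \<notin> N\<close> by (simp add: err_def xk f_def)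
        qed
        also have "\<dots> \<le> (\<Sum>i\<in>p. e / 2 * measure lborel (snd i))"
          using \<open>finite p\<close> \<open>e > 0\<close> by (intro sum_mono2) auto
        also have "\<dots> = e / 2 * (b - a)"
          using additive_content_tagged_division[of p a b] p(1) \<open>a \<le> b\<close>
          unfolding sum_distrib_left[symmetric] by (simp add: case_prod_unfold)
        finally have 2: "\<bar>sum err (p - P)\<bar> \<le> e'" by (simp add: e'_def)
        show ?thesis unfolding eq using 1 2 \<open>a \<le> b\<close> by (simp add: e'_def)
      qed
      ultimately show ?thesis by (intro exI[of _ \<gamma>] conjI allI impI)
    qed
  qed
  then show ?thesis
    by (rule has_integral_spike[OF \<open>negligible N\<close>, rotated]) (simp add: f_def)
qed

section \<open>Measurability, domination and composition of absolutely continuous curves\<close>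

lemma AC_curves_deriv_measurable:
  assumes "q \<in> AC_curves T"
  shows "deriv q \<in> borel_measurable (lebesgue_on {0..T})"
proof (cases "0 \<le> T")
  case True
  then show ?thesis
    using AC_curves_FTC[OF assms, of 0 T] by (intro integrable_imp_measurable) auto
qed (simp add: borel_measurable_restrict_space_iff)

lemma AC_curves_measurable:
  assumes "q \<in> AC_curves T"
  shows "q \<in> borel_measurable (lebesgue_on {0..T})"
  by (rule continuous_imp_measurable_on_sets_lebesgue) (use AC_curves_continuous[OF assms] in auto)

text \<open>Common source of the closure properties: Lipschitz curves are dominated by the identity,
  compositions and modifications outside \<open>{0..T}\<close> by the original curve.\<close>

lemma AC_curves_dominated:
  assumes u: "u \<in> AC_curves T" and "L \<ge> 0"
    and le: "\<And>s t. 0 \<le> s \<Longrightarrow> s \<le> t \<Longrightarrow> t \<le> T \<Longrightarrow> \<bar>v t - v s\<bar> \<le> L * \<bar>u t - u s\<bar>"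
  shows "v \<in> AC_curves T"
  unfolding AC_curves_def
proof (rule CollectI, intro allI impI)
  fix e :: real assume "e > 0"
  then have "e / (L + 1) > 0" using \<open>L \<ge> 0\<close> by simp
  then obtain d where d: "d > 0" "\<And>(n::nat) a b. (\<forall>i<n. 0 \<le> a i \<and> a i \<le> b i \<and> b i \<le> T) \<and>
     disjoint_family_on (\<lambda>i. {a i<..<b i}) {..<n} \<and> (\<Sum>i<n. b i - a i) < d
     \<Longrightarrow> (\<Sum>i<n. \<bar>u (b i) - u (a i)\<bar>) < e / (L + 1)"
    using u unfolding AC_curves_def by blast
  show "\<exists>d>0. \<forall>(n::nat) a b. (\<forall>i<n. 0 \<le> a i \<and> a i \<le> b i \<and> b i \<le> T) \<and>
     disjoint_family_on (\<lambda>i. {a i<..<b i}) {..<n} \<and> (\<Sum>i<n. b i - a i) < d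
     \<longrightarrow> (\<Sum>i<n. \<bar>v (b i) - v (a i)\<bar>) < e"
  proof (intro exI[of _ d] conjI allI impI d(1))
    fix n :: nat and a b :: "nat \<Rightarrow> real"
    assume *: "(\<forall>i<n. 0 \<le> a i \<and> a i \<le> b i \<and> b i \<le> T) \<and>
      disjoint_family_on (\<lambda>i. {a i<..<b i}) {..<n} \<and> (\<Sum>i<n. b i - a i) < d"
    have "(\<Sum>i<n. \<bar>v (b i) - v (a i)\<bar>) \<le> (\<Sum>i<n. L * \<bar>u (b i) - u (a i)\<bar>)"
      using * by (intro sum_mono le) auto
    also have "\<dots> = L * (\<Sum>i<n. \<bar>u (b i) - u (a i)\<bar>)" by (simp add: sum_distrib_left)
    also have "\<dots> \<le> L * (e / (L + 1))" using d(2)[OF *] \<open>L \<ge> 0\<close> by (intro mult_left_mono) auto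
    also have "\<dots> < e" using \<open>L \<ge> 0\<close> \<open>e > 0\<close> by (simp add: field_simps)
    finally show "(\<Sum>i<n. \<bar>v (b i) - v (a i)\<bar>) < e" .
  qed
qed

lemma AC_curves_cong:
  assumes "\<And>t. t \<in> {0..T} \<Longrightarrow> u t = v t" "u \<in> AC_curves T"
  shows "v \<in> AC_curves T"
  by (rule AC_curves_dominated[OF assms(2), of 1]) (use assms(1) in \<open>auto simp flip: assms(1)\<close>)

lemma lipschitz_AC_curves:
  assumes "L-lipschitz_on {0..T} q"
  shows "q \<in> AC_curves T"
proof (rule AC_curves_dominated[OF _ lipschitz_on_nonneg[OF assms]])
  show "(\<lambda>t. t) \<in> AC_curves T"
    unfolding AC_curves_def by (rule CollectI, intro allI impI) (auto intro!: exI)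
  show "\<bar>q t - q s\<bar> \<le> L * \<bar>t - s\<bar>" if "0 \<le> s" "s \<le> t" "t \<le> T" for s t
    using lipschitz_onD[OF assms, of t s] that by (auto simp: dist_real_def)
qed

text \<open>The curve has compact range, on which \<open>\<Phi>\<close> is Lipschitz.\<close>

lemma AC_curves_compose_C1:
  assumes q: "q \<in> AC_curves T"
    and \<Phi>: "\<And>x. (\<Phi> has_real_derivative \<phi> x) (at x)" and \<phi>: "continuous_on UNIV \<phi>"
  shows "(\<lambda>t. \<Phi> (q t)) \<in> AC_curves T"
proof -
  have "compact (q ` {0..T})"
    using AC_curves_continuous[OF q] by (intro compact_continuous_image) auto
  then obtain R where R: "\<And>t. t \<in> {0..T} \<Longrightarrow> \<bar>q t\<bar> \<le> R"
    unfolding bounded_iff[symmetric] using compact_imp_bounded bounded_iff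
    by (metis image_eqI real_norm_def)
  have "compact (\<phi> ` {-R..R})"
    using \<phi> by (intro compact_continuous_image continuous_on_subset[OF \<phi>]) auto
  then obtain L where L: "\<And>x. x \<in> {-R..R} \<Longrightarrow> \<bar>\<phi> x\<bar> \<le> L"
    using compact_imp_bounded bounded_iff by (metis image_eqI real_norm_def)
  have lip: "\<bar>\<Phi> x - \<Phi> y\<bar> \<le> (\<bar>L\<bar> + 1) * \<bar>x - y\<bar>" if "x \<in> {-R..R}" "y \<in> {-R..R}" for x y
  proof -
    have "norm (\<Phi> x - \<Phi> y) \<le> (\<bar>L\<bar> + 1) * norm (x - y)"
    proof (rule field_differentiable_bound[of "{-R..R}"])
      show "(\<Phi> has_field_derivative \<phi> z) (at z within {-R..R})" for z
        using \<Phi> has_field_derivative_at_within by blast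
      show "norm (\<phi> z) \<le> \<bar>L\<bar> + 1" if "z \<in> {-R..R}" for z using L[OF that] by simp
    qed (use that in auto)
    then show ?thesis by simp
  qed
  show ?thesis
  proof (rule AC_curves_dominated[OF q, of "\<bar>L\<bar> + 1"])
    fix s t assume "0 \<le> s" "s \<le> t" "t \<le> T"
    then show "\<bar>\<Phi> (q t) - \<Phi> (q s)\<bar> \<le> (\<bar>L\<bar> + 1) * \<bar>q t - q s\<bar>"
      using R[of s] R[of t] by (intro lip) (auto simp: abs_le_iff)
  qed simp
qed

text \<open>The fundamental theorem applied to the composition; wherever \<open>q\<close> is
  differentiable the pointwise chain rule identifies the integrand, and the remaining points form a
  null set.\<close>

lemma AC_curves_chain_rule_integral:
  assumes q: "q \<in> AC_curves T"
    and \<Phi>: "\<And>x. (\<Phi> has_real_derivative \<phi> x) (at x)" and \<phi>: "continuous_on UNIV \<phi>"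
    and ab: "0 \<le> a" "a \<le> b" "b \<le> T"
  shows "((\<lambda>t. \<phi> (q t) * deriv q t) has_integral \<Phi> (q b) - \<Phi> (q a)) {a..b}"
proof (rule has_integral_spike[OF AC_curves_differentiable_ae[OF q]])
  show "(deriv (\<lambda>t. \<Phi> (q t)) has_integral \<Phi> (q b) - \<Phi> (q a)) {a..b}"
    by (rule AC_curves_FTC[OF AC_curves_compose_C1[OF q \<Phi> \<phi>] ab])
next
  fix t assume "t \<in> {a..b} - {t \<in> {0..T}. \<not> q differentiable at t}"
  then have "(q has_real_derivative deriv q t) (at t)"
    using ab by (auto simp: DERIV_deriv_iff_real_differentiable)
  then have "((\<lambda>t. \<Phi> (q t)) has_real_derivative \<phi> (q t) * deriv q t) (at t)"
    by (rule DERIV_chain2[OF \<Phi>])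
  then show "\<phi> (q t) * deriv q t = deriv (\<lambda>t. \<Phi> (q t)) t"
    by (rule DERIV_imp_deriv[symmetric])
qed

section \<open>The effective density\<close>

text \<open>A particle of energy \<open>- \<nu>\<close> can pass every point of the period: its
  squared momentum \<open>\<xi>\<^sup>2 - 2 * \<nu> * a y\<close> is never negative.\<close>

definition admissible :: "(real \<Rightarrow> real) \<Rightarrow> real \<Rightarrow> real set" where
  "admissible a \<xi> = {\<nu>. \<forall>y. 2 * \<nu> * a y \<le> \<xi>\<^sup>2}"

text \<open>The value of \<open>a y * \<bar>w\<bar>\<close> at which Young's inequality is an
  equality.\<close>

definition momentum :: "(real \<Rightarrow> real) \<Rightarrow> real \<Rightarrow> real \<Rightarrow> real \<Rightarrow> real" where
  "momentum a \<xi> \<nu> y = sqrt (\<xi>\<^sup>2 - 2 * \<nu> * a y)"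

definition mean_momentum :: "(real \<Rightarrow> real) \<Rightarrow> real \<Rightarrow> real \<Rightarrow> real" where
  "mean_momentum a \<xi> \<nu> = integral {0..1} (momentum a \<xi> \<nu>)"

text \<open>A dual formula for the least mean cost at mean speed \<open>\<bar>v\<bar>\<close>:
  \<open>mean_momentum\<close> is the least cost per unit of distance after a credit of
  \<open>\<nu>\<close> per unit of time.\<close>

definition eff_density :: "(real \<Rightarrow> real) \<Rightarrow> real \<Rightarrow> real \<Rightarrow> real" where
  "eff_density a v \<xi> = (SUP \<nu>\<in>admissible a \<xi>. \<nu> + \<bar>v\<bar> * mean_momentum a \<xi> \<nu>)"

lemma periodic_frac:
  fixes f :: "real \<Rightarrow> 'a"
  assumes "\<And>y. f (y + 1) = f y"
  shows "f (frac y) = f y"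
proof -
  have "f (y + of_int k) = f y" for k
  proof (induction k arbitrary: y rule: int_induct[where k = 0])
    case (step1 i)
    then show ?case using assms[of "y + of_int i"] by (simp add: algebra_simps)
  next
    case (step2 i)
    then show ?case using assms[of "y + of_int (i - 1)"] by (simp add: algebra_simps)
  qed simp
  from this[of "- \<lfloor>y\<rfloor>"] show ?thesis by (simp add: frac_def)
qed

locale periodic_coeff =
  fixes a :: "real \<Rightarrow> real" and m M :: real
  assumes cont_a: "continuous_on UNIV a"
    and per: "\<And>y. a (y + 1) = a y"
    and m_pos: "0 < m"
    and a_ge: "\<And>y. m \<le> a y"
    and a_le: "\<And>y. a y \<le> M"
begin

lemma a_pos: "0 < a y" using a_ge[of y] m_pos by linarith

lemma M_pos: "0 < M" using a_pos[of 0] a_le[of 0] by linarith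

lemma per_frac: "a (frac y) = a y"
  by (rule periodic_frac[of a, OF per])

lemma max_a: obtains y0 where "y0 \<in> {0..1}" "\<And>y. a y \<le> a y0"
proof -
  obtain y0 where "y0 \<in> {0..1::real}" "\<forall>y\<in>{0..1}. a y \<le> a y0"
    using continuous_attains_sup[of "{0..1}" a] continuous_on_subset[OF cont_a] by auto
  moreover have "frac y \<in> {0..1}" for y :: real using frac_lt_1[of y] by (simp add: less_imp_le)
  ultimately show thesis using that per_frac by metis
qed

lemma cont_momentum: "continuous_on S (momentum a \<xi> \<nu>)"
  unfolding momentum_def by (intro continuous_intros continuous_on_subset[OF cont_a]) auto

lemma per_momentum: "momentum a \<xi> \<nu> (y + 1) = momentum a \<xi> \<nu> y"
  by (simp add: momentum_def per)

lemma admissible_zero: "0 \<in> admissible a \<xi>" by (simp add: admissible_def)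

lemma admissible_le: "\<nu> \<in> admissible a \<xi> \<Longrightarrow> \<nu> \<le> \<xi>\<^sup>2 / (2 * a y)"
  using a_pos[of y] by (simp add: admissible_def field_simps)

lemma admissible_downward: "\<nu> \<in> admissible a \<xi> \<Longrightarrow> \<nu>' \<le> \<nu> \<Longrightarrow> \<nu>' \<in> admissible a \<xi>"
  unfolding admissible_def mem_Collect_eq
  by (meson a_pos less_imp_le mult_left_mono mult_right_mono order_trans zero_le_numeral)

lemma momentum_nonneg: "\<nu> \<in> admissible a \<xi> \<Longrightarrow> 0 \<le> momentum a \<xi> \<nu> y"
  by (simp add: admissible_def momentum_def)

lemma momentum_sq: "\<nu> \<in> admissible a \<xi> \<Longrightarrow> (momentum a \<xi> \<nu> y)\<^sup>2 = \<xi>\<^sup>2 - 2 * \<nu> * a y"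
  by (simp add: admissible_def momentum_def)

lemma momentum_le: "momentum a \<xi> \<nu> y \<le> sqrt (\<xi>\<^sup>2 + 2 * \<bar>\<nu>\<bar> * M)"
proof -
  have "- (2 * \<nu> * a y) \<le> 2 * \<bar>\<nu>\<bar> * a y"
    using mult_right_mono[of "- \<nu>" "\<bar>\<nu>\<bar>" "2 * a y"] a_pos[of y] by (simp add: algebra_simps)
  also have "\<dots> \<le> 2 * \<bar>\<nu>\<bar> * M" using a_le[of y] by (intro mult_left_mono) auto
  finally show ?thesis unfolding momentum_def by (intro real_sqrt_le_mono) simp
qed

lemma momentum_integrable: "momentum a \<xi> \<nu> integrable_on {0..1}"
  by (rule integrable_continuous_interval[OF cont_momentum])

lemma has_integral_affine_momentum:
  "((\<lambda>y. c + v * momentum a \<xi> \<nu> y) has_integral c + v * mean_momentum a \<xi> \<nu>) {0..1}"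
  unfolding mean_momentum_def
  using has_integral_add[OF has_integral_const_real[of c 0 1]
      has_integral_mult_right[OF integrable_integral[OF momentum_integrable], of v]] by simp

lemma mean_momentum_nonneg: "\<nu> \<in> admissible a \<xi> \<Longrightarrow> 0 \<le> mean_momentum a \<xi> \<nu>"
  unfolding mean_momentum_def by (intro integral_nonneg momentum_integrable momentum_nonneg)

lemma mean_momentum_zero: "mean_momentum a \<xi> 0 = \<bar>\<xi>\<bar>"
  by (simp add: mean_momentum_def momentum_def[abs_def])

text \<open>The gap is the square \<open>(a y * \<bar>w\<bar> - s)\<^sup>2 / (2 * a y)\<close> with
  \<open>s\<close> the momentum, so equality holds exactly at the speed \<open>s / a y\<close>, the
  one used by the recovery curves.\<close>

lemma young_momentum:
  assumes "\<nu> \<in> admissible a \<xi>"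
  shows "\<nu> + \<bar>w\<bar> * momentum a \<xi> \<nu> y \<le> a y / 2 * w\<^sup>2 + \<xi>\<^sup>2 / (2 * a y)"
proof -
  define s where "s = momentum a \<xi> \<nu> y"
  have s: "\<nu> = (\<xi>\<^sup>2 - s\<^sup>2) / (2 * a y)"
    using momentum_sq[OF assms, of y] a_pos[of y] by (simp add: s_def)
  have "a y / 2 * w\<^sup>2 + \<xi>\<^sup>2 / (2 * a y) - (\<nu> + \<bar>w\<bar> * s) = (a y * \<bar>w\<bar> - s)\<^sup>2 / (2 * a y)"
    unfolding s using a_pos[of y] by (simp add: field_simps power2_eq_square)
  also have "\<dots> \<ge> 0" using a_pos[of y] by simp
  finally show ?thesis by (simp add: s_def)
qed

text \<open>A bound uniform in \<open>\<nu>\<close>: it makes the supremum of reals in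
  \<open>eff_density\<close> a genuine least upper bound.\<close>

lemma eff_term_le:
  assumes "\<nu> \<in> admissible a \<xi>"
  shows "\<nu> + \<bar>v\<bar> * mean_momentum a \<xi> \<nu> \<le> M / 2 * v\<^sup>2 + \<xi>\<^sup>2 / (2 * m)"
proof -
  have "\<nu> + \<bar>v\<bar> * momentum a \<xi> \<nu> y \<le> M / 2 * v\<^sup>2 + \<xi>\<^sup>2 / (2 * m)" for y
  proof -
    have "a y / 2 * v\<^sup>2 \<le> M / 2 * v\<^sup>2" using a_le[of y] by (intro mult_right_mono) auto
    moreover have "\<xi>\<^sup>2 / (2 * a y) \<le> \<xi>\<^sup>2 / (2 * m)"
      using a_ge[of y] m_pos by (intro divide_left_mono) auto
    ultimately show ?thesis using young_momentum[OF assms, of v y] by linarith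
  qed
  then show ?thesis
    using has_integral_le[OF has_integral_affine_momentum has_integral_const_real[of _ 0 1]]
    by fastforce
qed

lemma bdd_above_eff: "bdd_above ((\<lambda>\<nu>. \<nu> + \<bar>v\<bar> * mean_momentum a \<xi> \<nu>) ` admissible a \<xi>)"
  using eff_term_le by (intro bdd_aboveI2[of _ _ "M / 2 * v\<^sup>2 + \<xi>\<^sup>2 / (2 * m)"])

lemma eff_upper: "\<nu> \<in> admissible a \<xi> \<Longrightarrow> \<nu> + \<bar>v\<bar> * mean_momentum a \<xi> \<nu> \<le> eff_density a v \<xi>"
  unfolding eff_density_def by (rule cSUP_upper[OF _ bdd_above_eff])

lemma eff_least:
  "(\<And>\<nu>. \<nu> \<in> admissible a \<xi> \<Longrightarrow> \<nu> + \<bar>v\<bar> * mean_momentum a \<xi> \<nu> \<le> X) \<Longrightarrow> eff_density a v \<xi> \<le> X"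
  unfolding eff_density_def using admissible_zero by (intro cSUP_least) auto

lemma eff_approx:
  assumes "r < eff_density a v \<xi>"
  shows "\<exists>\<nu>\<in>admissible a \<xi>. r < \<nu> + \<bar>v\<bar> * mean_momentum a \<xi> \<nu>"
  using assms eff_least[of \<xi> v r] by (meson linorder_not_le)

text \<open>The multiplier 0 is admissible and gives momentum \<open>\<bar>\<xi>\<bar>\<close>
  everywhere.\<close>

lemma eff_ge_abs: "\<bar>v * \<xi>\<bar> \<le> eff_density a v \<xi>"
  using eff_upper[OF admissible_zero, of v \<xi>] by (simp add: mean_momentum_zero abs_mult)

lemma eff_nonneg: "0 \<le> eff_density a v \<xi>"
  using eff_ge_abs[of v \<xi>] by linarith

lemma eff_mono: "\<bar>v\<bar> \<le> \<bar>w\<bar> \<Longrightarrow> eff_density a v \<xi> \<le> eff_density a w \<xi>"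
  by (intro eff_least order_trans[OF _ eff_upper]) (auto intro!: mult_right_mono mean_momentum_nonneg)

text \<open>Each term is an affine function of \<open>\<bar>v\<bar>\<close> with nonnegative slope,
  hence convex in \<open>v\<close>.\<close>

lemma eff_convex: "convex_on UNIV (\<lambda>v. eff_density a v \<xi>)"
proof (rule convex_onI)
  fix t v w :: real assume t: "0 < t" "t < 1"
  have "\<nu> + \<bar>(1 - t) * v + t * w\<bar> * mean_momentum a \<xi> \<nu> \<le> (1 - t) * eff_density a v \<xi> + t * eff_density a w \<xi>"
    if "\<nu> \<in> admissible a \<xi>" for \<nu>
  proof -
    have "\<bar>(1 - t) * v + t * w\<bar> \<le> (1 - t) * \<bar>v\<bar> + t * \<bar>w\<bar>"
      using t by (intro order_trans[OF abs_triangle_ineq]) (simp add: abs_mult)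
    then have "\<nu> + \<bar>(1 - t) * v + t * w\<bar> * mean_momentum a \<xi> \<nu>
      \<le> \<nu> + ((1 - t) * \<bar>v\<bar> + t * \<bar>w\<bar>) * mean_momentum a \<xi> \<nu>"
      using mean_momentum_nonneg[OF that] by (intro add_left_mono mult_right_mono)
    also have "\<dots> = (1 - t) * (\<nu> + \<bar>v\<bar> * mean_momentum a \<xi> \<nu>) + t * (\<nu> + \<bar>w\<bar> * mean_momentum a \<xi> \<nu>)"
      by (simp add: algebra_simps)
    also have "\<dots> \<le> (1 - t) * eff_density a v \<xi> + t * eff_density a w \<xi>"
      using t eff_upper[OF that] by (intro add_mono mult_left_mono) auto
    finally show ?thesis .
  qed
  then show "eff_density a ((1 - t) *\<^sub>R v + t *\<^sub>R w) \<xi> \<le> (1 - t) * eff_density a v \<xi> + t * eff_density a w \<xi>"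
    by (intro eff_least) simp
qed simp

lemma eff_continuous: "continuous_on UNIV (\<lambda>v. eff_density a v \<xi>)"
  by (rule convex_on_continuous[OF open_UNIV eff_convex])

text \<open>By \<open>admissible_le\<close> at \<open>y0\<close> this is the largest admissible
  multiplier.\<close>

lemma max_admissible:
  assumes "\<And>y. a y \<le> a y0"
  shows "\<xi>\<^sup>2 / (2 * a y0) \<in> admissible a \<xi>"
  unfolding admissible_def
proof safe
  fix y
  have "a y / a y0 * \<xi>\<^sup>2 \<le> 1 * \<xi>\<^sup>2" using assms[of y] a_pos by (intro mult_right_mono) auto
  then show "2 * (\<xi>\<^sup>2 / (2 * a y0)) * a y \<le> \<xi>\<^sup>2" using a_pos[of y0] by (simp add: field_simps)
qed

lemma eff_zero:
  assumes "\<And>y. a y \<le> a y0"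
  shows "eff_density a 0 \<xi> = \<xi>\<^sup>2 / (2 * a y0)"
proof (rule antisym)
  show "eff_density a 0 \<xi> \<le> \<xi>\<^sup>2 / (2 * a y0)"
    by (intro eff_least) (simp add: admissible_le)
  show "\<xi>\<^sup>2 / (2 * a y0) \<le> eff_density a 0 \<xi>"
    using eff_upper[OF max_admissible[OF assms], of \<xi> 0] by simp
qed

section \<open>The contact set of the density\<close>

lemma a_integrable: "a integrable_on {0..1}"
  by (rule integrable_continuous_interval) (rule continuous_on_subset[OF cont_a], simp)

lemma mean_a_bounds: "m \<le> integral {0..1} a" "integral {0..1} a \<le> M"
  using has_integral_le[OF has_integral_const_real[of m 0 1] integrable_integral[OF a_integrable]]
    has_integral_le[OF integrable_integral[OF a_integrable] has_integral_const_real[of M 0 1]] a_ge a_le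
  by auto

text \<open>The square root lies below its tangent at \<open>\<nu> = 0\<close>. After averaging, the
  coefficient of \<open>\<nu>\<close> is \<open>1 - \<bar>v\<bar> * A / \<bar>\<xi>\<bar>\<close>,
  which vanishes for this force.\<close>

lemma eff_contact_le:
  assumes "\<xi> = integral {0..1} a * v"
  shows "eff_density a v \<xi> \<le> \<xi> * v"
proof (rule eff_least)
  fix \<nu> assume \<nu>: "\<nu> \<in> admissible a \<xi>"
  define A where "A = integral {0..1} a"
  have "A > 0" using mean_a_bounds(1) m_pos by (simp add: A_def)
  have \<xi>: "\<xi> = A * v" using assms by (simp add: A_def)
  show "\<nu> + \<bar>v\<bar> * mean_momentum a \<xi> \<nu> \<le> \<xi> * v"
  proof (cases "\<xi> = 0")
    case True
    then have "v = 0" using \<xi> \<open>A > 0\<close> by simp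
    then show ?thesis using admissible_le[OF \<nu>, of 0] True by simp
  next
    case False
    have "momentum a \<xi> \<nu> y \<le> \<bar>\<xi>\<bar> - \<nu> / \<bar>\<xi>\<bar> * a y" for y
    proof -
      have "2 * \<bar>\<xi>\<bar> * momentum a \<xi> \<nu> y \<le> \<bar>\<xi>\<bar>\<^sup>2 + (momentum a \<xi> \<nu> y)\<^sup>2"
        using sum_squares_bound[of "\<bar>\<xi>\<bar>" "momentum a \<xi> \<nu> y"] by simp
      also have "\<dots> = 2 * \<bar>\<xi>\<bar> * (\<bar>\<xi>\<bar> - \<nu> / \<bar>\<xi>\<bar> * a y)"
      proof -
        have "2 * \<bar>\<xi>\<bar> * (\<bar>\<xi>\<bar> - \<nu> / \<bar>\<xi>\<bar> * a y) = 2 * \<bar>\<xi>\<bar>\<^sup>2 - 2 * \<nu> * a y"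
          using False by (simp add: right_diff_distrib power2_eq_square)
        then show ?thesis using momentum_sq[OF \<nu>, of y] by simp
      qed
      finally show ?thesis using False by simp
    qed
    moreover have "((\<lambda>y. \<bar>\<xi>\<bar> - \<nu> / \<bar>\<xi>\<bar> * a y) has_integral \<bar>\<xi>\<bar> - \<nu> / \<bar>\<xi>\<bar> * A) {0..1}"
      using has_integral_diff[OF has_integral_const_real[of "\<bar>\<xi>\<bar>" 0 1]
          has_integral_mult_right[OF integrable_integral[OF a_integrable], of "\<nu> / \<bar>\<xi>\<bar>"]]
      by (simp add: A_def)
    ultimately have "mean_momentum a \<xi> \<nu> \<le> \<bar>\<xi>\<bar> - \<nu> / \<bar>\<xi>\<bar> * A"
      unfolding mean_momentum_def using has_integral_le[OF integrable_integral[OF momentum_integrable]] by blast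
    then have "\<nu> + \<bar>v\<bar> * mean_momentum a \<xi> \<nu> \<le> \<nu> + \<bar>v\<bar> * (\<bar>\<xi>\<bar> - \<nu> / \<bar>\<xi>\<bar> * A)"
      by (intro add_left_mono mult_left_mono) auto
    also have "\<dots> = \<bar>v\<bar> * \<bar>\<xi>\<bar>"
      using False \<xi> \<open>A > 0\<close> by (simp add: abs_mult field_simps)
    also have "\<dots> = \<xi> * v" using \<xi> \<open>A > 0\<close> by (simp add: abs_mult)
    finally show ?thesis .
  qed
qed

text \<open>First-order condition: in contact, \<open>\<nu> = 0\<close> maximizes the term in the
  supremum. For \<open>\<xi> \<noteq> 0\<close> it is an interior point and the derivative
  \<open>1 - \<bar>v\<bar> * A / \<bar>\<xi>\<bar>\<close> must vanish; an explicit quadratic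
  remainder replaces differentiation under the integral. For \<open>\<xi> = 0\<close> it is a
  boundary point, and the square-root growth in \<open>- \<nu>\<close> forces
  \<open>v = 0\<close>.\<close>

lemma eff_contact_imp:
  assumes "eff_density a v \<xi> = \<xi> * v"
  shows "\<xi> = integral {0..1} a * v"
proof -
  define A where "A = integral {0..1} a"
  have "A > 0" using mean_a_bounds(1) m_pos by (simp add: A_def)
  have sgn: "\<xi> * v = \<bar>v\<bar> * \<bar>\<xi>\<bar>"
    using eff_ge_abs[of v \<xi>] assms by (simp add: abs_mult mult.commute)
       (metis abs_ge_self abs_mult antisym mult.commute)
  show ?thesis
  proof (cases "\<xi> = 0")
    case True
    have "v = 0"
    proof (rule ccontr)
      assume "v \<noteq> 0"
      have le: "- s + \<bar>v\<bar> * sqrt (2 * s * m) \<le> 0" if "s > 0" for s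
      proof -
        have adm: "- s \<in> admissible a \<xi>" using that a_pos by (auto simp: admissible_def True less_imp_le)
        have "sqrt (2 * s * m) \<le> momentum a \<xi> (- s) y" for y
          using a_ge[of y] that by (simp add: momentum_def True)
        then have "sqrt (2 * s * m) \<le> mean_momentum a \<xi> (- s)"
          unfolding mean_momentum_def
          using has_integral_le[OF has_integral_const_real[of _ 0 1] integrable_integral[OF momentum_integrable]]
          by fastforce
        then have "- s + \<bar>v\<bar> * sqrt (2 * s * m) \<le> - s + \<bar>v\<bar> * mean_momentum a \<xi> (- s)"
          by (intro add_left_mono mult_left_mono) auto
        also have "\<dots> \<le> 0" using eff_upper[OF adm, of v] assms True by simp
        finally show ?thesis .
      qed
      \<comment> \<open>The value for which \<open>sqrt (2 * s * m)\<close> equals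
        \<open>m * \<bar>v\<bar>\<close>; it is half of the term \<open>m * v\<^sup>2\<close> that
        has to exceed it.\<close>
      define s where "s = m * v\<^sup>2 / 2"
      have "s > 0" using \<open>v \<noteq> 0\<close> m_pos by (simp add: s_def)
      have "2 * s * m = (m * \<bar>v\<bar>)\<^sup>2" by (simp add: s_def power2_eq_square)
      then have "sqrt (2 * s * m) = m * \<bar>v\<bar>" using m_pos by simp
      then have "- s + m * v\<^sup>2 \<le> 0"
        using le[OF \<open>s > 0\<close>] by (simp add: power2_eq_square algebra_simps)
      moreover have "m * v\<^sup>2 > 0" using \<open>v \<noteq> 0\<close> m_pos by simp
      ultimately show False by (simp add: s_def)
    qed
    then show ?thesis using True by simp
  next
    case False
    define K where "K = \<bar>\<xi>\<bar>"
    have "K > 0" using False by (simp add: K_def)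
    \<comment> \<open>Remainder bound: with \<open>x = 2 * \<nu> * a y / K\<^sup>2\<close> the
      quadratic term \<open>K * (x\<^sup>2 / 2)\<close> is at most \<open>C * \<nu>\<^sup>2\<close>,
      because \<open>a y \<le> M\<close>.\<close>
    define C where "C = 2 * M\<^sup>2 / (K * K * K)"
    have ineq: "\<nu> * (1 - \<bar>v\<bar> * A / K) \<le> \<bar>v\<bar> * C * \<nu>\<^sup>2" if small: "\<bar>\<nu>\<bar> \<le> \<xi>\<^sup>2 / (2 * M)" for \<nu>
    proof -
      have adm: "\<nu> \<in> admissible a \<xi>" unfolding admissible_def
      proof safe
        fix y
        have "2 * \<nu> * a y \<le> 2 * \<bar>\<nu>\<bar> * M"
          using a_le[of y] a_pos[of y] by (intro mult_mono[of "2 * \<nu>"]) auto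
        also have "\<dots> \<le> \<xi>\<^sup>2" using small M_pos by (simp add: field_simps)
        finally show "2 * \<nu> * a y \<le> \<xi>\<^sup>2" .
      qed
      have pt: "K - C * \<nu>\<^sup>2 - \<nu> / K * a y \<le> momentum a \<xi> \<nu> y" for y
      proof -
        define x where "x = 2 * \<nu> * a y / K\<^sup>2"
        have "x \<le> 1" using adm \<open>K > 0\<close> by (auto simp: x_def K_def admissible_def divide_le_eq)
        have "x \<ge> -1"
        proof -
          have "2 * - \<nu> * a y \<le> 2 * \<bar>\<nu>\<bar> * M"
            using a_le[of y] a_pos[of y] by (intro mult_mono[of "2 * - \<nu>"]) auto
          also have "\<dots> \<le> \<xi>\<^sup>2" using small M_pos by (simp add: field_simps)
          finally show ?thesis using \<open>K > 0\<close> by (simp add: x_def K_def field_simps)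
        qed
        \<comment> \<open>A second-order minorant of the root on \<open>[-1, 1]\<close>: the
          difference of the squares factors as
          \<open>(1 - x) * x\<^sup>2 * (3 + x) / 4\<close>.\<close>
        have "(1 - x / 2 - x\<^sup>2 / 2) \<le> sqrt (1 - x)"
        proof (rule real_le_rsqrt)
          have "1 - x - (1 - x / 2 - x\<^sup>2 / 2)\<^sup>2 = (1 - x) * x\<^sup>2 * (3 + x) / 4"
            by (simp add: power2_eq_square algebra_simps)
          moreover have "0 \<le> (1 - x) * x\<^sup>2 * (3 + x) / 4"
            using \<open>x \<le> 1\<close> \<open>x \<ge> -1\<close> by (intro divide_nonneg_pos mult_nonneg_nonneg) auto
          ultimately show "(1 - x / 2 - x\<^sup>2 / 2)\<^sup>2 \<le> 1 - x" by linarith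
        qed
        then have "K * (1 - x / 2 - x\<^sup>2 / 2) \<le> K * sqrt (1 - x)"
          using \<open>K > 0\<close> by simp
        also have "\<dots> = sqrt (K\<^sup>2 * (1 - x))" using \<open>K > 0\<close> by (simp add: real_sqrt_mult)
        also have "K\<^sup>2 * (1 - x) = \<xi>\<^sup>2 - 2 * \<nu> * a y"
          using \<open>K > 0\<close> by (simp add: x_def K_def field_simps)
        finally have "K * (1 - x / 2 - x\<^sup>2 / 2) \<le> momentum a \<xi> \<nu> y" by (simp add: momentum_def)
        moreover have "K * (x / 2) = \<nu> / K * a y"
          using \<open>K > 0\<close> by (simp add: x_def field_simps power2_eq_square)
        moreover have "K * (x\<^sup>2 / 2) \<le> C * \<nu>\<^sup>2"
        proof -
          have "K * (x\<^sup>2 / 2) = 2 * (a y)\<^sup>2 / (K * K * K) * \<nu>\<^sup>2"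
            using \<open>K > 0\<close> by (simp add: x_def field_simps power2_eq_square)
          also have "\<dots> \<le> C * \<nu>\<^sup>2" unfolding C_def
            using a_le[of y] a_pos[of y] \<open>K > 0\<close>
            by (intro mult_right_mono divide_right_mono mult_left_mono power_mono) auto
          finally show ?thesis .
        qed
        ultimately show ?thesis by (simp add: algebra_simps)
      qed
      have "((\<lambda>y. K - C * \<nu>\<^sup>2 - \<nu> / K * a y) has_integral K - C * \<nu>\<^sup>2 - \<nu> / K * A) {0..1}"
        using has_integral_diff[OF has_integral_const_real[of "K - C * \<nu>\<^sup>2" 0 1]
            has_integral_mult_right[OF integrable_integral[OF a_integrable], of "\<nu> / K"]]
        by (simp add: A_def)
      then have "K - C * \<nu>\<^sup>2 - \<nu> / K * A \<le> mean_momentum a \<xi> \<nu>"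
        unfolding mean_momentum_def using pt has_integral_le[OF _ integrable_integral[OF momentum_integrable]] by blast
      then have "\<nu> + \<bar>v\<bar> * (K - C * \<nu>\<^sup>2 - \<nu> / K * A) \<le> \<nu> + \<bar>v\<bar> * mean_momentum a \<xi> \<nu>"
        by (intro add_left_mono mult_left_mono) auto
      also have "\<dots> \<le> \<bar>v\<bar> * K" using eff_upper[OF adm, of v] assms sgn by (simp add: K_def)
      finally show ?thesis by (simp add: algebra_simps)
    qed
    define D where "D = 1 - \<bar>v\<bar> * A / K"
    define B where "B = \<bar>v\<bar> * C"
    have "B \<ge> 0" using \<open>K > 0\<close> by (simp add: B_def C_def)
    have "D = 0"
    proof (rule ccontr)
      assume "D \<noteq> 0"
      \<comment> \<open>The length of a step in the direction \<open>sgn D\<close>: the first entry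
        keeps the multiplier admissible, the second makes the quadratic term at most half of the
        linear one.\<close>
      define t where "t = min (\<xi>\<^sup>2 / (2 * M)) (\<bar>D\<bar> / (2 * (B + 1)))"
      have "t > 0" using False M_pos \<open>D \<noteq> 0\<close> \<open>B \<ge> 0\<close> by (simp add: t_def)
      have "\<bar>sgn D * t\<bar> \<le> \<xi>\<^sup>2 / (2 * M)" using \<open>t > 0\<close> \<open>D \<noteq> 0\<close> by (simp add: abs_mult abs_sgn_eq t_def)
      from ineq[OF this] have "sgn D * t * D \<le> B * (sgn D * t)\<^sup>2" by (simp add: D_def B_def)
      moreover have "(sgn D * t)\<^sup>2 = t * t" using \<open>D \<noteq> 0\<close> by (auto simp: sgn_if power2_eq_square)
      moreover have "sgn D * t * D = t * \<bar>D\<bar>" by (simp add: abs_sgn mult.commute mult.left_commute)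
      ultimately have "t * \<bar>D\<bar> \<le> t * (B * t)" by (simp add: mult.left_commute)
      then have "\<bar>D\<bar> \<le> B * t" using \<open>t > 0\<close> by simp
      also have "\<dots> \<le> (B + 1) * (\<bar>D\<bar> / (2 * (B + 1)))"
        using \<open>B \<ge> 0\<close> \<open>t > 0\<close> by (intro mult_mono) (auto simp: t_def)
      also have "\<dots> = \<bar>D\<bar> / 2" using \<open>B \<ge> 0\<close> by (simp add: field_simps)
      finally show False using \<open>D \<noteq> 0\<close> by simp
    qed
    then have abs: "\<bar>\<xi>\<bar> = A * \<bar>v\<bar>" using \<open>K > 0\<close> by (simp add: D_def K_def field_simps)
    then have "\<xi> * v = (A * v) * v" using sgn by (simp add: power2_eq_square)
    moreover have "v \<noteq> 0" using abs False by auto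
    ultimately show ?thesis by (simp add: A_def)
  qed
qed

lemma eff_contact_iff: "eff_density a v \<xi> = \<xi> * v \<longleftrightarrow> \<xi> = integral {0..1} a * v"
  using eff_contact_imp eff_contact_le eff_ge_abs[of v \<xi>] by (smt (verit) mult.commute)

text \<open>With zero force the term is
  \<open>\<nu> + \<bar>v\<bar> * sqrt (- 2 * \<nu>) * S\<close>, bounded by the inequality between
  arithmetic and geometric mean.\<close>

lemma eff_no_force_le: "eff_density a v 0 \<le> v\<^sup>2 / 2 * (integral {0..1} (\<lambda>y. sqrt (a y)))\<^sup>2"
proof (rule eff_least)
  fix \<nu> assume \<nu>: "\<nu> \<in> admissible a 0"
  define S where "S = integral {0..1} (\<lambda>y. sqrt (a y))"
  have "\<nu> \<le> 0" using admissible_le[OF \<nu>, of 0] by simp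
  have "momentum a 0 \<nu> = (\<lambda>y. sqrt (- 2 * \<nu>) * sqrt (a y))"
    by (auto simp: momentum_def fun_eq_iff simp flip: real_sqrt_mult)
  then have "mean_momentum a 0 \<nu> = sqrt (- 2 * \<nu>) * S"
    by (simp add: mean_momentum_def S_def)
  moreover have "2 * sqrt (- 2 * \<nu>) * (\<bar>v\<bar> * S) \<le> (sqrt (- 2 * \<nu>))\<^sup>2 + (\<bar>v\<bar> * S)\<^sup>2"
    by (rule sum_squares_bound)
  moreover have "(sqrt (- 2 * \<nu>))\<^sup>2 = - 2 * \<nu>" using \<open>\<nu> \<le> 0\<close> by simp
  ultimately show "\<nu> + \<bar>v\<bar> * mean_momentum a 0 \<nu> \<le> v\<^sup>2 / 2 * S\<^sup>2"
    by (simp add: power_mult_distrib algebra_simps)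
qed

section \<open>Strict inequalities for nonconstant coefficients\<close>

lemma nonconstant_unit_interval:
  assumes "\<not> a constant_on UNIV"
  shows "\<exists>y\<in>{0..1}. a y \<noteq> c"
proof (rule ccontr)
  assume "\<not> (\<exists>y\<in>{0..1}. a y \<noteq> c)"
  then have "a (frac y) = c" for y using frac_lt_1[of y] by (simp add: less_imp_le)
  then show False using assms per_frac by (simp add: constant_on_def)
qed

text \<open>The difference is the variance of \<open>sqrt (a y)\<close> over a period, and it
  vanishes only for constant \<open>a\<close>.\<close>

lemma mean_sqrt_less:
  assumes "\<not> a constant_on UNIV"
  shows "(integral {0..1} (\<lambda>y. sqrt (a y)))\<^sup>2 < integral {0..1} a"
proof -
  define S where "S = integral {0..1} (\<lambda>y. sqrt (a y))"
  have c: "continuous_on {0..1} a" by (rule continuous_on_subset[OF cont_a]) simp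
  then have cs: "continuous_on {0..1} (\<lambda>y. sqrt (a y))" by (intro continuous_intros)
  have "((\<lambda>y. a y - 2 * S * sqrt (a y) + S\<^sup>2) has_integral integral {0..1} a - 2 * S * S + S\<^sup>2) {0..1}"
    using has_integral_add[OF has_integral_diff[OF integrable_integral[OF a_integrable]
      has_integral_mult_right[OF integrable_integral[OF integrable_continuous_interval[OF cs]], of "2 * S"]]
      has_integral_const_real[of "S\<^sup>2" 0 1]] by (simp add: S_def)
  moreover have "a y - 2 * S * sqrt (a y) + S\<^sup>2 = (sqrt (a y) - S)\<^sup>2" for y
    using a_pos[of y] by (simp add: power2_diff)
  ultimately have i: "integral {0..1} (\<lambda>y. (sqrt (a y) - S)\<^sup>2) = integral {0..1} a - S\<^sup>2"
    by (simp add: integral_unique power2_eq_square)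
  have csq: "continuous_on {0..1} (\<lambda>y. (sqrt (a y) - S)\<^sup>2)"
    by (intro continuous_on_power continuous_on_diff cs continuous_on_const)
  then have "integral {0..1} (\<lambda>y. (sqrt (a y) - S)\<^sup>2) = 0 \<longleftrightarrow> (\<forall>y\<in>{0..1}. (sqrt (a y) - S)\<^sup>2 = 0)"
    by (intro integral_eq_0_iff) auto
  moreover have "\<not> (\<forall>y\<in>{0..1}. (sqrt (a y) - S)\<^sup>2 = 0)"
    using nonconstant_unit_interval[OF assms, of "S\<^sup>2"] a_pos
    by (metis eq_iff_diff_eq_0 less_imp_le power2_eq_iff_nonneg power_zero_numeral real_sqrt_pow2 zero_eq_power2)
  moreover have "0 \<le> integral {0..1} (\<lambda>y. (sqrt (a y) - S)\<^sup>2)"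
    by (rule integral_nonneg[OF integrable_continuous_interval[OF csq]]) simp
  ultimately have "0 < integral {0..1} a - S\<^sup>2" using i by (smt (verit))
  then show ?thesis by (simp add: S_def)
qed

text \<open>At the largest multiplier the momentum vanishes only where \<open>a\<close> attains its
  maximum, which for nonconstant \<open>a\<close> is not the whole period.\<close>

lemma mean_momentum_pos:
  assumes "\<not> a constant_on UNIV" "\<xi> \<noteq> 0" "\<And>y. a y \<le> a y0"
  shows "0 < mean_momentum a \<xi> (\<xi>\<^sup>2 / (2 * a y0))"
proof -
  define \<nu> where "\<nu> = \<xi>\<^sup>2 / (2 * a y0)"
  have adm: "\<nu> \<in> admissible a \<xi>" unfolding \<nu>_def by (rule max_admissible[OF assms(3)])
  have "mean_momentum a \<xi> \<nu> = 0 \<longleftrightarrow> (\<forall>y\<in>{0..1}. momentum a \<xi> \<nu> y = 0)"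
    unfolding mean_momentum_def by (intro integral_eq_0_iff cont_momentum momentum_nonneg[OF adm]) simp
  moreover have "momentum a \<xi> \<nu> y \<noteq> 0" if "a y \<noteq> a y0" for y
    using that assms(2) a_pos[of y0] by (simp add: momentum_def \<nu>_def field_simps)
  ultimately have "mean_momentum a \<xi> \<nu> \<noteq> 0"
    using nonconstant_unit_interval[OF assms(1), of "a y0"] by auto
  then show ?thesis using mean_momentum_nonneg[OF adm] by (simp add: \<nu>_def)
qed

end

text \<open>The hypotheses bound the local cost of \<open>a\<close> by \<open>\<theta>\<close> times
  that of \<open>b\<close> plus \<open>C\<close>. The densities inherit this through their dual
  formulas: \<open>(\<nu> - C) / \<theta>\<close> is the multiplier that transfers, and its momentum
  for \<open>b\<close> dominates that of \<open>a\<close> divided by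
  \<open>\<theta>\<close>.\<close>

lemma eff_compare:
  assumes a: "periodic_coeff a m M" and b: "periodic_coeff b m M"
    and \<theta>: "\<theta> \<ge> 1" and C: "C \<ge> 0"
    and ab: "\<And>y. a y \<le> \<theta> * b y"
    and \<xi>: "\<And>y. \<xi>\<^sup>2 / (2 * a y) \<le> \<theta> * (\<eta>\<^sup>2 / (2 * b y)) + C"
  shows "eff_density a v \<xi> \<le> \<theta> * eff_density b v \<eta> + C"
proof -
  interpret a: periodic_coeff a m M by (rule a)
  interpret b: periodic_coeff b m M by (rule b)
  show ?thesis
  proof (rule a.eff_least)
    fix \<nu> assume \<nu>: "\<nu> \<in> admissible a \<xi>"
    define \<kappa> where "\<kappa> = (\<nu> - C) / \<theta>"
    have "\<theta> > 0" using \<theta> by simp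
    have key: "\<kappa> + w * (momentum a \<xi> \<nu> y / \<theta>) \<le> b y / 2 * w\<^sup>2 + \<eta>\<^sup>2 / (2 * b y)" if "w \<ge> 0" for w y
    proof -
      have "\<nu> + w * momentum a \<xi> \<nu> y \<le> a y / 2 * w\<^sup>2 + \<xi>\<^sup>2 / (2 * a y)"
        using a.young_momentum[OF \<nu>, of w y] that by simp
      also have "\<dots> \<le> (\<theta> * b y) / 2 * w\<^sup>2 + (\<theta> * (\<eta>\<^sup>2 / (2 * b y)) + C)"
        using ab \<xi> by (intro add_mono mult_right_mono divide_right_mono) auto
      finally have "\<nu> - C + w * momentum a \<xi> \<nu> y \<le> \<theta> * (b y / 2 * w\<^sup>2 + \<eta>\<^sup>2 / (2 * b y))"
        by (simp add: algebra_simps)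
      then have "(\<nu> - C + w * momentum a \<xi> \<nu> y) / \<theta> \<le> b y / 2 * w\<^sup>2 + \<eta>\<^sup>2 / (2 * b y)"
        using \<open>\<theta> > 0\<close> by (simp add: pos_divide_le_eq mult.commute)
      then show ?thesis by (simp add: \<kappa>_def add_divide_distrib)
    qed
    have adm: "\<kappa> \<in> admissible b \<eta>" unfolding admissible_def
    proof safe
      fix y show "2 * \<kappa> * b y \<le> \<eta>\<^sup>2"
        using key[of 0 y] b.a_pos[of y] by (simp add: field_simps)
    qed
    have mom: "momentum a \<xi> \<nu> y / \<theta> \<le> momentum b \<eta> \<kappa> y" for y
    proof -
      define p where "p = momentum a \<xi> \<nu> y / \<theta>"
      have "p \<ge> 0" using a.momentum_nonneg[OF \<nu>] \<theta> by (simp add: p_def)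
      \<comment> \<open>\<open>w = p / b y\<close> is the speed with momentum \<open>p\<close>,
        where \<open>key\<close> is sharpest and reads
        \<open>p\<^sup>2 \<le> \<eta>\<^sup>2 - 2 * \<kappa> * b y\<close>.\<close>
      then have "0 \<le> p / b y" using b.a_pos[of y] by simp
      from key[OF this, of y] have "\<kappa> + (p / b y) * p \<le> b y / 2 * (p / b y)\<^sup>2 + \<eta>\<^sup>2 / (2 * b y)"
        by (simp only: p_def)
      then have "b y * (p\<^sup>2 + 2 * \<kappa> * b y) \<le> b y * \<eta>\<^sup>2"
        using b.a_pos[of y] by (simp add: field_simps power2_eq_square)
      then have "p\<^sup>2 \<le> \<eta>\<^sup>2 - 2 * \<kappa> * b y"
        using b.a_pos[of y] by simp
      then show ?thesis unfolding p_def[symmetric] momentum_def[of b] by (rule real_le_rsqrt)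
    qed
    have "mean_momentum a \<xi> \<nu> / \<theta> \<le> mean_momentum b \<eta> \<kappa>"
      unfolding mean_momentum_def
      using has_integral_le[OF has_integral_divide[OF integrable_integral[OF a.momentum_integrable]]
        integrable_integral[OF b.momentum_integrable]] mom by blast
    then have "\<kappa> + \<bar>v\<bar> * (mean_momentum a \<xi> \<nu> / \<theta>) \<le> eff_density b v \<eta>"
      by (intro order_trans[OF _ b.eff_upper[OF adm]] add_left_mono mult_left_mono) auto
    then have "\<theta> * (\<kappa> + \<bar>v\<bar> * (mean_momentum a \<xi> \<nu> / \<theta>)) \<le> \<theta> * eff_density b v \<eta>"
      using \<open>\<theta> > 0\<close> by (intro mult_left_mono) auto
    moreover have "\<theta> * (\<kappa> + \<bar>v\<bar> * (mean_momentum a \<xi> \<nu> / \<theta>)) = \<nu> - C + \<bar>v\<bar> * mean_momentum a \<xi> \<nu>"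
      using \<open>\<theta> > 0\<close> by (simp add: \<kappa>_def field_simps)
    ultimately show "\<nu> + \<bar>v\<bar> * mean_momentum a \<xi> \<nu> \<le> \<theta> * eff_density b v \<eta> + C" by linarith
  qed
qed

section \<open>Cell bounds and freezing of the slow variable\<close>

lemma continuous_antiderivative:
  fixes g :: "real \<Rightarrow> real"
  assumes "continuous_on UNIV g"
  obtains G where "\<And>x. (G has_real_derivative g x) (at x)" "G 0 = 0"
    "\<And>x y. x \<le> y \<Longrightarrow> (g has_integral G y - G x) {x..y}"
proof -
  define G where "G x = (if 0 \<le> x then integral {0..x} g else - integral {x..0} g)" for x
  have int: "g integrable_on {x..y}" for x y
    by (rule integrable_continuous_interval[OF continuous_on_subset[OF assms]]) simp
  have G: "G x = integral {-R..x} g - integral {-R..0} g" if "x \<in> {-R..R}" for x R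
  proof (cases "0 \<le> x")
    case True
    then show ?thesis
      using Henstock_Kurzweil_Integration.integral_combine[OF _ _ int, of "-R" 0 x] that
      by (simp add: G_def)
  next
    case False
    then show ?thesis
      using Henstock_Kurzweil_Integration.integral_combine[OF _ _ int, of "-R" x 0] that
      by (simp add: G_def)
  qed
  have D: "(G has_real_derivative g x) (at x)" for x
  proof -
    define R where "R = \<bar>x\<bar> + 1"
    have x: "x \<in> {-R<..<R}" by (auto simp: R_def)
    have "((\<lambda>x. integral {-R..x} g) has_real_derivative g x) (at x within {-R..R})"
      using x by (intro integral_has_real_derivative continuous_on_subset[OF assms]) auto
    then have "((\<lambda>x. integral {-R..x} g - integral {-R..0} g) has_real_derivative g x) (at x within {-R..R})"
      by (auto intro!: derivative_eq_intros)
    then have "((\<lambda>x. integral {-R..x} g - integral {-R..0} g) has_real_derivative g x) (at x)"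
      using x at_within_interior[of x "{-R..R}"] by simp
    then show ?thesis
      by (rule has_field_derivative_transform_within_open[of _ _ _ "{-R<..<R}"])
        (use x in \<open>auto intro!: G[symmetric]\<close>)
  qed
  have "(g has_integral G y - G x) {x..y}" if "x \<le> y" for x y
    using that D by (intro fundamental_theorem_of_calculus)
      (auto simp: has_real_derivative_iff_has_vector_derivative[symmetric] intro: has_field_derivative_at_within)
  then show thesis using D that[of G] by (auto simp: G_def)
qed

text \<open>\<open>G x - A * x\<close>, with \<open>A\<close> the mean of \<open>g\<close>, is
  1-periodic, so it is bounded by its values on one period.\<close>

lemma periodic_antiderivative:
  fixes g :: "real \<Rightarrow> real"
  assumes g: "continuous_on UNIV g" and per: "\<And>y. g (y + 1) = g y"
    and bounds: "\<And>y. 0 \<le> g y" "\<And>y. g y \<le> B"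
  obtains G where "\<And>x. (G has_real_derivative g x) (at x)"
    "\<And>x. \<bar>G x - integral {0..1} g * x\<bar> \<le> B"
proof -
  obtain G where G: "\<And>x. (G has_real_derivative g x) (at x)" "G 0 = 0"
    "\<And>x y. x \<le> y \<Longrightarrow> (g has_integral G y - G x) {x..y}"
    using continuous_antiderivative[OF g] by blast
  define A where "A = integral {0..1} g"
  have A: "G 1 = A" using G(3)[of 0 1] G(2) by (simp add: A_def integral_unique)
  have bd: "0 \<le> G x \<and> G x \<le> B * x" if "0 \<le> x" for x
    using has_integral_le[OF has_integral_const_real[of 0 0 x] G(3)[OF that]]
      has_integral_le[OF G(3)[OF that] has_integral_const_real[of B 0 x]] bounds that G(2)
    by (simp add: mult.commute)
  have "((\<lambda>x. G (x + 1) - G x) has_real_derivative 0) (at x)" for x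
    using DERIV_diff[OF DERIV_shift[THEN iffD1, OF G(1)] G(1)[of x], of 1] per[of x] by simp
  then have const: "G (x + 1) - G x = G (0 + 1) - G 0" for x
    using DERIV_isconst_all[of "\<lambda>x. G (x + 1) - G x" x 0] by blast
  have step: "G (x + 1) = G x + A" for x using const[of x] A G(2) by simp
  have "\<bar>G x - A * x\<bar> \<le> B" for x
  proof -
    have "G x - A * x = G (frac x) - A * frac x"
      using periodic_frac[of "\<lambda>x. G x - A * x" x] step by (simp add: algebra_simps)
    moreover have f: "0 \<le> frac x" "frac x \<le> 1" using frac_lt_1[of x] by auto
    moreover have "0 \<le> A" "A \<le> B" "0 \<le> B" using bd[of 1] A by auto
    moreover have "A * frac x \<le> B * 1" "B * frac x \<le> B * 1" "0 \<le> A * frac x"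
      using calculation by (intro mult_mono mult_nonneg_nonneg; simp)+
    ultimately show ?thesis using bd[OF f(1)] by linarith
  qed
  then show thesis using that[of G] G(1) A by (simp add: A_def)
qed

definition local_cost :: "(real \<Rightarrow> real) \<Rightarrow> real \<Rightarrow> real \<Rightarrow> real \<Rightarrow> real" where
  "local_cost a \<xi> y w = a y / 2 * w\<^sup>2 + \<xi>\<^sup>2 / (2 * a y)"

context periodic_coeff
begin

lemma local_cost_nonneg: "0 \<le> local_cost a \<xi> y w"
  using a_pos[of y] by (simp add: local_cost_def)

lemma local_cost_ge_kinetic: "m / 2 * w\<^sup>2 \<le> local_cost a \<xi> y w"
proof -
  have "m / 2 * w\<^sup>2 \<le> a y / 2 * w\<^sup>2" using a_ge[of y] by (intro mult_right_mono) auto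
  moreover have "0 \<le> \<xi>\<^sup>2 / (2 * a y)" using a_pos[of y] by simp
  ultimately show ?thesis unfolding local_cost_def by linarith
qed

text \<open>The antiderivative is rescaled to \<open>\<epsilon> * G (p / \<epsilon>)\<close>; the
  bounded deviation from mean growth becomes of order \<open>\<epsilon>\<close>, once for each
  endpoint.\<close>

lemma oscillating_momentum_antiderivative:
  assumes "\<nu> \<in> admissible a \<xi>" "\<epsilon> > 0"
  obtains \<Phi> where "\<And>p. (\<Phi> has_real_derivative momentum a \<xi> \<nu> (p / \<epsilon>)) (at p)"
    "\<And>p p'. \<bar>(\<Phi> p' - \<Phi> p) - mean_momentum a \<xi> \<nu> * (p' - p)\<bar> \<le> 2 * \<epsilon> * sqrt (\<xi>\<^sup>2 + 2 * \<bar>\<nu>\<bar> * M)"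
proof -
  define B where "B = sqrt (\<xi>\<^sup>2 + 2 * \<bar>\<nu>\<bar> * M)"
  obtain G where G: "\<And>x. (G has_real_derivative momentum a \<xi> \<nu> x) (at x)"
    "\<And>x. \<bar>G x - integral {0..1} (momentum a \<xi> \<nu>) * x\<bar> \<le> B"
    using periodic_antiderivative[OF cont_momentum per_momentum momentum_nonneg[OF assms(1)] momentum_le]
    unfolding B_def by blast
  show thesis
  proof (rule that[of "\<lambda>p. \<epsilon> * G (p / \<epsilon>)"])
    show "((\<lambda>p. \<epsilon> * G (p / \<epsilon>)) has_real_derivative momentum a \<xi> \<nu> (p / \<epsilon>)) (at p)" for p
      using \<open>\<epsilon> > 0\<close> by (auto intro!: derivative_eq_intros DERIV_chain2[OF G(1)])
    fix p p'
    have *: "\<bar>\<epsilon> * G (p / \<epsilon>) - mean_momentum a \<xi> \<nu> * p\<bar> \<le> \<epsilon> * B" for p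
    proof -
      have "\<epsilon> * G (p / \<epsilon>) - mean_momentum a \<xi> \<nu> * p
          = \<epsilon> * (G (p / \<epsilon>) - integral {0..1} (momentum a \<xi> \<nu>) * (p / \<epsilon>))"
        using \<open>\<epsilon> > 0\<close> by (simp add: mean_momentum_def algebra_simps)
      then show ?thesis using G(2)[of "p / \<epsilon>"] \<open>\<epsilon> > 0\<close> by (simp add: abs_mult)
    qed
    show "\<bar>(\<epsilon> * G (p' / \<epsilon>) - \<epsilon> * G (p / \<epsilon>)) - mean_momentum a \<xi> \<nu> * (p' - p)\<bar> \<le> 2 * \<epsilon> * sqrt (\<xi>\<^sup>2 + 2 * \<bar>\<nu>\<bar> * M)"
      unfolding B_def[symmetric] using *[of p] *[of p'] by (simp add: algebra_simps abs_le_iff)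
  qed
qed

text \<open>Young's inequality turns the cost into the derivative of an oscillating potential along
  the curve, whose homogenized increment is explicit.\<close>

lemma cell_lower_bound:
  assumes u: "u \<in> AC_curves T" and st: "0 \<le> s" "s \<le> t" "t \<le> T"
    and "\<epsilon> > 0" and \<nu>: "\<nu> \<in> admissible a \<xi>"
    and f: "(f has_integral I) {s..t}"
    and le: "\<And>x. x \<in> {s..t} \<Longrightarrow> local_cost a \<xi> (u x / \<epsilon>) (deriv u x) \<le> f x"
  shows "\<nu> * (t - s) + \<bar>u t - u s\<bar> * mean_momentum a \<xi> \<nu> - 2 * \<epsilon> * sqrt (\<xi>\<^sup>2 + 2 * \<bar>\<nu>\<bar> * M) \<le> I"
proof -
  obtain \<Phi> where \<Phi>: "\<And>p. (\<Phi> has_real_derivative momentum a \<xi> \<nu> (p / \<epsilon>)) (at p)"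
    "\<And>p p'. \<bar>(\<Phi> p' - \<Phi> p) - mean_momentum a \<xi> \<nu> * (p' - p)\<bar> \<le> 2 * \<epsilon> * sqrt (\<xi>\<^sup>2 + 2 * \<bar>\<nu>\<bar> * M)"
    using oscillating_momentum_antiderivative[OF \<nu> \<open>\<epsilon> > 0\<close>] by blast
  have "continuous_on UNIV (\<lambda>p. momentum a \<xi> \<nu> (p / \<epsilon>))"
    using \<open>\<epsilon> > 0\<close> by (intro continuous_on_compose2[OF cont_momentum[of UNIV]] continuous_intros) auto
  note chain = AC_curves_chain_rule_integral[OF u \<Phi>(1) this st]
  \<comment> \<open>The direction of the net displacement. The curve may move against it at times;
    Young's inequality still applies there because it involves only
    \<open>\<bar>deriv u x\<bar>\<close>.\<close>
  define \<sigma> where "\<sigma> = (if u s \<le> u t then 1 else -1 :: real)"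
  have "((\<lambda>x. \<nu> + \<sigma> * (momentum a \<xi> \<nu> (u x / \<epsilon>) * deriv u x)) has_integral
      (\<nu> * (t - s) + \<sigma> * (\<Phi> (u t) - \<Phi> (u s)))) {s..t}"
    using has_integral_add[OF has_integral_const_real[of \<nu> s t] has_integral_mult_right[OF chain, of \<sigma>]] st
    by (simp add: mult.commute)
  moreover have "\<nu> + \<sigma> * (momentum a \<xi> \<nu> (u x / \<epsilon>) * deriv u x) \<le> f x" if "x \<in> {s..t}" for x
  proof -
    have "\<sigma> * (momentum a \<xi> \<nu> (u x / \<epsilon>) * deriv u x) \<le> \<bar>\<sigma> * (momentum a \<xi> \<nu> (u x / \<epsilon>) * deriv u x)\<bar>"
      by (rule abs_ge_self)
    also have "\<dots> = \<bar>deriv u x\<bar> * momentum a \<xi> \<nu> (u x / \<epsilon>)"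
      using momentum_nonneg[OF \<nu>] by (simp add: abs_mult \<sigma>_def)
    finally have "\<nu> + \<sigma> * (momentum a \<xi> \<nu> (u x / \<epsilon>) * deriv u x) \<le> local_cost a \<xi> (u x / \<epsilon>) (deriv u x)"
      using young_momentum[OF \<nu>, of "deriv u x" "u x / \<epsilon>"] by (simp add: local_cost_def)
    then show ?thesis using le[OF that] by linarith
  qed
  ultimately have "\<nu> * (t - s) + \<sigma> * (\<Phi> (u t) - \<Phi> (u s)) \<le> I"
    using has_integral_le f by blast
  moreover have "\<bar>u t - u s\<bar> * mean_momentum a \<xi> \<nu> - 2 * \<epsilon> * sqrt (\<xi>\<^sup>2 + 2 * \<bar>\<nu>\<bar> * M) \<le> \<sigma> * (\<Phi> (u t) - \<Phi> (u s))"
  proof -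
    define E where "E = (\<Phi> (u t) - \<Phi> (u s)) - mean_momentum a \<xi> \<nu> * (u t - u s)"
    have "\<bar>u t - u s\<bar> * mean_momentum a \<xi> \<nu> = \<sigma> * (mean_momentum a \<xi> \<nu> * (u t - u s))"
      by (simp add: \<sigma>_def)
    then have "\<sigma> * (\<Phi> (u t) - \<Phi> (u s)) = \<sigma> * E + \<bar>u t - u s\<bar> * mean_momentum a \<xi> \<nu>"
      by (simp add: E_def algebra_simps)
    moreover have "- \<bar>E\<bar> \<le> \<sigma> * E" by (auto simp: \<sigma>_def)
    ultimately show ?thesis using \<Phi>(2)[where p = "u s" and p' = "u t"] unfolding E_def by linarith
  qed
  ultimately show ?thesis by linarith
qed

text \<open>Young's inequality with a free weight. A small \<open>\<kappa>\<close> makes the energy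
  term small, and a short total length then controls the other term, which gives absolute continuity
  uniformly under an energy bound.\<close>

lemma displacement_bound:
  assumes u: "u \<in> AC_curves T" and st: "0 \<le> s" "s \<le> t" "t \<le> T"
    and "\<kappa> > 0" and f: "(f has_integral I) {s..t}"
    and le: "\<And>x. x \<in> {s..t} \<Longrightarrow> m / 2 * (deriv u x)\<^sup>2 \<le> f x"
  shows "\<bar>u t - u s\<bar> \<le> \<kappa> * I + (t - s) / (2 * m * \<kappa>)"
proof -
  define \<sigma> where "\<sigma> = (if u s \<le> u t then 1 else -1 :: real)"
  have "((\<lambda>x. \<sigma> * deriv u x) has_integral \<sigma> * (u t - u s)) {s..t}"
    using AC_curves_FTC[OF u st] by (rule has_integral_mult_right)
  moreover have "((\<lambda>x. \<kappa> * f x + 1 / (2 * m * \<kappa>)) has_integral \<kappa> * I + (t - s) / (2 * m * \<kappa>)) {s..t}"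
    using has_integral_add[OF has_integral_mult_right[OF f, of \<kappa>] has_integral_const_real[of "1 / (2 * m * \<kappa>)" s t]] st
    by simp
  moreover have "\<sigma> * deriv u x \<le> \<kappa> * f x + 1 / (2 * m * \<kappa>)" if "x \<in> {s..t}" for x
  proof -
    have "\<sigma> * deriv u x \<le> \<bar>deriv u x\<bar>" by (auto simp: \<sigma>_def)
    also have "\<dots> \<le> \<kappa> * (m / 2 * (deriv u x)\<^sup>2) + 1 / (2 * m * \<kappa>)"
    proof -
      have "\<kappa> * (m / 2 * (deriv u x)\<^sup>2) + 1 / (2 * m * \<kappa>) - \<bar>deriv u x\<bar>
          = (m * \<kappa> * \<bar>deriv u x\<bar> - 1)\<^sup>2 / (2 * m * \<kappa>)"
        using m_pos \<open>\<kappa> > 0\<close> by (simp add: power2_eq_square field_simps)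
      also have "\<dots> \<ge> 0" using m_pos \<open>\<kappa> > 0\<close> by simp
      finally show ?thesis by linarith
    qed
    also have "\<dots> \<le> \<kappa> * f x + 1 / (2 * m * \<kappa>)"
      using le[OF that] \<open>\<kappa> > 0\<close> by simp
    finally show ?thesis .
  qed
  ultimately have "\<sigma> * (u t - u s) \<le> \<kappa> * I + (t - s) / (2 * m * \<kappa>)" using has_integral_le by blast
  then show ?thesis by (auto simp: \<sigma>_def split: if_splits)
qed

end

text \<open>The lower bound \<open>m\<close> turns the absolute distance \<open>\<omega>\<close>
  into the relative factor \<open>1 + \<omega> / m\<close>; the change of
  \<open>\<xi>\<^sup>2\<close> costs at most \<open>\<omega> / (2 * m)\<close>.\<close>

lemma coeff_compare:
  assumes a: "periodic_coeff a m M" and b: "periodic_coeff b m M"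
    and ab: "\<And>y. \<bar>a y - b y\<bar> \<le> \<omega>" and \<xi>: "\<bar>\<xi>\<^sup>2 - \<eta>\<^sup>2\<bar> \<le> \<omega>"
  shows "a y \<le> (1 + \<omega> / m) * b y"
    and "\<xi>\<^sup>2 / (2 * a y) \<le> (1 + \<omega> / m) * (\<eta>\<^sup>2 / (2 * b y)) + \<omega> / (2 * m)"
proof -
  interpret a: periodic_coeff a m M by (rule a)
  interpret b: periodic_coeff b m M by (rule b)
  have "\<omega> \<ge> 0" using ab[of 0] by linarith
  have pos: "a y > 0" "b y > 0" "m > 0" using a.a_pos b.a_pos a.m_pos by auto
  have "\<omega> \<le> \<omega> / m * b y" "\<omega> \<le> \<omega> / m * a y"
    using mult_left_mono[OF b.a_ge \<open>\<omega> \<ge> 0\<close>, of y] mult_left_mono[OF a.a_ge \<open>\<omega> \<ge> 0\<close>, of y] pos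
    by (auto simp: field_simps)
  then have 1: "a y \<le> (1 + \<omega> / m) * b y" and 2: "b y \<le> (1 + \<omega> / m) * a y"
    using ab[of y] by (auto simp: algebra_simps)
  show "a y \<le> (1 + \<omega> / m) * b y" by (rule 1)
  have "1 / a y \<le> (1 + \<omega> / m) / b y" using 2 pos by (simp add: field_simps)
  then have "\<eta>\<^sup>2 / 2 * (1 / a y) \<le> \<eta>\<^sup>2 / 2 * ((1 + \<omega> / m) / b y)" by (intro mult_left_mono) auto
  moreover have "\<omega> / 2 * (1 / a y) \<le> \<omega> / 2 * (1 / m)"
    using \<open>\<omega> \<ge> 0\<close> a.a_ge[of y] pos by (intro mult_left_mono) (auto simp: frac_le)
  moreover have "\<xi>\<^sup>2 / 2 * (1 / a y) \<le> (\<eta>\<^sup>2 + \<omega>) / 2 * (1 / a y)"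
    using \<xi> pos by (intro mult_right_mono) auto
  ultimately show "\<xi>\<^sup>2 / (2 * a y) \<le> (1 + \<omega> / m) * (\<eta>\<^sup>2 / (2 * b y)) + \<omega> / (2 * m)"
    by (simp add: add_divide_distrib algebra_simps)
qed

lemma local_cost_compare:
  assumes "periodic_coeff a m M" "periodic_coeff b m M"
    and "\<And>y. \<bar>a y - b y\<bar> \<le> \<omega>" "\<bar>\<xi>\<^sup>2 - \<eta>\<^sup>2\<bar> \<le> \<omega>"
  shows "local_cost a \<xi> y w \<le> (1 + \<omega> / m) * local_cost b \<eta> y w + \<omega> / (2 * m)"
proof -
  have "a y / 2 * w\<^sup>2 \<le> ((1 + \<omega> / m) * b y) / 2 * w\<^sup>2"
    using coeff_compare(1)[OF assms, of y] by (intro mult_right_mono divide_right_mono) auto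
  then have "local_cost a \<xi> y w \<le> ((1 + \<omega> / m) * b y) / 2 * w\<^sup>2 +
      ((1 + \<omega> / m) * (\<eta>\<^sup>2 / (2 * b y)) + \<omega> / (2 * m))"
    unfolding local_cost_def using coeff_compare(2)[OF assms, of y] by (rule add_mono)
  also have "\<dots> = (1 + \<omega> / m) * local_cost b \<eta> y w + \<omega> / (2 * m)"
    unfolding local_cost_def distrib_left by simp
  finally show ?thesis .
qed

lemma eff_density_compare:
  assumes a: "periodic_coeff a m M" and b: "periodic_coeff b m M"
    and ab: "\<And>y. \<bar>a y - b y\<bar> \<le> \<omega>" and \<xi>: "\<bar>\<xi>\<^sup>2 - \<eta>\<^sup>2\<bar> \<le> \<omega>"
  shows "eff_density a v \<xi> \<le> (1 + \<omega> / m) * eff_density b v \<eta> + \<omega> / (2 * m)"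
proof (rule eff_compare[OF a b _ _ coeff_compare[OF assms]])
  have "\<omega> \<ge> 0" using ab[of 0] by linarith
  moreover have "m > 0" using a by (rule periodic_coeff.m_pos)
  ultimately show "1 + \<omega> / m \<ge> 1" "\<omega> / (2 * m) \<ge> 0" by auto
qed

text \<open>\<open>\<Xi>\<close> is the total force as a function of position. It will be
  \<open>- deriv E - deriv F\<close>, so one proof covers every energy and every tilt.\<close>

locale oscillating_coeff =
  fixes \<mu> :: "real \<Rightarrow> real \<Rightarrow> real" and m M :: real and \<Xi> :: "real \<Rightarrow> real"
  assumes cont: "continuous_on UNIV (\<lambda>(q, y). \<mu> q y)"
    and per: "\<And>q y. \<mu> q (y + 1) = \<mu> q y"
    and m_pos: "0 < m"
    and bounds: "\<And>q y. m \<le> \<mu> q y \<and> \<mu> q y \<le> M"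
    and cont_\<Xi>: "continuous_on UNIV \<Xi>"
begin

lemma cont_\<mu>: "continuous_on S f \<Longrightarrow> continuous_on S g \<Longrightarrow> continuous_on S (\<lambda>x. \<mu> (f x) (g x))"
  using continuous_on_compose2[OF cont, of S "\<lambda>x. (f x, g x)"] by (simp add: continuous_on_Pair)

lemma cont_\<Xi>': "continuous_on S f \<Longrightarrow> continuous_on S (\<lambda>x. \<Xi> (f x))"
  by (rule continuous_on_compose2[OF cont_\<Xi>]) auto

lemma \<mu>_coeff: "periodic_coeff (\<mu> c) m M"
  using per m_pos bounds cont_\<mu>[OF continuous_on_const continuous_on_id, of UNIV c]
  by unfold_locales auto

lemma M_pos: "M > 0" using m_pos bounds[of 0 0] by linarith

definition rate :: "real \<Rightarrow> (real \<Rightarrow> real) \<Rightarrow> real \<Rightarrow> real" where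
  "rate \<epsilon> u t = local_cost (\<mu> (u t)) (\<Xi> (u t)) (u t / \<epsilon>) (deriv u t)"

definition eff_rate :: "(real \<Rightarrow> real) \<Rightarrow> real \<Rightarrow> real" where
  "eff_rate q t = eff_density (\<mu> (q t)) (deriv q t) (\<Xi> (q t))"

lemma rate_nonneg: "0 \<le> rate \<epsilon> u t"
  unfolding rate_def by (rule periodic_coeff.local_cost_nonneg[OF \<mu>_coeff])

lemma eff_rate_nonneg: "0 \<le> eff_rate q t"
  unfolding eff_rate_def by (rule periodic_coeff.eff_nonneg[OF \<mu>_coeff])

text \<open>Uniform continuity on a compact rectangle covers one period; periodicity makes it
  uniform in all \<open>y\<close>.\<close>

lemma modulus:
  assumes "\<omega> > 0"
  obtains \<delta> where "\<delta> > 0" "\<And>q c. \<bar>q\<bar> \<le> R \<Longrightarrow> \<bar>c\<bar> \<le> R \<Longrightarrow> \<bar>q - c\<bar> < \<delta> \<Longrightarrow>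
    (\<forall>y. \<bar>\<mu> q y - \<mu> c y\<bar> \<le> \<omega>) \<and> \<bar>(\<Xi> q)\<^sup>2 - (\<Xi> c)\<^sup>2\<bar> \<le> \<omega>"
proof -
  have "uniformly_continuous_on ({-R..R} \<times> {0..1}) (\<lambda>(q, y). \<mu> q y)"
    by (intro compact_uniformly_continuous continuous_on_subset[OF cont] compact_Times) auto
  then obtain d1 where d1: "d1 > 0" "\<And>x x'. x \<in> {-R..R} \<times> {0..1} \<Longrightarrow> x' \<in> {-R..R} \<times> {0..1} \<Longrightarrow> dist x' x < d1 \<Longrightarrow>
      dist ((\<lambda>(q, y). \<mu> q y) x') ((\<lambda>(q, y). \<mu> q y) x) < \<omega>"
    using \<open>\<omega> > 0\<close> unfolding uniformly_continuous_on_def by metis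
  have "uniformly_continuous_on {-R..R} (\<lambda>q. (\<Xi> q)\<^sup>2)"
    by (intro compact_uniformly_continuous continuous_on_power cont_\<Xi>' continuous_on_id) auto
  then obtain d2 where d2: "d2 > 0" "\<And>x x'. x \<in> {-R..R} \<Longrightarrow> x' \<in> {-R..R} \<Longrightarrow> dist x' x < d2 \<Longrightarrow>
      dist ((\<Xi> x')\<^sup>2) ((\<Xi> x)\<^sup>2) < \<omega>"
    using \<open>\<omega> > 0\<close> unfolding uniformly_continuous_on_def by metis
  show thesis
  proof (rule that[of "min d1 d2"])
    show "min d1 d2 > 0" using d1 d2 by simp
    fix q c assume qc: "\<bar>q\<bar> \<le> R" "\<bar>c\<bar> \<le> R" "\<bar>q - c\<bar> < min d1 d2"
    have "\<bar>\<mu> q y - \<mu> c y\<bar> \<le> \<omega>" for y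
    proof -
      have "dist (q, frac y) (c, frac y) < d1" using qc(3) by (simp add: dist_Pair_Pair dist_real_def)
      then have "\<bar>\<mu> q (frac y) - \<mu> c (frac y)\<bar> < \<omega>"
        using d1(2)[of "(c, frac y)" "(q, frac y)"] qc frac_lt_1[of y] by (auto simp: dist_real_def abs_le_iff)
      moreover have "\<mu> q (frac y) = \<mu> q y" "\<mu> c (frac y) = \<mu> c y"
        by (rule periodic_frac[of "\<mu> q", OF per] periodic_frac[of "\<mu> c", OF per])+
      ultimately show ?thesis by simp
    qed
    moreover have "\<bar>(\<Xi> q)\<^sup>2 - (\<Xi> c)\<^sup>2\<bar> \<le> \<omega>"
      using d2(2)[of c q] qc by (auto simp: dist_real_def abs_le_iff)
    ultimately show "(\<forall>y. \<bar>\<mu> q y - \<mu> c y\<bar> \<le> \<omega>) \<and> \<bar>(\<Xi> q)\<^sup>2 - (\<Xi> c)\<^sup>2\<bar> \<le> \<omega>" by blast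
  qed
qed

text \<open>The supremum runs over an uncountable set that depends on \<open>t\<close>. The terms
  are continuous in \<open>\<nu>\<close> and admissibility is inherited downwards, so rational
  multipliers suffice for the strict inequality.\<close>

lemma eff_measurable:
  assumes p: "p \<in> borel_measurable N" and v: "v \<in> borel_measurable N"
  shows "(\<lambda>t. eff_density (\<mu> (p t)) (v t) (\<Xi> (p t))) \<in> borel_measurable N"
  unfolding borel_measurable_iff_greater
proof
  fix r :: real
  define D where "D \<nu> = {c. \<nu> \<in> admissible (\<mu> c) (\<Xi> c)}" for \<nu>
  define g where "g \<nu> c = mean_momentum (\<mu> c) (\<Xi> c) \<nu>" for \<nu> c
  have D: "D \<nu> \<in> sets borel" for \<nu>
  proof -
    have "D \<nu> = (\<Inter>y. {c. 2 * \<nu> * \<mu> c y \<le> (\<Xi> c)\<^sup>2})" by (auto simp: D_def admissible_def)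
    moreover have "closed {c. 2 * \<nu> * \<mu> c y \<le> (\<Xi> c)\<^sup>2}" for y
      by (intro closed_Collect_le continuous_intros cont_\<mu> cont_\<Xi>')
    then have "closed (\<Inter>y. {c. 2 * \<nu> * \<mu> c y \<le> (\<Xi> c)\<^sup>2})" by (rule closed_INT[rule_format])
    ultimately show ?thesis by (metis borel_closed)
  qed
  have g: "g \<nu> \<in> borel_measurable borel" for \<nu>
  proof -
    have "continuous_on (UNIV \<times> cbox 0 1) (\<lambda>(c, y). momentum (\<mu> c) (\<Xi> c) \<nu> y)"
      unfolding momentum_def case_prod_unfold by (intro continuous_intros cont_\<mu> cont_\<Xi>')
    then have "continuous_on UNIV (g \<nu>)"
      using integral_continuous_on_param[of UNIV 0 1 "\<lambda>c. momentum (\<mu> c) (\<Xi> c) \<nu>"]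
      by (simp add: g_def[abs_def] mean_momentum_def)
    then show ?thesis by (rule borel_measurable_continuous_onI)
  qed
  have eq: "{t \<in> space N. r < eff_density (\<mu> (p t)) (v t) (\<Xi> (p t))} =
    (\<Union>\<nu>\<in>\<rat>. {t \<in> space N. p t \<in> D \<nu> \<and> r < \<nu> + \<bar>v t\<bar> * g \<nu> (p t)})" (is "?L = ?R")
  proof (intro equalityI subsetI)
    fix t assume t: "t \<in> ?L"
    interpret periodic_coeff "\<mu> (p t)" m M by (rule \<mu>_coeff)
    obtain \<nu> where \<nu>: "\<nu> \<in> admissible (\<mu> (p t)) (\<Xi> (p t))" "r < \<nu> + \<bar>v t\<bar> * g \<nu> (p t)"
      using eff_approx t unfolding g_def by blast
    have "continuous_on (UNIV \<times> cbox 0 1) (\<lambda>(\<nu>, y). momentum (\<mu> (p t)) (\<Xi> (p t)) \<nu> y)"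
      unfolding momentum_def case_prod_unfold by (intro continuous_intros cont_\<mu>)
    then have "continuous_on UNIV (\<lambda>\<nu>. g \<nu> (p t))"
      using integral_continuous_on_param[of UNIV 0 1 "\<lambda>\<nu>. momentum (\<mu> (p t)) (\<Xi> (p t)) \<nu>"]
      by (simp add: g_def[abs_def] mean_momentum_def)
    then have "open {\<nu>. r < \<nu> + \<bar>v t\<bar> * g \<nu> (p t)}"
      by (intro open_Collect_less continuous_intros)
    then obtain e where e: "e > 0" "ball \<nu> e \<subseteq> {\<nu>. r < \<nu> + \<bar>v t\<bar> * g \<nu> (p t)}"
      using \<nu>(2) openE[of _ \<nu>] by blast
    \<comment> \<open>The rational is taken below \<open>\<nu>\<close>, which keeps it
      admissible.\<close>
    obtain \<nu>' where \<nu>': "\<nu>' \<in> \<rat>" "\<nu> - e < \<nu>'" "\<nu>' < \<nu>"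
      using Rats_dense_in_real[of "\<nu> - e" \<nu>] e(1) by auto
    then have "\<nu>' \<in> ball \<nu> e" by (auto simp: dist_real_def)
    then have "t \<in> {t \<in> space N. p t \<in> D \<nu>' \<and> r < \<nu>' + \<bar>v t\<bar> * g \<nu>' (p t)}"
      using e(2) t admissible_downward[OF \<nu>(1)] \<nu>'(3) unfolding D_def by auto
    then show "t \<in> ?R" using \<nu>'(1) by blast
  next
    fix t assume "t \<in> ?R"
    then obtain \<nu> where "t \<in> space N" "\<nu> \<in> admissible (\<mu> (p t)) (\<Xi> (p t))" "r < \<nu> + \<bar>v t\<bar> * g \<nu> (p t)"
      by (auto simp: D_def)
    then show "t \<in> ?L"
      using periodic_coeff.eff_upper[OF \<mu>_coeff] unfolding g_def by (auto intro: less_le_trans)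
  qed
  have "{t \<in> space N. p t \<in> D \<nu> \<and> r < \<nu> + \<bar>v t\<bar> * g \<nu> (p t)} \<in> sets N" for \<nu>
  proof -
    have "{t \<in> space N. p t \<in> D \<nu>} \<in> sets N"
      using measurable_sets[OF p D[of \<nu>]] by (simp add: vimage_def Int_def conj_commute)
    moreover have "(\<lambda>t. \<nu> + \<bar>v t\<bar> * g \<nu> (p t)) \<in> borel_measurable N"
      using v measurable_compose[OF p g[of \<nu>]] by measurable
    then have "{t \<in> space N. r < \<nu> + \<bar>v t\<bar> * g \<nu> (p t)} \<in> sets N"
      unfolding borel_measurable_iff_greater by blast
    ultimately have "{t \<in> space N. p t \<in> D \<nu>} \<inter> {t \<in> space N. r < \<nu> + \<bar>v t\<bar> * g \<nu> (p t)} \<in> sets N"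
      by (rule sets.Int)
    then show ?thesis by (simp add: Int_def conj_commute conj_left_commute)
  qed
  then show "{t \<in> space N. r < eff_density (\<mu> (p t)) (v t) (\<Xi> (p t))} \<in> sets N"
    unfolding eq by (intro sets.countable_UN'' countable_rat) auto
qed

lemma eff_rate_measurable:
  assumes "q \<in> AC_curves T"
  shows "eff_rate q \<in> borel_measurable (lebesgue_on {0..T})"
  unfolding eff_rate_def[abs_def]
  by (intro eff_measurable AC_curves_measurable AC_curves_deriv_measurable assms)

lemma rate_measurable:
  assumes "u \<in> AC_curves T" "\<epsilon> > 0"
  shows "rate \<epsilon> u \<in> borel_measurable (lebesgue_on {0..T})"
proof -
  note u = AC_curves_measurable[OF assms(1)] AC_curves_deriv_measurable[OF assms(1)]
  have "continuous_on UNIV (\<lambda>q. \<mu> q (q / \<epsilon>))" "continuous_on UNIV \<Xi>"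
    using assms(2) by (intro cont_\<mu> continuous_intros cont_\<Xi>; simp)+
  note c = this[THEN borel_measurable_continuous_onI, THEN measurable_compose[OF u(1)]]
  show ?thesis unfolding rate_def[abs_def] local_cost_def using c u(2) by measurable
qed

end

section \<open>Lower bound\<close>

lemma sum_integral_disjoint_le:
  fixes f :: "real \<Rightarrow> real"
  assumes f: "f integrable_on {0..T}" "\<And>x. 0 \<le> f x" and "finite I"
    and ab: "\<And>i. i \<in> I \<Longrightarrow> 0 \<le> a i \<and> a i \<le> b i \<and> b i \<le> T"
    and disj: "disjoint_family_on (\<lambda>i. {a i<..<b i}) I"
  shows "(\<Sum>i\<in>I. integral {a i..b i} f) \<le> integral {0..T} f"
proof -
  have int: "(f has_integral integral {a i..b i} f) {a i<..<b i}" if "i \<in> I" for i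
  proof -
    have "f integrable_on {a i..b i}"
      by (rule integrable_on_subinterval[OF f(1)]) (use ab[OF that] in auto)
    then show ?thesis using integrable_integral has_integral_Icc_iff_Ioo by blast
  qed
  have "(f has_integral (\<Sum>i\<in>I. integral {a i..b i} f)) (\<Union>i\<in>I. {a i<..<b i})"
  proof (rule has_integral_UN[OF \<open>finite I\<close> int])
    show "pairwise (\<lambda>i i'. negligible ({a i<..<b i} \<inter> {a i'<..<b i'})) I"
      using disj unfolding pairwise_def disjoint_family_on_def by simp
  qed
  moreover have "(\<Union>i\<in>I. {a i<..<b i}) \<subseteq> {0..T}" using ab by force
  ultimately show ?thesis
    using has_integral_subset_le[OF _ _ integrable_integral[OF f(1)]] f(2) by blast
qed

lemma integral_uniform_partition:
  fixes f :: "real \<Rightarrow> real"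
  assumes "f integrable_on {0..real N * h}" "0 \<le> h"
  shows "(\<Sum>i<N. integral {real i * h..real (Suc i) * h} f) = integral {0..real N * h} f"
  using assms
proof (induction N)
  case (Suc N)
  have le: "0 \<le> real N * h" "real N * h \<le> real (Suc N) * h" using \<open>0 \<le> h\<close> by (auto simp: algebra_simps)
  have "f integrable_on {0..real N * h}"
    by (rule integrable_on_subinterval[OF Suc.prems(1)]) (use le in auto)
  then show ?case
    using Suc.IH[OF _ Suc.prems(2)] Henstock_Kurzweil_Integration.integral_combine[OF le Suc.prems(1)] by simp
qed simp

section \<open>Nonnegative Lebesgue integrals as gauge integrals\<close>

lemma finite_nn_integral_has_integral:
  fixes f :: "real \<Rightarrow> real"
  assumes "f \<in> borel_measurable (lebesgue_on {a..b})" "\<And>x. 0 \<le> f x"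
    and fin: "(\<integral>\<^sup>+ x. ennreal (f x) \<partial>lebesgue_on {a..b}) < \<infinity>"
  shows "\<exists>I\<ge>0. (f has_integral I) {a..b} \<and> (\<integral>\<^sup>+ x. ennreal (f x) \<partial>lebesgue_on {a..b}) = ennreal I"
proof -
  have "integrable (lebesgue_on {a..b}) f"
    using assms by (intro integrableI_bounded) auto
  moreover from this have "(\<integral>\<^sup>+ x. ennreal (f x) \<partial>lebesgue_on {a..b}) = ennreal (integral\<^sup>L (lebesgue_on {a..b}) f)"
    using assms(2) by (intro nn_integral_eq_integral) auto
  ultimately show ?thesis
    using has_integral_integral_lebesgue_on[of "{a..b}" f] assms(2)
    by (intro exI[of _ "integral\<^sup>L (lebesgue_on {a..b}) f"]) (auto intro: integral_nonneg_AE)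
qed

lemma has_integral_imp_nn_integral:
  fixes f :: "real \<Rightarrow> real"
  assumes "(f has_integral I) {a..b}" "\<And>x. 0 \<le> f x"
  shows "(\<integral>\<^sup>+ x. ennreal (f x) \<partial>lebesgue_on {a..b}) = ennreal I"
proof -
  have "f absolutely_integrable_on {a..b}"
    using assms by (intro nonnegative_absolutely_integrable_1) auto
  then have "integrable (lebesgue_on {a..b}) f" by (rule absolutely_integrable_imp_integrable) simp
  then have "(\<integral>\<^sup>+ x. ennreal (f x) \<partial>lebesgue_on {a..b}) = ennreal (integral\<^sup>L (lebesgue_on {a..b}) f)"
    "integral\<^sup>L (lebesgue_on {a..b}) f = integral {a..b} f"
    using assms(2) by (auto intro: nn_integral_eq_integral lebesgue_integral_eq_integral)
  then show ?thesis using assms(1) by (simp add: integral_unique)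
qed

section \<open>Uniform meshes in time\<close>

definition mesh_left :: "real \<Rightarrow> real \<Rightarrow> real" where
  "mesh_left h t = of_int \<lfloor>t / h\<rfloor> * h"

lemma mesh_left_bounds:
  assumes "h > 0" shows "mesh_left h t \<le> t" "t < mesh_left h t + h"
proof -
  have "of_int \<lfloor>t / h\<rfloor> \<le> t / h" "t / h < of_int \<lfloor>t / h\<rfloor> + 1" by linarith+
  then show "mesh_left h t \<le> t" "t < mesh_left h t + h"
    unfolding mesh_left_def pos_le_divide_eq[OF assms] pos_divide_less_eq[OF assms]
    by (simp_all add: algebra_simps)
qed

lemma mesh_left_eq:
  assumes "h > 0" "real i * h \<le> t" "t < real (Suc i) * h"
  shows "mesh_left h t = real i * h"
proof -
  have "\<lfloor>t / h\<rfloor> = int i" using assms by (intro floor_unique) (auto simp: field_simps)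
  then show ?thesis by (simp add: mesh_left_def)
qed

lemma mesh_cell_exists:
  assumes "h > 0" "0 \<le> t" "t < real N * h"
  shows "\<exists>i<N. t \<in> {real i * h..<real (Suc i) * h}"
proof -
  define i where "i = nat \<lfloor>t / h\<rfloor>"
  have fl: "of_int \<lfloor>t / h\<rfloor> * h \<le> t" "t < (of_int \<lfloor>t / h\<rfloor> + 1) * h"
    using mesh_left_bounds[OF assms(1), of t] by (auto simp: mesh_left_def algebra_simps)
  have ri: "real i = of_int \<lfloor>t / h\<rfloor>" using assms by (simp add: i_def)
  have ti: "t \<in> {real i * h..<real (Suc i) * h}" using fl unfolding ri[symmetric] by (simp add: add.commute)
  have "real i * h < real N * h" using ti assms(3) by auto
  then have "i < N" using assms(1) by (simp only: mult_less_cancel_right_pos of_nat_less_iff)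
  then show ?thesis using ti by blast
qed

text \<open>The point \<open>t\<close> may lie anywhere in the shrinking interval: the first-order
  errors at both ends are small relative to their distances from \<open>t\<close>, and these
  distances sum to \<open>h n\<close>.\<close>

lemma straddling_slope_tendsto:
  fixes q :: "real \<Rightarrow> real"
  assumes D: "(q has_real_derivative D) (at t)"
    and h: "\<And>n. h n > 0" "h \<longlonglongrightarrow> 0" and l: "\<And>n. l n \<le> t" "\<And>n. t \<le> l n + h n"
  shows "(\<lambda>n. (q (l n + h n) - q (l n)) / h n) \<longlonglongrightarrow> D"
proof (rule LIMSEQ_I)
  fix r :: real assume "r > 0"
  have "\<forall>e>0. \<exists>\<delta>>0. \<forall>y. norm (y - t) < \<delta> \<longrightarrow> norm (q y - q t - D * (y - t)) \<le> e * norm (y - t)"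
    using D unfolding has_field_derivative_def has_derivative_at_alt by blast
  then obtain \<delta> where \<delta>: "\<delta> > 0" "\<And>y. \<bar>y - t\<bar> < \<delta> \<Longrightarrow> \<bar>q y - q t - D * (y - t)\<bar> \<le> r / 2 * \<bar>y - t\<bar>"
    using \<open>r > 0\<close> by (metis half_gt_zero real_norm_def)
  obtain n0 where n0: "\<And>n. n \<ge> n0 \<Longrightarrow> h n < \<delta>"
    using order_tendstoD(2)[OF h(2) \<delta>(1)] unfolding eventually_sequentially by blast
  have "norm ((q (l n + h n) - q (l n)) / h n - D) < r" if "n \<ge> n0" for n
  proof -
    have "\<bar>l n + h n - t\<bar> < \<delta>" "\<bar>l n - t\<bar> < \<delta>" using l[of n] n0[OF that] h(1)[of n] by auto
    from this[THEN \<delta>(2)]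
    have b: "\<bar>q (l n + h n) - q t - D * (l n + h n - t)\<bar> \<le> r / 2 * (l n + h n - t)"
      "\<bar>q (l n) - q t - D * (l n - t)\<bar> \<le> r / 2 * (t - l n)"
      using l[of n] by auto
    have "q (l n + h n) - q (l n) - D * h n
        = (q (l n + h n) - q t - D * (l n + h n - t)) - (q (l n) - q t - D * (l n - t))"
      by (simp add: algebra_simps)
    moreover have "r / 2 * (l n + h n - t) + r / 2 * (t - l n) = r / 2 * h n"
      unfolding distrib_left[symmetric] by simp
    ultimately have "\<bar>q (l n + h n) - q (l n) - D * h n\<bar> \<le> r / 2 * h n" using b by linarith
    moreover have "(q (l n + h n) - q (l n)) / h n - D = (q (l n + h n) - q (l n) - D * h n) / h n"
      using h(1)[of n] by (simp add: field_simps)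
    ultimately have "\<bar>(q (l n + h n) - q (l n)) / h n - D\<bar> \<le> r / 2"
      using h(1)[of n] by (simp add: abs_divide pos_divide_le_eq)
    then show ?thesis using \<open>r > 0\<close> by simp
  qed
  then show "\<exists>no. \<forall>n\<ge>no. norm ((q (l n + h n) - q (l n)) / h n - D) < r" by blast
qed

context oscillating_coeff
begin

text \<open>\<open>displacement_bound\<close> summed over disjoint intervals gives absolute
  continuity with a \<open>d\<close> independent of the index of \<open>u\<close>, and finite sums
  pass to the limit.\<close>

lemma bounded_energy_limit_AC:
  assumes u: "\<And>n. u n \<in> AC_curves T" and I: "\<And>n. (rate (\<epsilon> n) (u n) has_integral I n) {0..T}" "\<And>n. I n \<le> K"
    and lim: "\<And>t. t \<in> {0..T} \<Longrightarrow> (\<lambda>n. u n t) \<longlonglongrightarrow> q t"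
  shows "q \<in> AC_curves T"
  unfolding AC_curves_def
proof (rule CollectI, intro allI impI)
  fix e :: real assume "e > 0"
  \<comment> \<open>Chosen such that the energy part of the bound is \<open>e / 4\<close>; with the
    \<open>d\<close> below the length part is \<open>e / 4\<close> too, so the limit stays strictly
    below \<open>e\<close>.\<close>
  define \<kappa> where "\<kappa> = e / (4 * (\<bar>K\<bar> + 1))"
  have "\<kappa> > 0" using \<open>e > 0\<close> by (simp add: \<kappa>_def)
  define d where "d = e * (m * \<kappa>) / 2"
  show "\<exists>d>0. \<forall>(n::nat) a b. (\<forall>i<n. 0 \<le> a i \<and> a i \<le> b i \<and> b i \<le> T) \<and>
     disjoint_family_on (\<lambda>i. {a i<..<b i}) {..<n} \<and> (\<Sum>i<n. b i - a i) < d
     \<longrightarrow> (\<Sum>i<n. \<bar>q (b i) - q (a i)\<bar>) < e"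
  proof (intro exI[of _ d] conjI allI impI)
    show "d > 0" using \<open>e > 0\<close> \<open>\<kappa> > 0\<close> m_pos by (simp add: d_def)
    fix k :: nat and a b :: "nat \<Rightarrow> real"
    assume *: "(\<forall>i<k. 0 \<le> a i \<and> a i \<le> b i \<and> b i \<le> T) \<and>
      disjoint_family_on (\<lambda>i. {a i<..<b i}) {..<k} \<and> (\<Sum>i<k. b i - a i) < d"
    have bound: "(\<Sum>i<k. \<bar>u n (b i) - u n (a i)\<bar>) \<le> e / 2" for n
    proof -
      have int: "rate (\<epsilon> n) (u n) integrable_on {0..T}" using I(1) by blast
      have "\<bar>u n (b i) - u n (a i)\<bar> \<le> \<kappa> * integral {a i..b i} (rate (\<epsilon> n) (u n)) + (b i - a i) / (2 * m * \<kappa>)"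
        if "i < k" for i
      proof (rule periodic_coeff.displacement_bound[OF \<mu>_coeff u])
        show "(rate (\<epsilon> n) (u n) has_integral integral {a i..b i} (rate (\<epsilon> n) (u n))) {a i..b i}"
          using * that by (intro integrable_integral integrable_on_subinterval[OF int]) auto
        show "m / 2 * (deriv (u n) x)\<^sup>2 \<le> rate (\<epsilon> n) (u n) x" for x
          unfolding rate_def by (rule periodic_coeff.local_cost_ge_kinetic[OF \<mu>_coeff])
      qed (use * that \<open>\<kappa> > 0\<close> in auto)
      then have "(\<Sum>i<k. \<bar>u n (b i) - u n (a i)\<bar>)
        \<le> (\<Sum>i<k. \<kappa> * integral {a i..b i} (rate (\<epsilon> n) (u n)) + (b i - a i) / (2 * m * \<kappa>))"
        by (intro sum_mono) auto
      also have "\<dots> = \<kappa> * (\<Sum>i<k. integral {a i..b i} (rate (\<epsilon> n) (u n))) + (\<Sum>i<k. b i - a i) / (2 * m * \<kappa>)"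
        by (simp add: sum.distrib sum_distrib_left sum_divide_distrib)
      also have "\<dots> \<le> \<kappa> * (\<bar>K\<bar> + 1) + d / (2 * m * \<kappa>)"
      proof (intro add_mono mult_left_mono divide_right_mono)
        have "(\<Sum>i<k. integral {a i..b i} (rate (\<epsilon> n) (u n))) \<le> integral {0..T} (rate (\<epsilon> n) (u n))"
          by (rule sum_integral_disjoint_le[OF int rate_nonneg]) (use * in auto)
        also have "\<dots> \<le> \<bar>K\<bar> + 1" using I[of n] by (simp add: integral_unique)
        finally show "(\<Sum>i<k. integral {a i..b i} (rate (\<epsilon> n) (u n))) \<le> \<bar>K\<bar> + 1" .
      qed (use * \<open>\<kappa> > 0\<close> m_pos in auto)
      also have "\<dots> = e / 2"
      proof -
        have "\<kappa> * (\<bar>K\<bar> + 1) = e / 4" by (simp add: \<kappa>_def field_simps)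
        moreover have "d / (2 * m * \<kappa>) = e / 4" using \<open>\<kappa> > 0\<close> m_pos by (simp add: d_def)
        ultimately show ?thesis by linarith
      qed
      finally show ?thesis .
    qed
    have "(\<lambda>n. \<Sum>i<k. \<bar>u n (b i) - u n (a i)\<bar>) \<longlonglongrightarrow> (\<Sum>i<k. \<bar>q (b i) - q (a i)\<bar>)"
      using * by (intro tendsto_sum tendsto_rabs tendsto_diff lim) auto
    then have "(\<Sum>i<k. \<bar>q (b i) - q (a i)\<bar>) \<le> e / 2"
      by (rule LIMSEQ_le_const2) (use bound in blast)
    then show "(\<Sum>i<k. \<bar>q (b i) - q (a i)\<bar>) < e" using \<open>e > 0\<close> by simp
  qed
qed

text \<open>\<open>p\<close> ranges over a neighbourhood of the curve and not only over its values,
  so the same mesh also serves for the curves that approximate \<open>q\<close>.\<close>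

definition fine_mesh :: "(real \<Rightarrow> real) \<Rightarrow> real \<Rightarrow> nat \<Rightarrow> real \<Rightarrow> real \<Rightarrow> bool" where
  "fine_mesh q h N \<omega> \<eta> \<longleftrightarrow> (\<forall>i<N. \<forall>t\<in>{real i * h..real (Suc i) * h}. \<forall>p. \<bar>p - q t\<bar> < \<eta> \<longrightarrow>
     (\<forall>y. \<bar>\<mu> p y - \<mu> (q (real i * h)) y\<bar> \<le> \<omega>) \<and> \<bar>(\<Xi> p)\<^sup>2 - (\<Xi> (q (real i * h)))\<^sup>2\<bar> \<le> \<omega>)"

lemma fine_mesh_exists:
  assumes q: "continuous_on {0..T} q" and "T > 0" "\<omega> > 0"
  obtains N0 \<eta> where "N0 > 0" "\<eta> > 0" "\<And>N. N \<ge> N0 \<Longrightarrow> fine_mesh q (T / real N) N \<omega> \<eta>"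
    "\<And>N i t. N \<ge> N0 \<Longrightarrow> i < N \<Longrightarrow> t \<in> {real i * (T / real N)..real (Suc i) * (T / real N)} \<Longrightarrow>
      \<bar>q t - q (real i * (T / real N))\<bar> < min \<omega> \<eta>"
proof -
  have "compact (q ` {0..T})" using q by (intro compact_continuous_image) auto
  then obtain R where R: "\<And>t. t \<in> {0..T} \<Longrightarrow> \<bar>q t\<bar> \<le> R"
    using compact_imp_bounded bounded_iff by (metis image_eqI real_norm_def)
  obtain \<delta> where \<delta>: "\<delta> > 0" "\<And>p c. \<bar>p\<bar> \<le> R + 1 \<Longrightarrow> \<bar>c\<bar> \<le> R + 1 \<Longrightarrow> \<bar>p - c\<bar> < \<delta> \<Longrightarrow>
    (\<forall>y. \<bar>\<mu> p y - \<mu> c y\<bar> \<le> \<omega>) \<and> \<bar>(\<Xi> p)\<^sup>2 - (\<Xi> c)\<^sup>2\<bar> \<le> \<omega>"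
    using modulus[OF \<open>\<omega> > 0\<close>, of "R + 1"] by blast
  \<comment> \<open>One half of \<open>\<delta>\<close> for the oscillation of \<open>q\<close> in a
    cell, the other for the distance of \<open>p\<close> from the curve, which in addition stays
    below 1 so that \<open>p\<close> remains in the range where \<open>\<delta>\<close> is
    valid.\<close>
  define \<delta>' where "\<delta>' = min (min (\<delta> / 2) 1) \<omega>"
  have "\<delta>' > 0" using \<delta>(1) \<open>\<omega> > 0\<close> by (simp add: \<delta>'_def)
  have "uniformly_continuous_on {0..T} q" using q by (intro compact_uniformly_continuous) auto
  then obtain d where d: "d > 0" "\<And>s t. s \<in> {0..T} \<Longrightarrow> t \<in> {0..T} \<Longrightarrow> dist t s < d \<Longrightarrow> dist (q t) (q s) < \<delta>'"
    using \<open>\<delta>' > 0\<close> unfolding uniformly_continuous_on_def by metis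
  obtain N0 :: nat where N0: "T / d < real N0" using reals_Archimedean2 by blast
  have "N0 > 0" using N0 \<open>T > 0\<close> d(1) by (metis divide_pos_pos gr0I less_trans of_nat_0 order_less_irrefl)
  have close: "\<bar>q t - q (real i * (T / real N))\<bar> < \<delta>' \<and> t \<in> {0..T} \<and> real i * (T / real N) \<in> {0..T}"
    if "N \<ge> N0" "i < N" "t \<in> {real i * (T / real N)..real (Suc i) * (T / real N)}" for N i t
  proof -
    define h where "h = T / real N"
    have "real N > 0" using \<open>N0 > 0\<close> that(1) by simp
    then have h: "h > 0" "real N * h = T" using \<open>T > 0\<close> by (auto simp: h_def)
    have "T / d < real N" using N0 that(1) by linarith
    then have "h < d" using d(1) \<open>real N > 0\<close> by (simp add: h_def field_simps)
    have "real (Suc i) * h \<le> real N * h" using that(2) h by (intro mult_right_mono) auto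
    then have "real (Suc i) * h \<le> T" using h by simp
    moreover have "0 \<le> real i * h" using h by simp
    moreover have t: "real i * h \<le> t" "t \<le> real i * h + h"
      using that(3) unfolding h_def[symmetric] by (auto simp: distrib_right)
    ultimately have "t \<in> {0..T}" "real i * h \<in> {0..T}" using that(3) by (auto simp: h_def)
    moreover from this have "dist (q t) (q (real i * h)) < \<delta>'"
      using t \<open>h < d\<close> by (intro d(2)) (auto simp: dist_real_def)
    ultimately show ?thesis by (simp add: h_def dist_real_def)
  qed
  show thesis
  proof (rule that[of N0 "min (\<delta> / 2) 1"])
    fix N assume "N \<ge> N0"
    show "fine_mesh q (T / real N) N \<omega> (min (\<delta> / 2) 1)" unfolding fine_mesh_def
    proof (intro allI impI ballI)
      fix i t p assume i: "i < N" "t \<in> {real i * (T / real N)..real (Suc i) * (T / real N)}" "\<bar>p - q t\<bar> < min (\<delta> / 2) 1"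
      note c = close[OF \<open>N \<ge> N0\<close> i(1,2)]
      have "\<bar>p - q (real i * (T / real N))\<bar> < \<delta>" using c i(3) unfolding \<delta>'_def by linarith
      moreover have "\<bar>p\<bar> \<le> R + 1" using R[of t] c i(3) by auto
      moreover have "\<bar>q (real i * (T / real N))\<bar> \<le> R + 1" using R[of "real i * (T / real N)"] c by simp
      ultimately show "(\<forall>y. \<bar>\<mu> p y - \<mu> (q (real i * (T / real N))) y\<bar> \<le> \<omega>) \<and>
        \<bar>(\<Xi> p)\<^sup>2 - (\<Xi> (q (real i * (T / real N))))\<^sup>2\<bar> \<le> \<omega>" by (intro \<delta>(2))
    qed
  next
    fix N i t assume "N \<ge> N0" "i < N" "t \<in> {real i * (T / real N)..real (Suc i) * (T / real N)}"
    from close[OF this] show "\<bar>q t - q (real i * (T / real N))\<bar> < min \<omega> (min (\<delta> / 2) 1)"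
      by (simp add: \<delta>'_def)
  qed (use \<open>N0 > 0\<close> \<delta>(1) in auto)
qed

text \<open>The multipliers are fixed cell by cell before \<open>n\<close> tends to infinity. The
  limit then concerns finitely many nodal values, the errors of order \<open>\<epsilon> n\<close>
  vanish, and the supremum over multipliers is taken afterwards.\<close>

lemma mesh_sum_lower_bound:
  fixes h T :: real and N :: nat
  assumes u: "\<And>n. u n \<in> AC_curves T" and I: "\<And>n. (rate (\<epsilon> n) (u n) has_integral I n) {0..T}" "\<And>n. I n \<le> K"
    and \<epsilon>: "\<And>n. \<epsilon> n > 0" "\<epsilon> \<longlonglongrightarrow> 0"
    and unif: "\<And>e. e > 0 \<Longrightarrow> \<forall>\<^sub>F n in sequentially. \<forall>t\<in>{0..T}. \<bar>u n t - q t\<bar> < e"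
    and h: "h > 0" "real N * h = T" and mesh: "fine_mesh q h N \<omega> \<eta>" and "\<eta> > 0" "\<omega> \<ge> 0"
  shows "(\<Sum>i<N. h * eff_density (\<mu> (q (real i * h))) ((q (real (Suc i) * h) - q (real i * h)) / h) (\<Xi> (q (real i * h))))
    \<le> (1 + \<omega> / m) * K + \<omega> / (2 * m) * T"
proof -
  define c where "c i = q (real i * h)" for i :: nat
  define \<Delta> where "\<Delta> i = q (real (Suc i) * h) - q (real i * h)" for i :: nat
  define \<theta> where "\<theta> = 1 + \<omega> / m"
  define C where "C = \<omega> / (2 * m)"
  have "T \<ge> 0" using h by (metis less_imp_le mult_nonneg_nonneg of_nat_0_le_iff)
  have "\<theta> > 0" using m_pos \<open>\<omega> \<ge> 0\<close> by (simp add: \<theta>_def add_pos_nonneg)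
  have cell: "0 \<le> real i * h" "real i * h \<le> real (Suc i) * h" "real (Suc i) * h \<le> T" if "i < N" for i
  proof -
    have "real (Suc i) * h \<le> real N * h" using that h by (intro mult_right_mono) auto
    then show "real (Suc i) * h \<le> T" using h by simp
  qed (use h in \<open>auto simp: algebra_simps\<close>)
  have main: "(\<Sum>i<N. \<nu> i * h + \<bar>\<Delta> i\<bar> * mean_momentum (\<mu> (c i)) (\<Xi> (c i)) (\<nu> i)) \<le> \<theta> * K + C * T"
    if \<nu>: "\<And>i. i < N \<Longrightarrow> \<nu> i \<in> admissible (\<mu> (c i)) (\<Xi> (c i))" for \<nu>
  proof -
    define B where "B i = sqrt ((\<Xi> (c i))\<^sup>2 + 2 * \<bar>\<nu> i\<bar> * M)" for i
    define mm where "mm i = mean_momentum (\<mu> (c i)) (\<Xi> (c i)) (\<nu> i)" for i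
    define S where "S n = (\<Sum>i<N. \<nu> i * h + \<bar>u n (real (Suc i) * h) - u n (real i * h)\<bar> * mm i - 2 * \<epsilon> n * B i)" for n
    have "S n \<le> \<theta> * K + C * T" if close: "\<forall>t\<in>{0..T}. \<bar>u n t - q t\<bar> < \<eta>" for n
    proof -
      have int: "rate (\<epsilon> n) (u n) integrable_on {0..T}" using I(1) by blast
      have "\<nu> i * h + \<bar>u n (real (Suc i) * h) - u n (real i * h)\<bar> * mm i - 2 * \<epsilon> n * B i
          \<le> \<theta> * integral {real i * h..real (Suc i) * h} (rate (\<epsilon> n) (u n)) + C * h" if "i < N" for i
      proof -
        have "\<nu> i * (real (Suc i) * h - real i * h) + \<bar>u n (real (Suc i) * h) - u n (real i * h)\<bar> * mm i - 2 * \<epsilon> n * B i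
          \<le> \<theta> * integral {real i * h..real (Suc i) * h} (rate (\<epsilon> n) (u n)) + C * h"
          unfolding mm_def B_def
        proof (rule periodic_coeff.cell_lower_bound[OF \<mu>_coeff u cell[OF \<open>i < N\<close>] \<epsilon>(1) \<nu>[OF \<open>i < N\<close>]])
          have "(rate (\<epsilon> n) (u n) has_integral integral {real i * h..real (Suc i) * h} (rate (\<epsilon> n) (u n)))
              {real i * h..real (Suc i) * h}"
            using cell[OF \<open>i < N\<close>] by (intro integrable_integral integrable_on_subinterval[OF int]) auto
          from has_integral_add[OF has_integral_mult_right[OF this, of \<theta>]
              has_integral_const_real[of C "real i * h" "real (Suc i) * h"]]
          show "((\<lambda>t. \<theta> * rate (\<epsilon> n) (u n) t + C) has_integral
              \<theta> * integral {real i * h..real (Suc i) * h} (rate (\<epsilon> n) (u n)) + C * h) {real i * h..real (Suc i) * h}"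
            using h by (simp add: algebra_simps)
          fix t assume t: "t \<in> {real i * h..real (Suc i) * h}"
          then have "t \<in> {0..T}" using cell[OF \<open>i < N\<close>] by auto
          then have "\<bar>u n t - q t\<bar> < \<eta>" using close by blast
          with mesh t \<open>i < N\<close> have
            "(\<forall>y. \<bar>\<mu> (u n t) y - \<mu> (c i) y\<bar> \<le> \<omega>) \<and> \<bar>(\<Xi> (u n t))\<^sup>2 - (\<Xi> (c i))\<^sup>2\<bar> \<le> \<omega>"
            unfolding fine_mesh_def c_def by blast
          then show "local_cost (\<mu> (c i)) (\<Xi> (c i)) (u n t / \<epsilon> n) (deriv (u n) t) \<le> \<theta> * rate (\<epsilon> n) (u n) t + C"
            unfolding rate_def \<theta>_def C_def
            by (intro local_cost_compare[OF \<mu>_coeff \<mu>_coeff]) (auto simp: abs_minus_commute)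
        qed
        then show ?thesis by (simp add: algebra_simps)
      qed
      then have "S n \<le> (\<Sum>i<N. \<theta> * integral {real i * h..real (Suc i) * h} (rate (\<epsilon> n) (u n)) + C * h)"
        unfolding S_def by (intro sum_mono) auto
      also have "\<dots> = \<theta> * (\<Sum>i<N. integral {real i * h..real (Suc i) * h} (rate (\<epsilon> n) (u n))) + C * (real N * h)"
        by (simp add: sum.distrib sum_distrib_left)
      also have "\<dots> = \<theta> * I n + C * T"
        using integral_uniform_partition[of "rate (\<epsilon> n) (u n)" N h] int h I(1)[of n] by (simp add: integral_unique)
      also have "\<dots> \<le> \<theta> * K + C * T" using I(2)[of n] \<open>\<theta> > 0\<close> by simp
      finally show ?thesis .
    qed
    then have "\<forall>\<^sub>F n in sequentially. S n \<le> \<theta> * K + C * T"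
      using unif[OF \<open>\<eta> > 0\<close>] by (rule eventually_mono[rotated])
    moreover have lim: "(\<lambda>n. u n t) \<longlonglongrightarrow> q t" if "t \<in> {0..T}" for t
    proof (rule tendstoI)
      fix e :: real assume "e > 0"
      show "\<forall>\<^sub>F n in sequentially. dist (u n t) (q t) < e"
        using unif[OF \<open>e > 0\<close>] by (rule eventually_mono) (use that in \<open>auto simp: dist_real_def\<close>)
    qed
    have "S \<longlonglongrightarrow> (\<Sum>i<N. \<nu> i * h + \<bar>q (real (Suc i) * h) - q (real i * h)\<bar> * mm i - 2 * 0 * B i)"
      unfolding S_def using cell by (intro tendsto_intros lim \<epsilon>(2)) (auto intro: order_trans)
    ultimately have "(\<Sum>i<N. \<nu> i * h + \<bar>q (real (Suc i) * h) - q (real i * h)\<bar> * mm i - 2 * 0 * B i) \<le> \<theta> * K + C * T"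
      by (intro tendsto_upperbound[of S _ sequentially]) auto
    then show ?thesis by (simp add: mm_def \<Delta>_def)
  qed
  \<comment> \<open>Multipliers that are optimal up to \<open>e\<close> in each cell; the
    accumulated loss is \<open>T * e\<close>.\<close>
  have *: "(\<Sum>i<N. h * eff_density (\<mu> (c i)) (\<Delta> i / h) (\<Xi> (c i))) \<le> \<theta> * K + C * T + T * e" if "e > 0" for e
  proof -
    have "\<exists>\<nu>\<in>admissible (\<mu> (c i)) (\<Xi> (c i)). eff_density (\<mu> (c i)) (\<Delta> i / h) (\<Xi> (c i)) - e
        < \<nu> + \<bar>\<Delta> i / h\<bar> * mean_momentum (\<mu> (c i)) (\<Xi> (c i)) \<nu>" for i
      by (rule periodic_coeff.eff_approx[OF \<mu>_coeff]) (use that in simp)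
    then obtain \<nu> where \<nu>: "\<And>i. \<nu> i \<in> admissible (\<mu> (c i)) (\<Xi> (c i))"
      "\<And>i. eff_density (\<mu> (c i)) (\<Delta> i / h) (\<Xi> (c i)) - e
        < \<nu> i + \<bar>\<Delta> i / h\<bar> * mean_momentum (\<mu> (c i)) (\<Xi> (c i)) (\<nu> i)"
      by metis
    have "h * eff_density (\<mu> (c i)) (\<Delta> i / h) (\<Xi> (c i))
        \<le> \<nu> i * h + \<bar>\<Delta> i\<bar> * mean_momentum (\<mu> (c i)) (\<Xi> (c i)) (\<nu> i) + h * e" for i
    proof -
      have "h * eff_density (\<mu> (c i)) (\<Delta> i / h) (\<Xi> (c i))
        \<le> h * (\<nu> i + \<bar>\<Delta> i / h\<bar> * mean_momentum (\<mu> (c i)) (\<Xi> (c i)) (\<nu> i) + e)"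
        using \<nu>(2)[of i] h by (intro mult_left_mono) auto
      also have "\<dots> = \<nu> i * h + \<bar>\<Delta> i\<bar> * mean_momentum (\<mu> (c i)) (\<Xi> (c i)) (\<nu> i) + h * e"
        using h by (simp add: abs_divide field_simps)
      finally show ?thesis .
    qed
    then have "(\<Sum>i<N. h * eff_density (\<mu> (c i)) (\<Delta> i / h) (\<Xi> (c i)))
      \<le> (\<Sum>i<N. \<nu> i * h + \<bar>\<Delta> i\<bar> * mean_momentum (\<mu> (c i)) (\<Xi> (c i)) (\<nu> i) + h * e)"
      by (rule sum_mono)
    also have "\<dots> = (\<Sum>i<N. \<nu> i * h + \<bar>\<Delta> i\<bar> * mean_momentum (\<mu> (c i)) (\<Xi> (c i)) (\<nu> i)) + real N * h * e"
      by (simp add: sum.distrib)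
    also have "\<dots> \<le> \<theta> * K + C * T + T * e" using main[OF \<nu>(1)] h by simp
    finally show ?thesis .
  qed
  have "(\<Sum>i<N. h * eff_density (\<mu> (c i)) (\<Delta> i / h) (\<Xi> (c i))) \<le> \<theta> * K + C * T"
  proof (rule field_le_epsilon)
    fix e :: real assume "e > 0"
    have "T * (e / (T + 1)) \<le> e" using \<open>T \<ge> 0\<close> \<open>e > 0\<close> by (simp add: field_simps)
    then show "(\<Sum>i<N. h * eff_density (\<mu> (c i)) (\<Delta> i / h) (\<Xi> (c i))) \<le> \<theta> * K + C * T + e"
      using *[of "e / (T + 1)"] \<open>T \<ge> 0\<close> \<open>e > 0\<close> by simp
  qed
  then show ?thesis by (simp add: c_def \<Delta>_def \<theta>_def C_def)
qed

end

lemma AE_lebesgue_on_negligible: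
  assumes "negligible N" "\<And>t. t \<in> S - N \<Longrightarrow> P t" "S \<in> sets lebesgue"
  shows "AE t in lebesgue_on S. P t"
proof -
  have "AE t in lebesgue. t \<notin> N"
    using assms(1) by (intro AE_not_in) (simp add: negligible_iff_null_sets)
  then have "AE t in lebesgue. t \<in> S \<longrightarrow> P t" by (rule AE_mp) (use assms(2) in auto)
  then show ?thesis using assms(3) by (simp add: AE_restrict_space_iff)
qed

context oscillating_coeff
begin

text \<open>Undoes the freezing at the limit curve: the sum with frozen coefficients bounds the
  integral with moving ones for the piecewise constant speed \<open>v\<close>.\<close>

lemma mesh_integral_bound:
  assumes q: "q \<in> AC_curves T" and h: "h > 0" "real N * h = T" and mesh: "fine_mesh q h N \<omega> \<eta>" "\<eta> > 0" "\<omega> \<ge> 0"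
    and sum: "(\<Sum>i<N. h * eff_density (\<mu> (q (real i * h))) ((q (real (Suc i) * h) - q (real i * h)) / h) (\<Xi> (q (real i * h)))) \<le> X"
    and v: "\<And>i t. i < N \<Longrightarrow> t \<in> {real i * h..<real (Suc i) * h} \<Longrightarrow> v t = (q (real (Suc i) * h) - q (real i * h)) / h"
  shows "(\<integral>\<^sup>+t. ennreal (eff_density (\<mu> (q t)) (v t) (\<Xi> (q t))) \<partial>lebesgue_on {0..T})
    \<le> ennreal ((1 + \<omega> / m) * X + \<omega> / (2 * m) * T)"
proof -
  define e where "e i = eff_density (\<mu> (q (real i * h))) ((q (real (Suc i) * h) - q (real i * h)) / h) (\<Xi> (q (real i * h)))" for i
  define \<theta> where "\<theta> = 1 + \<omega> / m"
  define C where "C = \<omega> / (2 * m)"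
  have pos: "\<theta> > 0" "C \<ge> 0" using m_pos \<open>\<omega> \<ge> 0\<close> by (auto simp: \<theta>_def C_def add_pos_nonneg)
  have e: "0 \<le> e i" for i unfolding e_def by (rule periodic_coeff.eff_nonneg[OF \<mu>_coeff])
  have cell: "{real i * h..<real (Suc i) * h} \<subseteq> {0..T}" if "i < N" for i
  proof -
    have "real (Suc i) * h \<le> real N * h" using that h by (intro mult_right_mono) auto
    moreover have "0 \<le> real i * h" using h by simp
    ultimately show ?thesis unfolding h(2) by (intro subsetI) (auto simp del: of_nat_Suc)
  qed
  have "AE t in lebesgue_on {0..T}. ennreal (eff_density (\<mu> (q t)) (v t) (\<Xi> (q t)))
    \<le> (\<Sum>i<N. ennreal (\<theta> * e i + C) * indicator {real i * h..<real (Suc i) * h} t)"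
  \<comment> \<open>The cells are half-open, so \<open>T\<close> itself belongs to none.\<close>
  proof (rule AE_lebesgue_on_negligible[of "{T}"])
    fix t assume t: "t \<in> {0..T} - {T}"
    then obtain i where "i < N" and ti: "t \<in> {real i * h..<real (Suc i) * h}"
      using mesh_cell_exists[OF h(1), of t N] h(2) by auto
    have "eff_density (\<mu> (q t)) (v t) (\<Xi> (q t)) \<le> \<theta> * e i + C"
      unfolding v[OF \<open>i < N\<close> ti] e_def \<theta>_def C_def
    proof (rule eff_density_compare[OF \<mu>_coeff \<mu>_coeff])
      have "t \<in> {real i * h..real (Suc i) * h}" "\<bar>q t - q t\<bar> < \<eta>" using ti \<open>\<eta> > 0\<close> by auto
      then have *: "(\<forall>y. \<bar>\<mu> (q t) y - \<mu> (q (real i * h)) y\<bar> \<le> \<omega>) \<and> \<bar>(\<Xi> (q t))\<^sup>2 - (\<Xi> (q (real i * h)))\<^sup>2\<bar> \<le> \<omega>"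
        using mesh(1) \<open>i < N\<close> unfolding fine_mesh_def by blast
      then show "\<bar>\<mu> (q t) y - \<mu> (q (real i * h)) y\<bar> \<le> \<omega>" for y by blast
      show "\<bar>(\<Xi> (q t))\<^sup>2 - (\<Xi> (q (real i * h)))\<^sup>2\<bar> \<le> \<omega>" using * by blast
    qed
    then have "ennreal (eff_density (\<mu> (q t)) (v t) (\<Xi> (q t))) \<le> ennreal (\<theta> * e i + C) * indicator {real i * h..<real (Suc i) * h} t"
      using ti by (simp add: ennreal_leI)
    also have "\<dots> \<le> (\<Sum>i<N. ennreal (\<theta> * e i + C) * indicator {real i * h..<real (Suc i) * h} t)"
      using \<open>i < N\<close> by (intro member_le_sum) auto
    finally show "ennreal (eff_density (\<mu> (q t)) (v t) (\<Xi> (q t)))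
      \<le> (\<Sum>i<N. ennreal (\<theta> * e i + C) * indicator {real i * h..<real (Suc i) * h} t)" .
  qed auto
  then have "(\<integral>\<^sup>+t. ennreal (eff_density (\<mu> (q t)) (v t) (\<Xi> (q t))) \<partial>lebesgue_on {0..T})
    \<le> (\<integral>\<^sup>+t. (\<Sum>i<N. ennreal (\<theta> * e i + C) * indicator {real i * h..<real (Suc i) * h} t) \<partial>lebesgue_on {0..T})"
    by (rule nn_integral_mono_AE)
  also have "\<dots> = (\<Sum>i<N. \<integral>\<^sup>+t. ennreal (\<theta> * e i + C) * indicator {real i * h..<real (Suc i) * h} t \<partial>lebesgue_on {0..T})"
    by (rule nn_integral_sum) (intro borel_measurable_times_ennreal borel_measurable_const borel_measurable_indicator,
      use cell in \<open>auto simp: sets_restrict_space_iff\<close>)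
  also have "\<dots> = (\<Sum>i<N. ennreal ((\<theta> * e i + C) * h))"
  proof (rule sum.cong[OF refl])
    fix i assume "i \<in> {..<N}"
    then have c: "{real i * h..<real (Suc i) * h} \<subseteq> {0..T}" using cell by blast
    then have s: "{real i * h..<real (Suc i) * h} \<in> sets (lebesgue_on {0..T})" by (auto simp: sets_restrict_space_iff)
    have "emeasure (lebesgue_on {0..T}) {real i * h..<real (Suc i) * h} = ennreal h"
      using c h by (subst emeasure_restrict_space) (auto simp: algebra_simps)
    then show "(\<integral>\<^sup>+t. ennreal (\<theta> * e i + C) * indicator {real i * h..<real (Suc i) * h} t \<partial>lebesgue_on {0..T})
        = ennreal ((\<theta> * e i + C) * h)"
      using s pos e[of i] h by (simp add: nn_integral_cmult_indicator ennreal_mult)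
  qed
  also have "\<dots> = ennreal (\<Sum>i<N. (\<theta> * e i + C) * h)"
    using pos e h by (intro sum_ennreal) auto
  also have "(\<Sum>i<N. (\<theta> * e i + C) * h) = \<theta> * (\<Sum>i<N. h * e i) + C * (real N * h)"
    by (simp add: algebra_simps sum.distrib sum_distrib_left)
  also have "ennreal (\<theta> * (\<Sum>i<N. h * e i) + C * (real N * h)) \<le> ennreal (\<theta> * X + C * T)"
    using sum pos h by (intro ennreal_leI add_mono mult_left_mono) (auto simp: e_def)
  finally show ?thesis by (simp add: \<theta>_def C_def)
qed

text \<open>Three limits in this order: the index \<open>n\<close> at a fixed mesh, then the mesh
  width through Fatou's lemma, then the freezing error \<open>\<omega>\<close>.\<close>

theorem liminf_inequality:
  assumes u: "\<And>n. u n \<in> AC_curves T" and I: "\<And>n. (rate (\<epsilon> n) (u n) has_integral I n) {0..T}" "\<And>n. I n \<le> K"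
    and \<epsilon>: "\<And>n. \<epsilon> n > 0" "\<epsilon> \<longlonglongrightarrow> 0"
    and unif: "\<And>e. e > 0 \<Longrightarrow> \<forall>\<^sub>F n in sequentially. \<forall>t\<in>{0..T}. \<bar>u n t - q t\<bar> < e"
    and "T > 0"
  shows "q \<in> AC_curves T" "(\<integral>\<^sup>+t. ennreal (eff_rate q t) \<partial>lebesgue_on {0..T}) \<le> ennreal K"
proof -
  have lim: "(\<lambda>n. u n t) \<longlonglongrightarrow> q t" if "t \<in> {0..T}" for t
  proof (rule tendstoI)
    fix e :: real assume "e > 0"
    show "\<forall>\<^sub>F n in sequentially. dist (u n t) (q t) < e"
      using unif[OF \<open>e > 0\<close>] by (rule eventually_mono) (use that in \<open>auto simp: dist_real_def\<close>)
  qed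
  show q: "q \<in> AC_curves T" by (rule bounded_energy_limit_AC[OF u I lim])
  have contq: "continuous_on {0..T} q" by (rule AC_curves_continuous[OF q])
  define J where "J = (\<integral>\<^sup>+t. ennreal (eff_rate q t) \<partial>lebesgue_on {0..T})"
  \<comment> \<open>The freezing error enters twice, once for the curves \<open>u n\<close> and once
    for the limit curve.\<close>
  define X where "X \<omega> = (1 + \<omega> / m) * ((1 + \<omega> / m) * K + \<omega> / (2 * m) * T) + \<omega> / (2 * m) * T" for \<omega>
  have J: "J \<le> ennreal (X \<omega>)" if "\<omega> > 0" for \<omega>
  proof -
    obtain N0 \<eta> where N0: "N0 > 0" "\<eta> > 0" "\<And>N. N \<ge> N0 \<Longrightarrow> fine_mesh q (T / real N) N \<omega> \<eta>"
      using fine_mesh_exists[OF contq \<open>T > 0\<close> \<open>\<omega> > 0\<close>] by metis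
    define h where "h n = T / real (N0 + n)" for n
    have h: "h n > 0" "real (N0 + n) * h n = T" for n using N0(1) \<open>T > 0\<close> by (auto simp: h_def)
    have "h \<longlonglongrightarrow> 0"
      unfolding h_def[abs_def] using LIMSEQ_ignore_initial_segment[OF lim_const_over_n[of T], of N0]
      by (simp add: add.commute)
    \<comment> \<open>The extension of \<open>q\<close> by constants makes the difference quotients
      measurable on the whole line.\<close>
    define p where "p t = q (max 0 (min T t))" for t
    have pq: "p t = q t" if "t \<in> {0..T}" for t using that by (simp add: p_def)
    have "continuous_on UNIV p" unfolding p_def
      using \<open>T > 0\<close> by (intro continuous_on_compose2[OF contq] continuous_intros) auto
    then have p: "p \<in> borel_measurable borel" by (rule borel_measurable_continuous_onI)
    define s where "s n t = (p (mesh_left (h n) t + h n) - p (mesh_left (h n) t)) / h n" for n t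
    have "s n \<in> borel_measurable borel" for n
    proof -
      have "mesh_left (h n) \<in> borel_measurable borel" unfolding mesh_left_def[abs_def] by measurable
      then show ?thesis unfolding s_def[abs_def] using p by measurable
    qed
    then have s: "s n \<in> borel_measurable (lebesgue_on {0..T})" for n
      by (intro measurable_restrict_space1 measurable_completion) simp
    define \<psi> where "\<psi> n t = eff_density (\<mu> (q t)) (s n t) (\<Xi> (q t))" for n t
    have \<psi>: "\<psi> n \<in> borel_measurable (lebesgue_on {0..T})" for n
      unfolding \<psi>_def[abs_def] by (intro eff_measurable AC_curves_measurable[OF q] s)
    have bound: "(\<integral>\<^sup>+t. ennreal (\<psi> n t) \<partial>lebesgue_on {0..T}) \<le> ennreal (X \<omega>)" for n
      unfolding \<psi>_def X_def
    proof (rule mesh_integral_bound[OF q h(1,2)])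
      show mesh: "fine_mesh q (h n) (N0 + n) \<omega> \<eta>" unfolding h_def by (rule N0(3)) simp
      show "(\<Sum>i<N0 + n. h n * eff_density (\<mu> (q (real i * h n))) ((q (real (Suc i) * h n) - q (real i * h n)) / h n) (\<Xi> (q (real i * h n))))
        \<le> (1 + \<omega> / m) * K + \<omega> / (2 * m) * T"
        by (rule mesh_sum_lower_bound[OF u I \<epsilon> unif h mesh N0(2)]) (use that in auto)
      fix i t assume i: "i < N0 + n" "t \<in> {real i * h n..<real (Suc i) * h n}"
      have ml: "mesh_left (h n) t = real i * h n" using i h(1) by (intro mesh_left_eq) auto
      have "real (Suc i) * h n \<le> real (N0 + n) * h n" using i h(1)[of n] by (intro mult_right_mono) auto
      then have "real (Suc i) * h n \<in> {0..T}" "real i * h n \<in> {0..T}"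
        using h(1)[of n] h(2)[of n] by (auto simp: algebra_simps)
      moreover have "real i * h n + h n = real (Suc i) * h n" by (simp add: algebra_simps)
      ultimately show "s n t = (q (real (Suc i) * h n) - q (real i * h n)) / h n"
        by (simp add: s_def ml pq)
    qed (use N0 that in auto)
    have "AE t in lebesgue_on {0..T}. ennreal (eff_rate q t) \<le> liminf (\<lambda>n. ennreal (\<psi> n t))"
    proof (rule AE_lebesgue_on_negligible[of "{t\<in>{0..T}. \<not> q differentiable (at t)} \<union> {0, T}"])
      show "negligible ({t\<in>{0..T}. \<not> q differentiable (at t)} \<union> {0, T})"
        by (intro negligible_Un AC_curves_differentiable_ae[OF q]) auto
      fix t assume t: "t \<in> {0..T} - ({t\<in>{0..T}. \<not> q differentiable (at t)} \<union> {0, T})"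
      then have D: "(q has_real_derivative deriv q t) (at t)"
        by (auto simp: DERIV_deriv_iff_real_differentiable)
      have "(p has_real_derivative deriv q t) (at t)"
        by (rule has_field_derivative_transform_within_open[OF D, of "{0<..<T}"]) (use t pq in auto)
      then have "(\<lambda>n. s n t) \<longlonglongrightarrow> deriv q t"
        unfolding s_def by (rule straddling_slope_tendsto)
          (intro h(1) \<open>h \<longlonglongrightarrow> 0\<close> mesh_left_bounds less_imp_le)+
      moreover have "isCont (\<lambda>v. eff_density (\<mu> (q t)) v (\<Xi> (q t))) (deriv q t)"
        using periodic_coeff.eff_continuous[OF \<mu>_coeff] continuous_on_eq_continuous_at by blast
      ultimately have "(\<lambda>n. \<psi> n t) \<longlonglongrightarrow> eff_rate q t"
        unfolding \<psi>_def eff_rate_def by (rule isCont_tendsto_compose[rotated])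
      then have "(\<lambda>n. ennreal (\<psi> n t)) \<longlonglongrightarrow> ennreal (eff_rate q t)" by (rule tendsto_ennrealI)
      then show "ennreal (eff_rate q t) \<le> liminf (\<lambda>n. ennreal (\<psi> n t))"
        by (simp add: lim_imp_Liminf)
    qed auto
    then have "J \<le> (\<integral>\<^sup>+t. liminf (\<lambda>n. ennreal (\<psi> n t)) \<partial>lebesgue_on {0..T})"
      unfolding J_def by (rule nn_integral_mono_AE)
    also have "\<dots> \<le> liminf (\<lambda>n. \<integral>\<^sup>+t. ennreal (\<psi> n t) \<partial>lebesgue_on {0..T})"
      using \<psi> by (intro nn_integral_liminf) auto
    also have "\<dots> \<le> liminf (\<lambda>n. ennreal (X \<omega>))"
      using bound by (intro Liminf_mono) auto
    also have "\<dots> = ennreal (X \<omega>)" by (simp add: Liminf_const)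
    finally show ?thesis .
  qed
  have "((\<lambda>\<omega>. ennreal (X \<omega>)) \<longlongrightarrow> ennreal ((1 + 0 / m) * ((1 + 0 / m) * K + 0 / (2 * m) * T) + 0 / (2 * m) * T)) (at_right 0)"
    unfolding X_def using m_pos by (intro tendsto_ennrealI tendsto_intros) auto
  then have "((\<lambda>\<omega>. ennreal (X \<omega>)) \<longlongrightarrow> ennreal K) (at_right 0)" by simp
  then show "(\<integral>\<^sup>+t. ennreal (eff_rate q t) \<partial>lebesgue_on {0..T}) \<le> ennreal K"
    unfolding J_def[symmetric]
    by (rule tendsto_lowerbound) (use J in \<open>auto simp: eventually_at_filter\<close>)
qed

end

section \<open>Recovery in a frozen cell\<close>

text \<open>The autonomous equation for \<open>u\<close> is solved by inverting the arrival time
  \<open>s\<close>, an antiderivative of the slowness \<open>\<tau>\<close>. The bound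
  \<open>\<tau>0\<close> makes \<open>s\<close> onto, so the solution is global.\<close>

lemma time_change_curve:
  fixes \<tau> :: "real \<Rightarrow> real"
  assumes \<tau>: "continuous_on UNIV \<tau>" "\<And>p. \<tau>0 \<le> \<tau> p" "\<tau>0 > 0"
  obtains u s where "\<And>p. (s has_real_derivative \<tau> p) (at p)" "s p0 = 0"
    "\<And>t. (u has_real_derivative 1 / \<tau> (u t)) (at t)" "\<And>p. u (s p) = p"
    "\<And>x y. x \<le> y \<Longrightarrow> u x \<le> u y"
proof -
  obtain S where S: "\<And>x. (S has_real_derivative \<tau> x) (at x)" "S 0 = 0"
    "\<And>x y. x \<le> y \<Longrightarrow> (\<tau> has_integral S y - S x) {x..y}"
    using continuous_antiderivative[OF \<tau>(1)] by blast
  define s where "s p = S p - S p0" for p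
  have ds: "(s has_real_derivative \<tau> p) (at p)" for p
    unfolding s_def using S(1)[of p] by (auto intro!: derivative_eq_intros)
  have inc: "\<tau>0 * (y - x) \<le> s y - s x" if "x \<le> y" for x y
    using has_integral_le[OF has_integral_const_real[of \<tau>0 x y] S(3)[OF that]] \<tau>(2) that
    by (simp add: s_def mult.commute)
  have surj: "\<exists>p. s p = t" for t
  proof -
    have c: "continuous_on A s" for A
      using ds by (meson DERIV_isCont continuous_at_imp_continuous_on)
    define a where "a = \<bar>t\<bar> / \<tau>0"
    have "a \<ge> 0" "\<tau>0 * a = \<bar>t\<bar>" using \<tau>(3) by (auto simp: a_def)
    moreover have "s p0 = 0" by (simp add: s_def)
    ultimately have "s (p0 - a) \<le> t" "t \<le> s (p0 + a)" "p0 - a \<le> p0 + a"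
      using inc[of "p0 - a" p0] inc[of p0 "p0 + a"] by auto
    then show ?thesis using IVT'[of s "p0 - a" t "p0 + a"] c by blast
  qed
  then obtain u where u: "\<And>t. s (u t) = t" by metis
  have abs: "\<tau>0 * \<bar>y - x\<bar> \<le> \<bar>s y - s x\<bar>" for x y
    using inc[of x y] inc[of y x] by (cases "x \<le> y") (auto simp: abs_if)
  have us: "u (s p) = p" for p
    using abs[of "u (s p)" p] u[of "s p"] \<tau>(3) by (simp add: mult_le_0_iff)
  have lip: "\<tau>0 * \<bar>u y - u x\<bar> \<le> \<bar>y - x\<bar>" for x y
    using abs[of "u y" "u x"] by (simp add: u abs_minus_commute)
  have cu: "isCont u t" for t
    unfolding continuous_at_eps_delta
  proof (intro allI impI)
    fix e :: real assume "e > 0"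
    have "dist (u x) (u t) < e" if "dist x t < \<tau>0 * e" for x
    proof -
      have "\<tau>0 * \<bar>u x - u t\<bar> < \<tau>0 * e" using lip[of x t] that by (simp add: dist_real_def)
      then show ?thesis using \<tau>(3) by (simp add: dist_real_def)
    qed
    then show "\<exists>d>0. \<forall>x. dist x t < d \<longrightarrow> dist (u x) (u t) < e"
      using \<tau>(3) \<open>e > 0\<close> by (intro exI[of _ "\<tau>0 * e"]) auto
  qed
  have du: "(u has_real_derivative 1 / \<tau> (u t)) (at t)" for t
    using DERIV_inverse_function[where f = s and g = u and x = t and D = "\<tau> (u t)" and a = "t - 1" and b = "t + 1"] ds[of "u t"] cu[of t] u
      \<tau>(2)[of "u t"] \<tau>(3) by (simp add: inverse_eq_divide)
  have mono: "u x \<le> u y" if "x \<le> y" for x y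
  proof (rule ccontr)
    assume "\<not> u x \<le> u y"
    then have "\<tau>0 * (u x - u y) \<le> x - y" "u x - u y > 0" using inc[of "u y" "u x"] by (auto simp: u)
    then show False using \<tau>(3) that by (smt (verit) mult_pos_pos)
  qed
  show thesis by (rule that[of s u, OF ds _ du us mono]) (simp_all add: s_def)
qed

context periodic_coeff
begin

lemma momentum_pos_below:
  assumes max: "\<And>y. a y \<le> a y0" and "\<nu> < \<xi>\<^sup>2 / (2 * a y0)"
  shows "2 * \<nu> * a y < \<xi>\<^sup>2"
proof (cases "\<nu> < 0")
  case True
  then have "2 * \<nu> * a y < 0" using a_pos[of y] by (simp add: mult_neg_pos)
  also have "0 \<le> \<xi>\<^sup>2" by simp
  finally show ?thesis .
next
  case False
  then have "2 * \<nu> * a y \<le> 2 * \<nu> * a y0" using max[of y] by (intro mult_left_mono) auto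
  also have "\<dots> < \<xi>\<^sup>2" using assms(2) a_pos[of y0] by (simp add: field_simps)
  finally show ?thesis .
qed

text \<open>The multiplier \<open>\<nu>\<close> is chosen such that the transit time is the prescribed one. If even
  the largest multiplier is too fast, the remaining time is spent near a maximum of \<open>a\<close>.\<close>

lemma multiplier_exists:
  fixes \<xi> :: real
  assumes max: "\<And>y. a y \<le> a y0" and "\<epsilon> > 0" "p0 < p1" "h > 0" "\<kappa> > 0"
  defines "d \<equiv> p1 - p0" and "\<nu>s \<equiv> \<xi>\<^sup>2 / (2 * a y0)"
  defines "\<Theta> \<equiv> \<lambda>\<nu>. integral {p0..p1} (\<lambda>p. a (p / \<epsilon>) / momentum a \<xi> \<nu> (p / \<epsilon>))"
  obtains \<nu> where "\<And>y. 2 * \<nu> * a y < \<xi>\<^sup>2" "\<Theta> \<nu> \<le> h" "(h - \<Theta> \<nu>) * (\<nu>s - \<nu>) \<le> h * \<kappa>"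
    "\<bar>\<nu>\<bar> \<le> M * d\<^sup>2 / (2 * h\<^sup>2) + \<xi>\<^sup>2 / (2 * m)"
proof -
  have "d > 0" using \<open>p0 < p1\<close> by (simp add: d_def)
  \<comment> \<open>For this multiplier the momentum is at least \<open>d / h\<close> times the
    coefficient, so the speed is at least \<open>d / h\<close> everywhere and the transit takes at
    most \<open>h\<close>.\<close>
  define \<nu>0 where "\<nu>0 = - (M * d\<^sup>2 / (2 * h\<^sup>2))"
  \<comment> \<open>Strictly below \<open>\<nu>s\<close>, where the transit time may diverge, but
    within \<open>\<kappa>\<close> of it; the maximum keeps the interval from \<open>\<nu>0\<close>
    to \<open>\<nu>1\<close> nonempty.\<close>
  define \<nu>1 where "\<nu>1 = max \<nu>0 (\<nu>s - \<kappa>)"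
  have "\<nu>0 < 0" using M_pos \<open>d > 0\<close> \<open>h > 0\<close> by (simp add: \<nu>0_def)
  have "\<nu>s \<ge> 0" using a_pos[of y0] by (simp add: \<nu>s_def)
  have "\<nu>s \<le> \<xi>\<^sup>2 / (2 * m)" unfolding \<nu>s_def using a_ge[of y0] m_pos by (intro divide_left_mono) auto
  have "\<nu>1 < \<nu>s" "\<nu>0 \<le> \<nu>1" "\<nu>s - \<nu>1 \<le> \<kappa>" using \<open>\<nu>0 < 0\<close> \<open>\<nu>s \<ge> 0\<close> \<open>\<kappa> > 0\<close> by (auto simp: \<nu>1_def)
  have pos: "2 * \<nu> * a y < \<xi>\<^sup>2" if "\<nu> \<le> \<nu>1" for \<nu> y
  proof (rule momentum_pos_below[OF max])
    show "\<nu> < \<xi>\<^sup>2 / (2 * a y0)" using that \<open>\<nu>1 < \<nu>s\<close> by (simp add: \<nu>s_def)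
  qed
  have nz: "\<xi>\<^sup>2 \<noteq> 2 * \<nu> * a y" if "\<nu> \<le> \<nu>1" for \<nu> y using pos[OF that, of y] by simp
  have bd: "\<bar>\<nu>\<bar> \<le> M * d\<^sup>2 / (2 * h\<^sup>2) + \<xi>\<^sup>2 / (2 * m)" if "\<nu>0 \<le> \<nu>" "\<nu> \<le> \<nu>1" for \<nu>
  proof -
    have "0 \<le> M * d\<^sup>2 / (2 * h\<^sup>2)" "0 \<le> \<xi>\<^sup>2 / (2 * m)" using M_pos m_pos by auto
    then show ?thesis using that \<open>\<nu>1 < \<nu>s\<close> \<open>\<nu>s \<le> \<xi>\<^sup>2 / (2 * m)\<close> unfolding \<nu>0_def by linarith
  qed
  have cont: "continuous_on ({\<nu>0..\<nu>1} \<times> cbox p0 p1) (\<lambda>(\<nu>, p). a (p / \<epsilon>) / momentum a \<xi> \<nu> (p / \<epsilon>))"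
    unfolding case_prod_unfold momentum_def
  proof (intro continuous_intros continuous_on_compose2[OF cont_a] ballI)
    fix x :: "real \<times> real" assume "x \<in> {\<nu>0..\<nu>1} \<times> cbox p0 p1"
    then show "sqrt (\<xi>\<^sup>2 - 2 * fst x * a (snd x / \<epsilon>)) \<noteq> 0" using pos[of "fst x" "snd x / \<epsilon>"] by auto
  qed (use \<open>\<epsilon> > 0\<close> in auto)
  have cT: "continuous_on {\<nu>0..\<nu>1} \<Theta>"
    unfolding \<Theta>_def using integral_continuous_on_param[OF cont] by simp
  have "\<Theta> \<nu>0 \<le> h"
  proof -
    have "(\<lambda>p. a (p / \<epsilon>) / momentum a \<xi> \<nu>0 (p / \<epsilon>)) integrable_on {p0..p1}"
      using nz[OF \<open>\<nu>0 \<le> \<nu>1\<close>] \<open>\<epsilon> > 0\<close> unfolding momentum_def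
      by (intro integrable_continuous_interval continuous_intros continuous_on_compose2[OF cont_a]) auto
    moreover have "a (p / \<epsilon>) / momentum a \<xi> \<nu>0 (p / \<epsilon>) \<le> h / d" for p
    proof -
      define b where "b = a (p / \<epsilon>)"
      have b: "0 < b" "b \<le> M" using a_pos a_le by (auto simp: b_def)
      have "b * d / h \<le> momentum a \<xi> \<nu>0 (p / \<epsilon>)" unfolding momentum_def
      proof (rule real_le_rsqrt)
        have "(b * d / h)\<^sup>2 = b * b * (d\<^sup>2 / h\<^sup>2)" by (simp add: power2_eq_square)
        also have "\<dots> \<le> M * b * (d\<^sup>2 / h\<^sup>2)" using b by (intro mult_right_mono) auto
        also have "\<dots> = - (2 * \<nu>0 * a (p / \<epsilon>))" by (simp add: \<nu>0_def b_def)
        also have "\<dots> \<le> \<xi>\<^sup>2 - 2 * \<nu>0 * a (p / \<epsilon>)" by simp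
        finally show "(b * d / h)\<^sup>2 \<le> \<xi>\<^sup>2 - 2 * \<nu>0 * a (p / \<epsilon>)" .
      qed
      moreover have "0 < b * d / h" using b \<open>d > 0\<close> \<open>h > 0\<close> by simp
      ultimately have "b / momentum a \<xi> \<nu>0 (p / \<epsilon>) \<le> b / (b * d / h)"
        using b by (intro divide_left_mono mult_pos_pos) auto
      then show ?thesis using b by (simp add: b_def)
    qed
    ultimately have "\<Theta> \<nu>0 \<le> h / d * (p1 - p0)"
      unfolding \<Theta>_def using has_integral_le[OF integrable_integral has_integral_const_real[of "h / d" p0 p1]] \<open>p0 < p1\<close>
      by (simp add: mult.commute)
    then show ?thesis using \<open>d > 0\<close> by (simp add: d_def)
  qed
  show thesis
  proof (cases "h \<le> \<Theta> \<nu>1")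
    case True
    then obtain \<nu> where \<nu>: "\<nu>0 \<le> \<nu>" "\<nu> \<le> \<nu>1" "\<Theta> \<nu> = h"
      using IVT'[of \<Theta> \<nu>0 h \<nu>1] \<open>\<Theta> \<nu>0 \<le> h\<close> \<open>\<nu>0 \<le> \<nu>1\<close> cT by auto
    show thesis by (rule that[of \<nu>, OF pos[OF \<nu>(2)] _ _ bd[OF \<nu>(1,2)]]) (use \<nu> \<open>h > 0\<close> \<open>\<kappa> > 0\<close> in auto)
  next
    case False
    have "0 \<le> \<Theta> \<nu>1" unfolding \<Theta>_def
    proof (rule Henstock_Kurzweil_Integration.integral_nonneg)
      show "(\<lambda>p. a (p / \<epsilon>) / momentum a \<xi> \<nu>1 (p / \<epsilon>)) integrable_on {p0..p1}"
        using nz[OF order_refl] \<open>\<epsilon> > 0\<close> unfolding momentum_def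
        by (intro integrable_continuous_interval continuous_intros continuous_on_compose2[OF cont_a]) auto
      show "0 \<le> a (p / \<epsilon>) / momentum a \<xi> \<nu>1 (p / \<epsilon>)" for p
        using pos[OF order_refl, of "p / \<epsilon>"] a_pos[of "p / \<epsilon>"] by (simp add: momentum_def)
    qed
    then have "(h - \<Theta> \<nu>1) * (\<nu>s - \<nu>1) \<le> h * \<kappa>"
      using False \<open>\<nu>1 < \<nu>s\<close> \<open>\<nu>s - \<nu>1 \<le> \<kappa>\<close> \<open>h > 0\<close> by (intro mult_mono) auto
    then show thesis using that[of \<nu>1, OF pos[OF order_refl] _ _ bd[OF \<open>\<nu>0 \<le> \<nu>1\<close> order_refl]] False by simp
  qed
qed

text \<open>A density in position over which the waiting time is distributed. It lives where the
  resting cost \<open>\<xi>\<^sup>2 / (2 * a (p / \<epsilon>))\<close> is within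
  \<open>\<kappa>\<close> of its minimum; such points exist because the cell contains a full
  period.\<close>

lemma waiting_bump:
  assumes max: "\<And>y. a y \<le> a y0" and "\<epsilon> > 0" "\<epsilon> \<le> p1 - p0" "\<kappa> > 0"
  obtains \<rho> where "continuous_on UNIV \<rho>" "\<And>p. 0 \<le> \<rho> p" "integral {p0..p1} \<rho> = 1"
    "\<And>p. \<rho> p * (\<xi>\<^sup>2 / (2 * a (p / \<epsilon>))) \<le> \<rho> p * (\<xi>\<^sup>2 / (2 * a y0) + \<kappa>)"
proof -
  define \<rho>0 where "\<rho>0 p = max 0 (\<xi>\<^sup>2 / (2 * a y0) + \<kappa> - \<xi>\<^sup>2 / (2 * a (p / \<epsilon>)))" for p
  have c: "continuous_on S \<rho>0" for S
    unfolding \<rho>0_def using a_pos \<open>\<epsilon> > 0\<close>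
    by (intro continuous_intros continuous_on_compose2[OF cont_a]) (auto simp: less_imp_neq[THEN not_sym])
  \<comment> \<open>\<open>ps\<close> is the first point at or after \<open>p0\<close> whose fast
    variable agrees with \<open>y0\<close> modulo 1.\<close>
  define z where "z = frac (y0 - p0 / \<epsilon>)"
  define ps where "ps = p0 + \<epsilon> * z"
  have "0 \<le> z" "z \<le> 1" using frac_lt_1[of "y0 - p0 / \<epsilon>"] by (auto simp: z_def)
  then have ps: "ps \<in> {p0..p1}"
  proof -
    have "\<epsilon> * z \<le> \<epsilon> * 1" "0 \<le> \<epsilon> * z"
      using \<open>0 \<le> z\<close> \<open>z \<le> 1\<close> \<open>\<epsilon> > 0\<close> by (intro mult_left_mono mult_nonneg_nonneg; simp)+
    then have "p0 \<le> ps" "ps \<le> p1" using \<open>\<epsilon> \<le> p1 - p0\<close> unfolding ps_def by linarith+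
    then show ?thesis by simp
  qed
  have "a (ps / \<epsilon>) = a (frac (ps / \<epsilon>))" by (simp add: per_frac)
  also have "frac (ps / \<epsilon>) = frac y0"
  proof -
    have "ps / \<epsilon> = y0 + of_int (- \<lfloor>y0 - p0 / \<epsilon>\<rfloor>)"
      using \<open>\<epsilon> > 0\<close> by (simp add: ps_def z_def frac_def add_divide_distrib)
    then show ?thesis by (simp add: frac_def)
  qed
  also have "a (frac y0) = a y0" by (rule per_frac)
  finally have "\<rho>0 ps = \<kappa>" using \<open>\<kappa> > 0\<close> by (simp add: \<rho>0_def)
  moreover have "p0 < p1" using \<open>\<epsilon> > 0\<close> \<open>\<epsilon> \<le> p1 - p0\<close> by simp
  then have "integral {p0..p1} \<rho>0 = 0 \<longleftrightarrow> (\<forall>p\<in>{p0..p1}. \<rho>0 p = 0)"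
    by (intro integral_eq_0_iff c) (auto simp: \<rho>0_def)
  moreover have "0 \<le> integral {p0..p1} \<rho>0"
    by (rule Henstock_Kurzweil_Integration.integral_nonneg[OF integrable_continuous_interval[OF c]]) (simp add: \<rho>0_def)
  ultimately have P: "integral {p0..p1} \<rho>0 > 0" using ps \<open>\<kappa> > 0\<close> by (metis less_le)
  show thesis
  proof (rule that[of "\<lambda>p. \<rho>0 p / integral {p0..p1} \<rho>0"])
    show "continuous_on UNIV (\<lambda>p. \<rho>0 p / integral {p0..p1} \<rho>0)" using P by (intro continuous_intros c) auto
    show "0 \<le> \<rho>0 p / integral {p0..p1} \<rho>0" for p using P by (simp add: \<rho>0_def)
    show "integral {p0..p1} (\<lambda>p. \<rho>0 p / integral {p0..p1} \<rho>0) = 1" using P by simp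
    have "\<rho>0 p * (\<xi>\<^sup>2 / (2 * a (p / \<epsilon>))) \<le> \<rho>0 p * (\<xi>\<^sup>2 / (2 * a y0) + \<kappa>)" for p
    proof (cases "\<xi>\<^sup>2 / (2 * a (p / \<epsilon>)) \<le> \<xi>\<^sup>2 / (2 * a y0) + \<kappa>")
      case True
      then show ?thesis by (rule mult_left_mono) (simp add: \<rho>0_def)
    next
      case False
      then have "\<rho>0 p = 0" by (simp add: \<rho>0_def)
      then show ?thesis by simp
    qed
    then show "\<rho>0 p / integral {p0..p1} \<rho>0 * (\<xi>\<^sup>2 / (2 * a (p / \<epsilon>)))
      \<le> \<rho>0 p / integral {p0..p1} \<rho>0 * (\<xi>\<^sup>2 / (2 * a y0) + \<kappa>)" for p
      using P by (simp only: times_divide_eq_left divide_right_mono less_imp_le)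
  qed
qed

text \<open>The curve is prescribed by its slowness: the one for which Young's inequality is an
  equality, plus the waiting time spread by \<open>\<rho>\<close>. One \<open>\<kappa> * h\<close>
  pays for the gap between \<open>\<nu>\<close> and the largest multiplier during the wait, the
  other for waiting near instead of at the maximum.\<close>

lemma forward_cell_recovery:
  assumes "\<epsilon> > 0" "\<epsilon> \<le> p1 - p0" "h > 0" "\<kappa> > 0"
  defines "d \<equiv> p1 - p0"
  obtains u w Q where "u 0 = p0" "u h = p1" "\<And>s. (u has_real_derivative w s) (at s)" "continuous_on UNIV w"
    "\<And>s. s \<in> {0..h} \<Longrightarrow> u s \<in> {p0..p1}"
    "\<And>s. (Q has_real_derivative local_cost a \<xi> (u s / \<epsilon>) (w s)) (at s)"
    "Q h - Q 0 \<le> h * eff_density a (d / h) \<xi>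
      + 2 * \<epsilon> * sqrt (\<xi>\<^sup>2 + 2 * (M * d\<^sup>2 / (2 * h\<^sup>2) + \<xi>\<^sup>2 / (2 * m)) * M) + 2 * \<kappa> * h"
proof -
  obtain y0 where max: "\<And>y. a y \<le> a y0" using max_a by blast
  have "p0 < p1" using \<open>\<epsilon> > 0\<close> \<open>\<epsilon> \<le> p1 - p0\<close> by simp
  define \<nu>s where "\<nu>s = \<xi>\<^sup>2 / (2 * a y0)"
  obtain \<nu> where \<nu>: "\<And>y. 2 * \<nu> * a y < \<xi>\<^sup>2"
    "integral {p0..p1} (\<lambda>p. a (p / \<epsilon>) / momentum a \<xi> \<nu> (p / \<epsilon>)) \<le> h"
    "(h - integral {p0..p1} (\<lambda>p. a (p / \<epsilon>) / momentum a \<xi> \<nu> (p / \<epsilon>))) * (\<nu>s - \<nu>) \<le> h * \<kappa>"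
    "\<bar>\<nu>\<bar> \<le> M * d\<^sup>2 / (2 * h\<^sup>2) + \<xi>\<^sup>2 / (2 * m)"
    using multiplier_exists[OF max \<open>\<epsilon> > 0\<close> \<open>p0 < p1\<close> \<open>h > 0\<close> \<open>\<kappa> > 0\<close>, of \<xi>] unfolding d_def \<nu>s_def by blast
  have adm: "\<nu> \<in> admissible a \<xi>" using \<nu>(1) by (auto simp: admissible_def less_imp_le)
  define b where "b p = a (p / \<epsilon>)" for p
  define g where "g p = momentum a \<xi> \<nu> (p / \<epsilon>)" for p
  have b: "0 < b p" "m \<le> b p" for p using a_pos a_ge by (auto simp: b_def)
  have g: "0 < g p" for p using \<nu>(1)[of "p / \<epsilon>"] by (simp add: g_def momentum_def)
  have g2: "(g p)\<^sup>2 = \<xi>\<^sup>2 - 2 * \<nu> * b p" for p using momentum_sq[OF adm] by (simp add: g_def b_def)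
  have cb: "continuous_on S b" for S
    unfolding b_def using \<open>\<epsilon> > 0\<close> by (intro continuous_on_compose2[OF cont_a] continuous_intros) auto
  have cg: "continuous_on S g" for S
    unfolding g_def using \<open>\<epsilon> > 0\<close> by (intro continuous_on_compose2[OF cont_momentum[of UNIV]] continuous_intros) auto
  define \<Theta> where "\<Theta> = integral {p0..p1} (\<lambda>p. b p / g p)"
  define wt where "wt = h - \<Theta>"
  have wt: "wt \<ge> 0" "wt * (\<nu>s - \<nu>) \<le> h * \<kappa>" using \<nu>(2,3) by (auto simp: wt_def \<Theta>_def b_def g_def)
  have cbg: "continuous_on S (\<lambda>p. b p / g p)" for S
    using g by (intro continuous_on_divide cb cg) (auto simp: less_imp_neq[THEN not_sym])
  have "0 \<le> \<Theta>" unfolding \<Theta>_def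
    by (rule Henstock_Kurzweil_Integration.integral_nonneg[OF integrable_continuous_interval[OF cbg]])
      (use b g in \<open>auto simp: less_imp_le\<close>)
  obtain \<rho> where \<rho>: "continuous_on UNIV \<rho>" "\<And>p. 0 \<le> \<rho> p" "integral {p0..p1} \<rho> = 1"
    "\<And>p. \<rho> p * (\<xi>\<^sup>2 / (2 * b p)) \<le> \<rho> p * (\<nu>s + \<kappa>)"
    using waiting_bump[OF max \<open>\<epsilon> > 0\<close> \<open>\<epsilon> \<le> p1 - p0\<close> \<open>\<kappa> > 0\<close>, of \<xi>] unfolding b_def \<nu>s_def by blast
  define \<tau> where "\<tau> p = b p / g p + wt * \<rho> p" for p
  have c\<rho>: "continuous_on S \<rho>" for S by (rule continuous_on_subset[OF \<rho>(1)]) simp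
  have c\<tau>: "continuous_on S \<tau>" for S
    unfolding \<tau>_def by (intro continuous_on_add cbg continuous_on_mult c\<rho> continuous_on_const)
  define B where "B = sqrt (\<xi>\<^sup>2 + 2 * \<bar>\<nu>\<bar> * M)"
  have gB: "g p \<le> B" for p unfolding g_def B_def by (rule momentum_le)
  have "B > 0" using gB[of 0] g[of 0] by linarith
  have bg: "m / B \<le> b p / g p" for p using b[of p] g[of p] gB[of p] m_pos by (intro frac_le) auto
  have \<tau>ge: "b p / g p \<le> \<tau> p" for p using wt(1) \<rho>(2)[of p] by (simp add: \<tau>_def)
  have \<tau>: "m / B \<le> \<tau> p" for p using bg[of p] \<tau>ge[of p] by linarith
  have "m / B > 0" using m_pos \<open>B > 0\<close> by simp
  obtain u s where us: "\<And>p. (s has_real_derivative \<tau> p) (at p)" "s p0 = 0"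
    "\<And>t. (u has_real_derivative 1 / \<tau> (u t)) (at t)" "\<And>p. u (s p) = p"
    "\<And>x y. x \<le> y \<Longrightarrow> u x \<le> u y"
    using time_change_curve[OF c\<tau> \<tau> \<open>m / B > 0\<close>, of p0] by metis
  have \<tau>int: "(\<tau> has_integral \<Theta> + wt * 1) {p0..p1}"
    unfolding \<tau>_def \<Theta>_def \<rho>(3)[symmetric]
    by (intro has_integral_add has_integral_mult_right integrable_integral integrable_continuous_interval cbg c\<rho>)
  have "(\<tau> has_integral s p1 - s p0) {p0..p1}"
    using us(1) \<open>p0 < p1\<close> by (intro fundamental_theorem_of_calculus)
      (auto simp: has_real_derivative_iff_has_vector_derivative[symmetric] intro: has_field_derivative_at_within)
  then have "s p1 = h" using has_integral_unique[OF \<tau>int] us(2) by (simp add: wt_def)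
  then have u0: "u 0 = p0" "u h = p1" using us(4)[of p0] us(4)[of p1] us(2) by auto
  have cu: "continuous_on UNIV u" using us(3) DERIV_isCont continuous_at_imp_continuous_on by blast
  have \<tau>pos: "\<tau> p > 0" for p using \<tau>[of p] \<open>m / B > 0\<close> by linarith
  define w where "w t = 1 / \<tau> (u t)" for t
  have cw: "continuous_on UNIV w" unfolding w_def
    using \<tau>pos by (intro continuous_on_divide continuous_on_compose2[OF c\<tau>[of UNIV] cu] continuous_on_const)
      (auto simp: less_imp_neq[THEN not_sym])
  \<comment> \<open>Cost per unit of distance at speed \<open>1 / \<tau> p\<close>. Integrating it
    in position yields the accumulated cost as a function of \<open>u\<close>.\<close>
  define k where "k p = b p / (2 * \<tau> p) + \<xi>\<^sup>2 / (2 * b p) * \<tau> p" for p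
  have ck: "continuous_on S k" for S unfolding k_def
    using \<tau>pos b(1) by (intro continuous_on_add continuous_on_divide continuous_on_mult cb c\<tau> continuous_on_const)
      (auto simp: less_imp_neq[THEN not_sym])
  obtain K where K: "\<And>x. (K has_real_derivative k x) (at x)" "K 0 = 0"
    "\<And>x y. x \<le> y \<Longrightarrow> (k has_integral K y - K x) {x..y}"
    using continuous_antiderivative[OF ck[of UNIV]] by blast
  have Q: "((\<lambda>t. K (u t)) has_real_derivative local_cost a \<xi> (u t / \<epsilon>) (w t)) (at t)" for t
  proof -
    have "k (u t) * (1 / \<tau> (u t)) = local_cost a \<xi> (u t / \<epsilon>) (w t)"
      using \<tau>pos[of "u t"] by (simp add: k_def local_cost_def w_def b_def field_simps power2_eq_square)
    then show ?thesis using DERIV_chain2[OF K(1) us(3)[of t]] by simp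
  qed
  obtain \<Phi> where \<Phi>: "\<And>p. (\<Phi> has_real_derivative momentum a \<xi> \<nu> (p / \<epsilon>)) (at p)"
    "\<And>p p'. \<bar>(\<Phi> p' - \<Phi> p) - mean_momentum a \<xi> \<nu> * (p' - p)\<bar> \<le> 2 * \<epsilon> * sqrt (\<xi>\<^sup>2 + 2 * \<bar>\<nu>\<bar> * M)"
    using oscillating_momentum_antiderivative[OF adm \<open>\<epsilon> > 0\<close>] by blast
  have gint: "(g has_integral \<Phi> p1 - \<Phi> p0) {p0..p1}"
    using \<Phi>(1) \<open>p0 < p1\<close> unfolding g_def by (intro fundamental_theorem_of_calculus)
      (auto simp: has_real_derivative_iff_has_vector_derivative[symmetric] intro: has_field_derivative_at_within)
  \<comment> \<open>Waiting lowers the kinetic part and adds resting cost only where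
    \<open>\<rho>\<close> is positive.\<close>
  have kle: "k p \<le> \<nu> * (b p / g p) + g p + wt * (\<nu>s + \<kappa>) * \<rho> p" for p
  proof -
    have "b p / (2 * \<tau> p) \<le> b p / (2 * (b p / g p))"
      using \<tau>ge[of p] b(1)[of p] g[of p] \<tau>pos[of p] by (intro divide_left_mono) auto
    also have "\<dots> = g p / 2" using b(1)[of p] by simp
    finally have 1: "b p / (2 * \<tau> p) \<le> g p / 2" .
    have "\<xi>\<^sup>2 / (2 * b p) * \<tau> p = \<xi>\<^sup>2 / (2 * g p) + wt * (\<rho> p * (\<xi>\<^sup>2 / (2 * b p)))"
      using b(1)[of p] g[of p] by (simp add: \<tau>_def field_simps)
    also have "\<dots> \<le> \<xi>\<^sup>2 / (2 * g p) + wt * (\<rho> p * (\<nu>s + \<kappa>))"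
      by (rule add_left_mono[OF mult_left_mono[OF \<rho>(4) wt(1)]])
    finally have 2: "\<xi>\<^sup>2 / (2 * b p) * \<tau> p \<le> \<xi>\<^sup>2 / (2 * g p) + wt * (\<rho> p * (\<nu>s + \<kappa>))" .
    have "\<xi>\<^sup>2 / (2 * g p) = \<nu> * (b p / g p) + g p / 2"
    proof -
      have "\<xi>\<^sup>2 = g p * g p + 2 * \<nu> * b p" using g2[of p] by (simp add: power2_eq_square)
      then show ?thesis using g[of p] by (simp add: field_simps)
    qed
    then show ?thesis using 1 2 by (simp add: k_def algebra_simps)
  qed
  have "K p1 - K p0 \<le> \<nu> * \<Theta> + (\<Phi> p1 - \<Phi> p0) + wt * (\<nu>s + \<kappa>) * 1"
  proof (rule has_integral_le[OF K(3)])
    show "((\<lambda>p. \<nu> * (b p / g p) + g p + wt * (\<nu>s + \<kappa>) * \<rho> p) has_integral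
      \<nu> * \<Theta> + (\<Phi> p1 - \<Phi> p0) + wt * (\<nu>s + \<kappa>) * 1) {p0..p1}"
      unfolding \<Theta>_def \<rho>(3)[symmetric]
      by (intro has_integral_add has_integral_mult_right gint integrable_integral integrable_continuous_interval cbg c\<rho>)
  qed (use kle \<open>p0 < p1\<close> in auto)
  \<comment> \<open>Writing \<open>\<Theta> = h - wt\<close> collects \<open>\<nu> * h\<close> and
    leaves the excess \<open>wt * (\<nu>s - \<nu>)\<close>, which the choice of the multiplier keeps
    below \<open>h * \<kappa>\<close>.\<close>
  also have "\<dots> = \<nu> * h + wt * (\<nu>s - \<nu>) + wt * \<kappa> + (\<Phi> p1 - \<Phi> p0)"
    by (simp add: wt_def algebra_simps)
  also have "\<dots> \<le> \<nu> * h + h * \<kappa> + h * \<kappa> + (mean_momentum a \<xi> \<nu> * d + 2 * \<epsilon> * B)"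
  proof -
    have "wt * \<kappa> \<le> h * \<kappa>" using \<open>0 \<le> \<Theta>\<close> \<open>\<kappa> > 0\<close> by (simp add: wt_def)
    moreover have "\<Phi> p1 - \<Phi> p0 \<le> mean_momentum a \<xi> \<nu> * d + 2 * \<epsilon> * B"
      using \<Phi>(2)[where p = p0 and p' = p1] unfolding d_def B_def by linarith
    ultimately show ?thesis using wt(2) by linarith
  qed
  also have "\<dots> = h * (\<nu> + \<bar>d / h\<bar> * mean_momentum a \<xi> \<nu>) + 2 * \<epsilon> * B + 2 * \<kappa> * h"
  proof -
    have "\<bar>d / h\<bar> = d / h" using \<open>h > 0\<close> \<open>p0 < p1\<close> by (simp add: d_def)
    then show ?thesis using \<open>h > 0\<close> by (simp add: distrib_left mult.commute)
  qed
  \<comment> \<open>\<open>\<nu>\<close> depends on \<open>\<epsilon>\<close>; its a priori bound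
    makes the error explicit, so that it vanishes with \<open>\<epsilon>\<close>.\<close>
  also have "\<dots> \<le> h * eff_density a (d / h) \<xi>
      + 2 * \<epsilon> * sqrt (\<xi>\<^sup>2 + 2 * (M * d\<^sup>2 / (2 * h\<^sup>2) + \<xi>\<^sup>2 / (2 * m)) * M) + 2 * \<kappa> * h"
  proof (intro add_right_mono add_mono mult_left_mono eff_upper[OF adm])
    show "B \<le> sqrt (\<xi>\<^sup>2 + 2 * (M * d\<^sup>2 / (2 * h\<^sup>2) + \<xi>\<^sup>2 / (2 * m)) * M)"
      unfolding B_def using \<nu>(4) M_pos
      by (intro real_sqrt_le_mono add_left_mono mult_right_mono mult_left_mono) auto
  qed (use \<open>h > 0\<close> \<open>\<epsilon> > 0\<close> in auto)
  finally have "K (u h) - K (u 0) \<le> h * eff_density a (d / h) \<xi>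
      + 2 * \<epsilon> * sqrt (\<xi>\<^sup>2 + 2 * (M * d\<^sup>2 / (2 * h\<^sup>2) + \<xi>\<^sup>2 / (2 * m)) * M) + 2 * \<kappa> * h"
    by (simp add: u0)
  moreover have "u s \<in> {p0..p1}" if "s \<in> {0..h}" for s
    using us(5)[of 0 s] us(5)[of s h] that u0 by auto
  ultimately show thesis
    using that[of u w "\<lambda>t. K (u t)"] u0 us(3) cw Q unfolding w_def by blast
qed

text \<open>Backward motion is forward motion run in reverse time; the cost is even in the
  speed.\<close>

lemma cell_recovery:
  assumes "\<epsilon> > 0" "\<epsilon> \<le> \<bar>p1 - p0\<bar>" "h > 0" "\<kappa> > 0"
  defines "d \<equiv> \<bar>p1 - p0\<bar>"
  shows "\<exists>u w Q. u 0 = p0 \<and> u h = p1 \<and> (\<forall>s. (u has_real_derivative w s) (at s)) \<and> continuous_on UNIV w \<and>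
    (\<forall>s\<in>{0..h}. \<bar>u s - p0\<bar> \<le> d) \<and>
    (\<forall>s. (Q has_real_derivative local_cost a \<xi> (u s / \<epsilon>) (w s)) (at s)) \<and>
    Q h - Q 0 \<le> h * eff_density a (d / h) \<xi>
      + 2 * \<epsilon> * sqrt (\<xi>\<^sup>2 + 2 * (M * d\<^sup>2 / (2 * h\<^sup>2) + \<xi>\<^sup>2 / (2 * m)) * M) + 2 * \<kappa> * h"
proof (cases "p0 \<le> p1")
  case True
  then have d: "d = p1 - p0" and "\<epsilon> \<le> p1 - p0" using assms by auto
  then show ?thesis
  proof -
    obtain u w Q where u: "u 0 = p0" "u h = p1" "\<And>s. (u has_real_derivative w s) (at s)" "continuous_on UNIV w"
      "\<And>s. s \<in> {0..h} \<Longrightarrow> u s \<in> {p0..p1}"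
      "\<And>s. (Q has_real_derivative local_cost a \<xi> (u s / \<epsilon>) (w s)) (at s)"
      "Q h - Q 0 \<le> h * eff_density a (d / h) \<xi>
        + 2 * \<epsilon> * sqrt (\<xi>\<^sup>2 + 2 * (M * d\<^sup>2 / (2 * h\<^sup>2) + \<xi>\<^sup>2 / (2 * m)) * M) + 2 * \<kappa> * h"
      using forward_cell_recovery[OF \<open>\<epsilon> > 0\<close> \<open>\<epsilon> \<le> p1 - p0\<close> \<open>h > 0\<close> \<open>\<kappa> > 0\<close>, of \<xi>] unfolding d by metis
    have "\<forall>s\<in>{0..h}. \<bar>u s - p0\<bar> \<le> d" using u(5) d by fastforce
    with u show ?thesis by blast
  qed
next
  case False
  then have d: "d = p0 - p1" and le: "\<epsilon> \<le> p0 - p1" using assms by auto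
  obtain u w Q where u: "u 0 = p1" "u h = p0" "\<And>s. (u has_real_derivative w s) (at s)" "continuous_on UNIV w"
    "\<And>s. s \<in> {0..h} \<Longrightarrow> u s \<in> {p1..p0}"
    "\<And>s. (Q has_real_derivative local_cost a \<xi> (u s / \<epsilon>) (w s)) (at s)"
    "Q h - Q 0 \<le> h * eff_density a (d / h) \<xi>
      + 2 * \<epsilon> * sqrt (\<xi>\<^sup>2 + 2 * (M * d\<^sup>2 / (2 * h\<^sup>2) + \<xi>\<^sup>2 / (2 * m)) * M) + 2 * \<kappa> * h"
    using forward_cell_recovery[OF \<open>\<epsilon> > 0\<close> le \<open>h > 0\<close> \<open>\<kappa> > 0\<close>, of \<xi>] unfolding d by metis
  have du: "((\<lambda>s. u (h - s)) has_real_derivative - w (h - s)) (at s)" for s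
  proof -
    have "((\<lambda>s. u (h - s)) has_real_derivative w (h - s) * (- 1)) (at s)"
      by (rule DERIV_chain2[OF u(3)]) (auto intro!: derivative_eq_intros)
    then show ?thesis by simp
  qed
  have dQ: "((\<lambda>s. - Q (h - s)) has_real_derivative local_cost a \<xi> (u (h - s) / \<epsilon>) (- w (h - s))) (at s)" for s
  proof -
    have "((\<lambda>s. Q (h - s)) has_real_derivative local_cost a \<xi> (u (h - s) / \<epsilon>) (w (h - s)) * (- 1)) (at s)"
      by (rule DERIV_chain2[OF u(6)]) (auto intro!: derivative_eq_intros)
    from DERIV_minus[OF this] show ?thesis by (simp add: local_cost_def add.commute)
  qed
  have cw: "continuous_on UNIV (\<lambda>s. - w (h - s))"
    by (intro continuous_on_minus continuous_on_compose2[OF u(4)] continuous_intros) auto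
  have "\<forall>s\<in>{0..h}. \<bar>u (h - s) - p0\<bar> \<le> d"
  proof
    fix s assume "s \<in> {0..h}"
    then have "u (h - s) \<in> {p1..p0}" by (intro u(5)) auto
    then show "\<bar>u (h - s) - p0\<bar> \<le> d" by (auto simp: d)
  qed
  then show ?thesis
    using du dQ cw u(1,2,7)
    by (intro exI[of _ "\<lambda>s. u (h - s)"] exI[of _ "\<lambda>s. - w (h - s)"] exI[of _ "\<lambda>s. - Q (h - s)"]) auto
qed

end

section \<open>Recovery curves\<close>

lemma has_integral_uniform_partition:
  fixes f :: "real \<Rightarrow> real"
  assumes "\<And>i. i < N \<Longrightarrow> (f has_integral J i) {real i * h..real (Suc i) * h}" "0 \<le> h"
  shows "(f has_integral (\<Sum>i<N. J i)) {0..real N * h}"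
  using assms(1)
proof (induction N)
  case (Suc N)
  have "0 \<le> real N * h" "real N * h \<le> real (Suc N) * h" using \<open>0 \<le> h\<close> by (auto simp: algebra_simps)
  then show ?case using has_integral_combine[OF _ _ Suc.IH Suc.prems[of N]] Suc.prems by simp
qed (simp add: has_integral_refl)

lemma mesh_closed_cell_exists:
  assumes "h > 0" "N > 0" "t \<in> {0..real N * h}"
  shows "\<exists>i<N. t \<in> {real i * h..real (Suc i) * h}"
proof (cases "t < real N * h")
  case True
  then obtain i where "i < N" "t \<in> {real i * h..<real (Suc i) * h}"
    using mesh_cell_exists[OF assms(1), of t N] assms(3) by auto
  then show ?thesis by (intro exI[of _ i]) auto
next
  case False
  then have "t = real (Suc (N - 1)) * h" using assms by simp
  then show ?thesis using assms by (intro exI[of _ "N - 1"]) auto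
qed

text \<open>Consecutive nodes must be a period apart: then every cell of the mesh contains a point where
  the frozen coefficient is maximal, even if the limit curve is at rest.\<close>

primrec spread_nodes :: "real \<Rightarrow> (nat \<Rightarrow> real) \<Rightarrow> nat \<Rightarrow> real" where
  "spread_nodes \<epsilon> x 0 = x 0"
| "spread_nodes \<epsilon> x (Suc i) =
    (if \<epsilon> \<le> \<bar>x (Suc i) - spread_nodes \<epsilon> x i\<bar> then x (Suc i) else x (Suc i) + 2 * \<epsilon>)"

text \<open>A target closer than \<open>\<epsilon>\<close> to the previous node is shifted by
  \<open>2 * \<epsilon>\<close>, which leaves it more than \<open>\<epsilon>\<close> away.\<close>

lemma spread_nodes_apart: "\<epsilon> > 0 \<Longrightarrow> \<epsilon> \<le> \<bar>spread_nodes \<epsilon> x (Suc i) - spread_nodes \<epsilon> x i\<bar>"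
  by auto

text \<open>Each node starts from its own target, so the shifts do not accumulate.\<close>

lemma spread_nodes_close: "\<epsilon> > 0 \<Longrightarrow> \<bar>spread_nodes \<epsilon> x i - x i\<bar> \<le> 2 * \<epsilon>"
  by (cases i) auto

context oscillating_coeff
begin

lemma mesh_cell_upper_bound:
  assumes q: "q \<in> AC_curves T" and st: "0 \<le> s" "s < t" "t \<le> T"
    and X: "(eff_rate q has_integral X) {s..t}"
    and close: "\<And>x. x \<in> {s..t} \<Longrightarrow> (\<forall>y. \<bar>\<mu> (q x) y - \<mu> c y\<bar> \<le> \<omega>) \<and> \<bar>(\<Xi> (q x))\<^sup>2 - (\<Xi> c)\<^sup>2\<bar> \<le> \<omega>"
  shows "(t - s) * eff_density (\<mu> c) (\<bar>q t - q s\<bar> / (t - s)) (\<Xi> c) \<le> (1 + \<omega> / m) * X + \<omega> / (2 * m) * (t - s)"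
proof -
  interpret c: periodic_coeff "\<mu> c" m M by (rule \<mu>_coeff)
  define Y where "Y = (1 + \<omega> / m) * X + \<omega> / (2 * m) * (t - s)"
  have "eff_density (\<mu> c) (\<bar>q t - q s\<bar> / (t - s)) (\<Xi> c) \<le> Y / (t - s)"
  proof (rule c.eff_least)
    fix \<nu> assume \<nu>: "\<nu> \<in> admissible (\<mu> c) (\<Xi> c)"
    define mm where "mm = mean_momentum (\<mu> c) (\<Xi> c) \<nu>"
    define \<sigma> where "\<sigma> = (if q s \<le> q t then 1 else -1 :: real)"
    have "mm \<ge> 0" unfolding mm_def by (rule c.mean_momentum_nonneg[OF \<nu>])
    have "((\<lambda>x. \<nu> + \<sigma> * mm * deriv q x) has_integral \<nu> * (t - s) + \<sigma> * mm * (q t - q s)) {s..t}"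
      using has_integral_add[OF has_integral_const_real[of \<nu> s t]
        has_integral_mult_right[OF AC_curves_FTC[OF q, of s t], of "\<sigma> * mm"]] st by (simp add: mult.commute)
    moreover have "((\<lambda>x. (1 + \<omega> / m) * eff_rate q x + \<omega> / (2 * m)) has_integral Y) {s..t}"
      using has_integral_add[OF has_integral_mult_right[OF X, of "1 + \<omega> / m"]
        has_integral_const_real[of "\<omega> / (2 * m)" s t]] st by (simp add: Y_def mult.commute)
    moreover have "\<nu> + \<sigma> * mm * deriv q x \<le> (1 + \<omega> / m) * eff_rate q x + \<omega> / (2 * m)" if "x \<in> {s..t}" for x
    proof -
      have "\<sigma> * deriv q x \<le> \<bar>deriv q x\<bar>" by (auto simp: \<sigma>_def)
      then have "\<nu> + \<sigma> * mm * deriv q x \<le> \<nu> + \<bar>deriv q x\<bar> * mm"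
        using \<open>mm \<ge> 0\<close> mult_right_mono[of "\<sigma> * deriv q x" "\<bar>deriv q x\<bar>" mm] by (simp add: mult_ac)
      also have "\<dots> \<le> eff_density (\<mu> c) (deriv q x) (\<Xi> c)"
        unfolding mm_def by (rule c.eff_upper[OF \<nu>])
      also have "\<dots> \<le> (1 + \<omega> / m) * eff_rate q x + \<omega> / (2 * m)"
        unfolding eff_rate_def using close[OF that]
        by (intro eff_density_compare[OF \<mu>_coeff \<mu>_coeff]) (auto simp: abs_minus_commute)
      finally show ?thesis .
    qed
    ultimately have "\<nu> * (t - s) + \<sigma> * mm * (q t - q s) \<le> Y" using has_integral_le by blast
    moreover have "\<sigma> * mm * (q t - q s) = \<bar>q t - q s\<bar> * mm" by (simp add: \<sigma>_def)
    moreover have "(\<nu> + \<bar>\<bar>q t - q s\<bar> / (t - s)\<bar> * mm) * (t - s) = \<nu> * (t - s) + \<bar>q t - q s\<bar> * mm"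
      using st by (simp add: distrib_right)
    ultimately show "\<nu> + \<bar>\<bar>q t - q s\<bar> / (t - s)\<bar> * mm \<le> Y / (t - s)"
      using st by (simp add: pos_le_divide_eq)
  qed
  then show ?thesis using st by (simp add: Y_def pos_le_divide_eq mult.commute)
qed

lemma recovery_on_mesh:
  fixes h T \<epsilon> \<kappa> \<omega> :: real
  defines "\<theta> \<equiv> 1 + \<omega> / m" and "C \<equiv> \<omega> / (2 * m)"
  assumes h: "h > 0" "real N * h = T" and "N > 0" "\<epsilon> > 0" "\<kappa> > 0" "\<omega> \<ge> 0"
    and apart: "\<And>i. i < N \<Longrightarrow> \<epsilon> \<le> \<bar>P (Suc i) - P i\<bar>"
    and close: "\<And>i p. i < N \<Longrightarrow> \<bar>p - P i\<bar> \<le> \<bar>P (Suc i) - P i\<bar> \<Longrightarrow>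
      (\<forall>y. \<bar>\<mu> p y - \<mu> (c i) y\<bar> \<le> \<omega>) \<and> \<bar>(\<Xi> p)\<^sup>2 - (\<Xi> (c i))\<^sup>2\<bar> \<le> \<omega>"
    and e: "\<And>i. i < N \<Longrightarrow> h * eff_density (\<mu> (c i)) (\<bar>P (Suc i) - P i\<bar> / h) (\<Xi> (c i))
      + 2 * \<epsilon> * sqrt ((\<Xi> (c i))\<^sup>2 + 2 * (M * \<bar>P (Suc i) - P i\<bar>\<^sup>2 / (2 * h\<^sup>2) + (\<Xi> (c i))\<^sup>2 / (2 * m)) * M)
      + 2 * \<kappa> * h \<le> e i"
  obtains u J where "u \<in> AC_curves T" "(rate \<epsilon> u has_integral J) {0..T}" "J \<le> \<theta> * (\<Sum>i<N. e i) + C * T"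
    "\<And>i t. i < N \<Longrightarrow> t \<in> {real i * h..real (Suc i) * h} \<Longrightarrow> \<bar>u t - P i\<bar> \<le> \<bar>P (Suc i) - P i\<bar>"
proof -
  have "\<theta> > 0" using m_pos \<open>\<omega> \<ge> 0\<close> by (simp add: \<theta>_def add_pos_nonneg)
  \<comment> \<open>One predicate, so that curve, speed and accumulated cost can be chosen for all
    cells at once.\<close>
  define good where "good i v w Q \<longleftrightarrow> v 0 = P i \<and> v h = P (Suc i) \<and> (\<forall>s. (v has_real_derivative w s) (at s)) \<and> continuous_on UNIV w \<and>
    (\<forall>s\<in>{0..h}. \<bar>v s - P i\<bar> \<le> \<bar>P (Suc i) - P i\<bar>) \<and>
    (\<forall>s. (Q has_real_derivative local_cost (\<mu> (c i)) (\<Xi> (c i)) (v s / \<epsilon>) (w s)) (at s)) \<and> Q h - Q 0 \<le> e i"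
    for i v w and Q :: "real \<Rightarrow> real"
  have "\<exists>v w Q. good i v w Q" if "i < N" for i
    using periodic_coeff.cell_recovery[OF \<mu>_coeff \<open>\<epsilon> > 0\<close> apart[OF that] \<open>h > 0\<close> \<open>\<kappa> > 0\<close>, of "c i" "\<Xi> (c i)"] e[OF that]
    unfolding good_def by (meson order_trans)
  then obtain v w Q where vwQ: "\<And>i. i < N \<Longrightarrow> good i (v i) (w i) (Q i)" by metis
  have v0: "v i 0 = P i" and vh: "v i h = P (Suc i)" and dv: "\<And>s. (v i has_real_derivative w i s) (at s)"
    and cw: "continuous_on UNIV (w i)" and range: "\<And>s. s \<in> {0..h} \<Longrightarrow> \<bar>v i s - P i\<bar> \<le> \<bar>P (Suc i) - P i\<bar>"
    and dQ: "\<And>s. (Q i has_real_derivative local_cost (\<mu> (c i)) (\<Xi> (c i)) (v i s / \<epsilon>) (w i s)) (at s)"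
    and Qe: "Q i h - Q i 0 \<le> e i" if "i < N" for i
    using vwQ[OF that] unfolding good_def by blast+
  \<comment> \<open>At an inner node the floor selects the cell on the right, and \<open>T\<close>
    is treated apart; matching node values make the cell formula valid on closed cells.\<close>
  define u where "u t = (if t < T then v (nat \<lfloor>t / h\<rfloor>) (t - mesh_left h t) else P N)" for t
  have u: "u t = v i (t - real i * h)" if "i < N" "t \<in> {real i * h..real (Suc i) * h}" for i t
  proof (cases "t < real (Suc i) * h")
    case True
    have "real (Suc i) * h \<le> real N * h" using that(1) h by (intro mult_right_mono) auto
    then have "t < T" using True h by linarith
    moreover have "mesh_left h t = real i * h" using True that(2) h by (intro mesh_left_eq) auto
    moreover have "nat \<lfloor>t / h\<rfloor> = i" using calculation(2) h by (simp add: mesh_left_def)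
    ultimately show ?thesis by (simp add: u_def)
  next
    case False
    then have t: "t = real (Suc i) * h" using that(2) by auto
    then have vi: "v i (t - real i * h) = P (Suc i)" using vh[OF that(1)] by (simp add: algebra_simps)
    show ?thesis
    proof (cases "Suc i < N")
      case True
      then have "real (Suc i) * h < real N * h" using h by (intro mult_strict_right_mono) auto
      then have "t < T" using t h by simp
      moreover have "mesh_left h t = real (Suc i) * h" using t h by (intro mesh_left_eq) auto
      moreover have "nat \<lfloor>t / h\<rfloor> = Suc i" using t h by simp
      ultimately have "u t = v (Suc i) 0" using t by (simp add: u_def)
      then show ?thesis using v0[OF True] vi by simp
    next
      case False
      then have "N = Suc i" using that(1) by simp
      then show ?thesis using t h vi by (simp add: u_def)
    qed
  qed
  have wbound: "\<exists>L\<ge>0. \<forall>s\<in>{0..h}. \<bar>w i s\<bar> \<le> L" if "i < N" for i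
  proof -
    have "compact (w i ` {0..h})"
      by (intro compact_continuous_image continuous_on_subset[OF cw[OF that]]) auto
    then obtain L where "\<forall>s\<in>{0..h}. \<bar>w i s\<bar> \<le> L"
      using compact_imp_bounded bounded_iff by (metis image_eqI real_norm_def)
    then show ?thesis using h(1) by (intro exI[of _ "\<bar>L\<bar>"]) (auto intro: order_trans[OF _ abs_ge_self])
  qed
  then obtain L where L: "\<And>i. i < N \<Longrightarrow> L i \<ge> 0" "\<And>i s. i < N \<Longrightarrow> s \<in> {0..h} \<Longrightarrow> \<bar>w i s\<bar> \<le> L i" by metis
  define L' where "L' = (\<Sum>i<N. L i)"
  have "L' \<ge> 0" unfolding L'_def using L(1) by (intro sum_nonneg) auto
  have lip: "L'-lipschitz_on {real i * h..real (Suc i) * h} u" if "i < N" for i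
  proof (rule lipschitz_onI[OF _ \<open>L' \<ge> 0\<close>])
    fix x y assume xy: "x \<in> {real i * h..real (Suc i) * h}" "y \<in> {real i * h..real (Suc i) * h}"
    have in_cell: "x - real i * h \<in> {0..h}" "y - real i * h \<in> {0..h}" using xy by (auto simp: algebra_simps)
    have "L i \<le> L'" unfolding L'_def using that L(1) by (intro member_le_sum) auto
    have "norm (v i (x - real i * h) - v i (y - real i * h)) \<le> L' * norm ((x - real i * h) - (y - real i * h))"
    proof (rule field_differentiable_bound[of "{0..h}"])
      show "(v i has_field_derivative w i z) (at z within {0..h})" for z
        using dv[OF that] has_field_derivative_at_within by blast
      show "norm (w i z) \<le> L'" if "z \<in> {0..h}" for z
        using L(2)[OF \<open>i < N\<close> that] \<open>L i \<le> L'\<close> by simp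
    qed (use in_cell in auto)
    then show "dist (u x) (u y) \<le> L' * dist x y"
      using u[OF that xy(1)] u[OF that xy(2)] by (simp add: dist_real_def)
  qed
  have cover: "{0..T} \<subseteq> (\<Union>i\<in>{..<N}. {real i * h..real (Suc i) * h})"
    using mesh_closed_cell_exists[OF h(1) \<open>N > 0\<close>] h(2) by fastforce
  have AC: "u \<in> AC_curves T"
    by (rule lipschitz_AC_curves[OF lipschitz_on_closed_Union[OF lip _ _ \<open>L' \<ge> 0\<close> cover]]) auto
  have "\<exists>J. (rate \<epsilon> u has_integral J) {real i * h..real (Suc i) * h} \<and> J \<le> \<theta> * e i + C * h" if "i < N" for i
  proof -
    define r where "r s = local_cost (\<mu> (v i s)) (\<Xi> (v i s)) (v i s / \<epsilon>) (w i s)" for s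
    have cv: "continuous_on S (v i)" for S
      using dv[OF that] by (meson DERIV_isCont continuous_at_imp_continuous_on)
    have cw': "continuous_on S (w i)" for S by (rule continuous_on_subset[OF cw[OF that]]) simp
    have pos: "\<mu> p y \<noteq> 0" for p y using bounds[of p y] m_pos by auto
    have "continuous_on S r" for S unfolding r_def local_cost_def
      using \<open>\<epsilon> > 0\<close> pos by (intro continuous_intros cont_\<mu> cont_\<Xi>' cv cw') auto
    then obtain I where I: "(r has_integral I) {0..h}"
      using integrable_continuous_interval by blast
    have Qint: "((\<lambda>s. local_cost (\<mu> (c i)) (\<Xi> (c i)) (v i s / \<epsilon>) (w i s)) has_integral Q i h - Q i 0) {0..h}"
      using dQ[OF that] h(1) by (intro fundamental_theorem_of_calculus)
        (auto simp: has_real_derivative_iff_has_vector_derivative[symmetric] intro: has_field_derivative_at_within)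
    have "I \<le> \<theta> * (Q i h - Q i 0) + C * h"
    proof (rule has_integral_le[OF I])
      show "((\<lambda>s. \<theta> * local_cost (\<mu> (c i)) (\<Xi> (c i)) (v i s / \<epsilon>) (w i s) + C) has_integral \<theta> * (Q i h - Q i 0) + C * h) {0..h}"
        using has_integral_add[OF has_integral_mult_right[OF Qint, of \<theta>] has_integral_const_real[of C 0 h]] h
        by (simp add: mult.commute)
      show "r s \<le> \<theta> * local_cost (\<mu> (c i)) (\<Xi> (c i)) (v i s / \<epsilon>) (w i s) + C" if "s \<in> {0..h}" for s
        unfolding r_def \<theta>_def C_def using close[OF \<open>i < N\<close> range[OF \<open>i < N\<close> that]]
        by (intro local_cost_compare[OF \<mu>_coeff \<mu>_coeff]) auto
    qed
    also have "\<dots> \<le> \<theta> * e i + C * h" using Qe[OF that] \<open>\<theta> > 0\<close> by simp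
    finally have "I \<le> \<theta> * e i + C * h" .
    moreover have "(rate \<epsilon> u has_integral I) {real i * h..real (Suc i) * h}"
    proof -
      have "((\<lambda>t. r (t - real i * h)) has_integral I) {real i * h..real (Suc i) * h}"
        using has_integral_affinity[of r I 0 h 1 "- (real i * h)"] I
        by (simp add: image_add_atLeastAtMost' algebra_simps)
      then show ?thesis
      proof (rule has_integral_spike_interior[of _ _ "real i * h" "real (Suc i) * h" "rate \<epsilon> u", unfolded cbox_interval])
        fix t assume t: "t \<in> box (real i * h) (real (Suc i) * h)"
        have "(v i has_real_derivative w i (t - real i * h)) (at (t - real i * h))" by (rule dv[OF that])
        then have "((\<lambda>t. v i (t - real i * h)) has_real_derivative w i (t - real i * h) * 1) (at t)"
          by (rule DERIV_chain2) (auto intro!: derivative_eq_intros)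
        then have "(u has_real_derivative w i (t - real i * h) * 1) (at t)"
          by (rule has_field_derivative_transform_within_open[of _ _ _ "{real i * h<..<real (Suc i) * h}"])
            (use t u[OF that] in auto)
        then have "deriv u t = w i (t - real i * h)" by (simp add: DERIV_imp_deriv)
        moreover have "u t = v i (t - real i * h)" using t by (intro u[OF that]) auto
        ultimately show "rate \<epsilon> u t = r (t - real i * h)" by (simp add: rate_def r_def)
      qed
    qed
    ultimately show ?thesis by blast
  qed
  then obtain J where J: "\<And>i. i < N \<Longrightarrow> (rate \<epsilon> u has_integral J i) {real i * h..real (Suc i) * h}"
    "\<And>i. i < N \<Longrightarrow> J i \<le> \<theta> * e i + C * h" by metis
  show thesis
  proof (rule that[OF AC])
    show "(rate \<epsilon> u has_integral (\<Sum>i<N. J i)) {0..T}"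
      using has_integral_uniform_partition[OF J(1), of N] h by auto
    have "(\<Sum>i<N. J i) \<le> (\<Sum>i<N. \<theta> * e i + C * h)" using J(2) by (intro sum_mono) auto
    also have "\<dots> = \<theta> * (\<Sum>i<N. e i) + C * (real N * h)" by (simp add: sum.distrib sum_distrib_left)
    finally show "(\<Sum>i<N. J i) \<le> \<theta> * (\<Sum>i<N. e i) + C * T" using h by simp
    fix i t assume "i < N" "t \<in> {real i * h..real (Suc i) * h}"
    then show "\<bar>u t - P i\<bar> \<le> \<bar>P (Suc i) - P i\<bar>"
      using u range[of i "t - real i * h"] by (auto simp: algebra_simps)
  qed
qed

text \<open>The accuracy \<open>\<omega>\<close> is fixed before the mesh and the mesh before
  \<open>\<epsilon>\<close>; since the cells are then finitely many, one threshold for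
  \<open>\<epsilon>\<close> serves them all.\<close>

theorem recovery_exists:
  assumes q: "q \<in> AC_curves T" and "T > 0" and X: "(eff_rate q has_integral X) {0..T}" and "\<zeta> > 0"
  shows "\<forall>\<^sub>F \<epsilon> in at_right 0. \<exists>u J. u \<in> AC_curves T \<and> (rate \<epsilon> u has_integral J) {0..T} \<and> J \<le> X + \<zeta> \<and>
    (\<forall>t\<in>{0..T}. \<bar>u t - q t\<bar> \<le> \<zeta>)"
proof -
  \<comment> \<open>Inner bracket: freezing along \<open>q\<close> plus the slack
    \<open>4 * \<omega> * T\<close> of the cells. The outer factor and summand come from the glued
    curve, which sees the true coefficient.\<close>
  define F where "F \<omega> = (1 + \<omega> / m) * ((1 + \<omega> / m) * X + \<omega> / (2 * m) * T + 4 * \<omega> * T) + \<omega> / (2 * m) * T" for \<omega>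
  have "(F \<longlongrightarrow> (1 + 0 / m) * ((1 + 0 / m) * X + 0 / (2 * m) * T + 4 * 0 * T) + 0 / (2 * m) * T) (at_right 0)"
    unfolding F_def using m_pos by (intro tendsto_intros) auto
  then have "\<forall>\<^sub>F \<omega> in at_right 0. F \<omega> < X + \<zeta>" using \<open>\<zeta> > 0\<close> by (intro order_tendstoD(2)[of F X]) auto
  \<comment> \<open>The distance to \<open>q\<close> is at most
    \<open>\<Delta> i + 4 * \<epsilon>\<close> inside a cell, plus \<open>2 * \<epsilon>\<close> for
    the node, plus one oscillation of \<open>q\<close>; \<open>\<Delta> i\<close>,
    \<open>\<epsilon>\<close> and the oscillation are all below \<open>\<omega>\<close>.\<close>
  moreover have "\<forall>\<^sub>F \<omega> in at_right 0. 8 * \<omega> < \<zeta>"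
    using \<open>\<zeta> > 0\<close> by (intro order_tendstoD(2)[of _ "8 * 0"] tendsto_intros) auto
  moreover have "\<forall>\<^sub>F \<omega> in at_right (0::real). \<omega> > 0" by (simp add: eventually_at_right_less)
  ultimately have "\<forall>\<^sub>F \<omega> in at_right 0. F \<omega> < X + \<zeta> \<and> 8 * \<omega> < \<zeta> \<and> \<omega> > 0" by (intro eventually_conj)
  then obtain \<omega> where \<omega>: "F \<omega> < X + \<zeta>" "8 * \<omega> < \<zeta>" "\<omega> > 0"
    using eventually_happens'[OF trivial_limit_at_right_real] by blast
  define \<theta> where "\<theta> = 1 + \<omega> / m"
  define C where "C = \<omega> / (2 * m)"
  have "\<theta> > 0" using m_pos \<omega>(3) by (simp add: \<theta>_def add_pos_pos)
  obtain N \<eta> where N: "N > 0" "\<eta> > 0" "\<And>n. n \<ge> N \<Longrightarrow> fine_mesh q (T / real n) n \<omega> \<eta>"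
    "\<And>n i t. n \<ge> N \<Longrightarrow> i < n \<Longrightarrow> t \<in> {real i * (T / real n)..real (Suc i) * (T / real n)} \<Longrightarrow>
      \<bar>q t - q (real i * (T / real n))\<bar> < min \<omega> \<eta>"
    using fine_mesh_exists[OF AC_curves_continuous[OF q] \<open>T > 0\<close> \<omega>(3)] by blast
  define h where "h = T / real N"
  have h: "h > 0" "real N * h = T" using N(1) \<open>T > 0\<close> by (auto simp: h_def)
  have mesh: "fine_mesh q h N \<omega> \<eta>" unfolding h_def by (rule N(3)) simp
  have osc: "\<bar>q t - q (real i * h)\<bar> < min \<omega> \<eta>" if "i < N" "t \<in> {real i * h..real (Suc i) * h}" for i t
    using N(4)[OF order_refl that(1)] that(2) unfolding h_def by blast
  define x where "x i = q (real i * h)" for i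
  define \<Delta> where "\<Delta> i = \<bar>x (Suc i) - x i\<bar>" for i
  define ef where "ef i = eff_density (\<mu> (x i)) (\<Delta> i / h) (\<Xi> (x i))" for i
  have cell: "0 \<le> real i * h" "real i * h < real (Suc i) * h" "real (Suc i) * h \<le> T" if "i < N" for i
  proof -
    have "real (Suc i) * h \<le> real N * h" using that h by (intro mult_right_mono) auto
    then show "real (Suc i) * h \<le> T" using h by simp
  qed (use h in \<open>auto simp: algebra_simps\<close>)
  have \<Delta>: "\<Delta> i < \<omega>" "\<Delta> i < \<eta>" if "i < N" for i
    using osc[OF that, of "real (Suc i) * h"] cell[OF that] by (auto simp: \<Delta>_def x_def)
  have int: "eff_rate q integrable_on {0..T}" using X by blast
  define Y where "Y i = integral {real i * h..real (Suc i) * h} (eff_rate q)" for i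
  have "(\<Sum>i<N. Y i) = X"
    using integral_uniform_partition[of "eff_rate q" N h] int h X by (simp add: Y_def integral_unique)
  have ef: "h * ef i \<le> \<theta> * Y i + C * h" if "i < N" for i
  proof -
    have "(real (Suc i) * h - real i * h) * eff_density (\<mu> (x i)) (\<bar>q (real (Suc i) * h) - q (real i * h)\<bar> / (real (Suc i) * h - real i * h)) (\<Xi> (x i))
      \<le> (1 + \<omega> / m) * Y i + \<omega> / (2 * m) * (real (Suc i) * h - real i * h)"
    proof (rule mesh_cell_upper_bound[OF q cell[OF that]])
      show "(eff_rate q has_integral Y i) {real i * h..real (Suc i) * h}"
        unfolding Y_def using cell[OF that] by (intro integrable_integral integrable_on_subinterval[OF int]) auto
      fix t assume "t \<in> {real i * h..real (Suc i) * h}"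
      then show "(\<forall>y. \<bar>\<mu> (q t) y - \<mu> (x i) y\<bar> \<le> \<omega>) \<and> \<bar>(\<Xi> (q t))\<^sup>2 - (\<Xi> (x i))\<^sup>2\<bar> \<le> \<omega>"
        using mesh that \<open>\<eta> > 0\<close> unfolding fine_mesh_def x_def by force
    qed
    moreover have "real (Suc i) * h - real i * h = h" by (simp add: algebra_simps)
    ultimately show ?thesis by (simp add: ef_def \<theta>_def C_def \<Delta>_def x_def)
  qed
  define cost where "cost \<epsilon> i d = h * eff_density (\<mu> (x i)) (d / h) (\<Xi> (x i))
      + 2 * \<epsilon> * sqrt ((\<Xi> (x i))\<^sup>2 + 2 * (M * d\<^sup>2 / (2 * h\<^sup>2) + (\<Xi> (x i))\<^sup>2 / (2 * m)) * M)
      + 2 * \<omega> * h" for \<epsilon> i d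
  \<comment> \<open>\<open>cost\<close> already contains \<open>2 * \<omega> * h\<close> for the
    waiting; the other half of \<open>4 * \<omega> * h\<close> absorbs the terms that vanish with
    \<open>\<epsilon>\<close>.\<close>
  define e where "e i = h * ef i + 4 * \<omega> * h" for i
  \<comment> \<open>\<open>6 * \<epsilon>\<close> is the displacement \<open>2 * \<epsilon>\<close>
    of a node plus the possible lengthening of its cell by two such displacements.\<close>
  have ev1: "\<forall>\<^sub>F \<epsilon> in at_right 0. \<forall>i\<in>{..<N}. \<Delta> i + 6 * \<epsilon> < \<eta>"
  proof (rule eventually_ball_finite, simp, intro ballI)
    fix i assume "i \<in> {..<N}"
    then show "\<forall>\<^sub>F \<epsilon> in at_right 0. \<Delta> i + 6 * \<epsilon> < \<eta>"
      using \<Delta>(2)[of i] by (intro order_tendstoD(2)[of _ "\<Delta> i + 6 * 0"] tendsto_intros) auto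
  qed
  have ev2: "\<forall>\<^sub>F \<epsilon> in at_right 0. \<forall>i\<in>{..<N}. cost \<epsilon> i (\<Delta> i + 4 * \<epsilon>) < e i"
  proof (rule eventually_ball_finite, simp, intro ballI)
    fix i assume "i \<in> {..<N}"
    have "isCont (\<lambda>v. eff_density (\<mu> (x i)) v (\<Xi> (x i))) (\<Delta> i / h)"
      using periodic_coeff.eff_continuous[OF \<mu>_coeff] continuous_on_eq_continuous_at by blast
    moreover have "((\<lambda>\<epsilon>. (\<Delta> i + 4 * \<epsilon>) / h) \<longlongrightarrow> (\<Delta> i + 4 * 0) / h) (at_right 0)"
      using h(1) by (intro tendsto_intros) auto
    then have "((\<lambda>\<epsilon>. (\<Delta> i + 4 * \<epsilon>) / h) \<longlongrightarrow> \<Delta> i / h) (at_right 0)" by simp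
    ultimately have "((\<lambda>\<epsilon>. eff_density (\<mu> (x i)) ((\<Delta> i + 4 * \<epsilon>) / h) (\<Xi> (x i))) \<longlongrightarrow> ef i) (at_right 0)"
      unfolding ef_def by (rule isCont_tendsto_compose)
    then have "((\<lambda>\<epsilon>. cost \<epsilon> i (\<Delta> i + 4 * \<epsilon>)) \<longlongrightarrow> h * ef i
      + 2 * 0 * sqrt ((\<Xi> (x i))\<^sup>2 + 2 * (M * (\<Delta> i + 4 * 0)\<^sup>2 / (2 * h\<^sup>2) + (\<Xi> (x i))\<^sup>2 / (2 * m)) * M) + 2 * \<omega> * h) (at_right 0)"
      unfolding cost_def using h(1) by (intro tendsto_intros) auto
    then show "\<forall>\<^sub>F \<epsilon> in at_right 0. cost \<epsilon> i (\<Delta> i + 4 * \<epsilon>) < e i"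
      by (rule order_tendstoD(2)) (use \<omega>(3) h(1) in \<open>simp add: e_def\<close>)
  qed
  have ev3: "\<forall>\<^sub>F \<epsilon> in at_right 0. 0 < \<epsilon> \<and> \<epsilon> < \<omega>"
    using \<omega>(3) by (auto simp: eventually_at_right[of 0 \<omega>])
  show ?thesis
    using ev1 ev2 ev3
  proof eventually_elim
    case (elim \<epsilon>)
    define P where "P = spread_nodes \<epsilon> x"
    have P: "\<epsilon> \<le> \<bar>P (Suc i) - P i\<bar>" "\<bar>P i - x i\<bar> \<le> 2 * \<epsilon>" for i
      unfolding P_def using elim spread_nodes_apart spread_nodes_close by blast+
    have d: "\<bar>P (Suc i) - P i\<bar> \<le> \<Delta> i + 4 * \<epsilon>" for i
      using P(2)[of i] P(2)[of "Suc i"] unfolding \<Delta>_def by linarith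
    obtain u J where u: "u \<in> AC_curves T" "(rate \<epsilon> u has_integral J) {0..T}" "J \<le> (1 + \<omega> / m) * (\<Sum>i<N. e i) + \<omega> / (2 * m) * T"
      "\<And>i t. i < N \<Longrightarrow> t \<in> {real i * h..real (Suc i) * h} \<Longrightarrow> \<bar>u t - P i\<bar> \<le> \<bar>P (Suc i) - P i\<bar>"
    proof (rule recovery_on_mesh[OF h N(1), of \<epsilon> \<omega> \<omega> P x e])
      fix i assume "i < N"
      show "\<epsilon> \<le> \<bar>P (Suc i) - P i\<bar>" by (rule P(1))
      have "h * eff_density (\<mu> (x i)) (\<bar>P (Suc i) - P i\<bar> / h) (\<Xi> (x i))
        \<le> h * eff_density (\<mu> (x i)) ((\<Delta> i + 4 * \<epsilon>) / h) (\<Xi> (x i))"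
        using d[of i] h(1) by (intro mult_left_mono periodic_coeff.eff_mono[OF \<mu>_coeff])
          (auto simp: abs_of_nonneg divide_right_mono)
      moreover have "2 * \<epsilon> * sqrt ((\<Xi> (x i))\<^sup>2 + 2 * (M * \<bar>P (Suc i) - P i\<bar>\<^sup>2 / (2 * h\<^sup>2) + (\<Xi> (x i))\<^sup>2 / (2 * m)) * M)
        \<le> 2 * \<epsilon> * sqrt ((\<Xi> (x i))\<^sup>2 + 2 * (M * (\<Delta> i + 4 * \<epsilon>)\<^sup>2 / (2 * h\<^sup>2) + (\<Xi> (x i))\<^sup>2 / (2 * m)) * M)"
        using elim d[of i] M_pos
        by (intro mult_left_mono real_sqrt_le_mono add_left_mono mult_right_mono add_right_mono divide_right_mono power_mono) simp_all
      ultimately have "h * eff_density (\<mu> (x i)) (\<bar>P (Suc i) - P i\<bar> / h) (\<Xi> (x i))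
        + 2 * \<epsilon> * sqrt ((\<Xi> (x i))\<^sup>2 + 2 * (M * \<bar>P (Suc i) - P i\<bar>\<^sup>2 / (2 * h\<^sup>2) + (\<Xi> (x i))\<^sup>2 / (2 * m)) * M)
        + 2 * \<omega> * h \<le> cost \<epsilon> i (\<Delta> i + 4 * \<epsilon>)" unfolding cost_def by linarith
      also have "\<dots> \<le> e i" using elim \<open>i < N\<close> by (simp add: less_imp_le)
      finally show "h * eff_density (\<mu> (x i)) (\<bar>P (Suc i) - P i\<bar> / h) (\<Xi> (x i))
        + 2 * \<epsilon> * sqrt ((\<Xi> (x i))\<^sup>2 + 2 * (M * \<bar>P (Suc i) - P i\<bar>\<^sup>2 / (2 * h\<^sup>2) + (\<Xi> (x i))\<^sup>2 / (2 * m)) * M)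
        + 2 * \<omega> * h \<le> e i" .
      fix p assume p: "\<bar>p - P i\<bar> \<le> \<bar>P (Suc i) - P i\<bar>"
      have "\<Delta> i + 6 * \<epsilon> < \<eta>" using elim \<open>i < N\<close> by blast
      then have "\<bar>p - q (real i * h)\<bar> < \<eta>" using p d[of i] P(2)[of i] unfolding x_def by linarith
      moreover have "real i * h \<in> {real i * h..real (Suc i) * h}" using cell[OF \<open>i < N\<close>] by auto
      ultimately show "(\<forall>y. \<bar>\<mu> p y - \<mu> (x i) y\<bar> \<le> \<omega>) \<and> \<bar>(\<Xi> p)\<^sup>2 - (\<Xi> (x i))\<^sup>2\<bar> \<le> \<omega>"
        using mesh \<open>i < N\<close> unfolding fine_mesh_def x_def by blast
    qed (use elim \<omega>(3) in auto)
    have "J \<le> X + \<zeta>"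
    proof -
      have "(\<Sum>i<N. e i) \<le> (\<Sum>i<N. \<theta> * Y i + C * h + 4 * \<omega> * h)"
        unfolding e_def using ef by (intro sum_mono add_right_mono) auto
      also have "\<dots> = \<theta> * (\<Sum>i<N. Y i) + C * (real N * h) + 4 * \<omega> * (real N * h)"
        by (simp add: sum.distrib sum_distrib_left)
      also have "\<dots> = \<theta> * X + C * T + 4 * \<omega> * T" unfolding \<open>(\<Sum>i<N. Y i) = X\<close> h(2) ..
      finally have "\<theta> * (\<Sum>i<N. e i) \<le> \<theta> * (\<theta> * X + C * T + 4 * \<omega> * T)" using \<open>\<theta> > 0\<close> by simp
      then have "J \<le> F \<omega>" using u(3) unfolding F_def \<theta>_def C_def by linarith
      then show ?thesis using \<omega>(1) by simp
    qed
    moreover have "\<bar>u t - q t\<bar> \<le> \<zeta>" if "t \<in> {0..T}" for t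
    proof -
      obtain i where i: "i < N" "t \<in> {real i * h..real (Suc i) * h}"
        using mesh_closed_cell_exists[OF h(1) N(1)] \<open>t \<in> {0..T}\<close> h(2) by blast
      have "\<bar>q t - x i\<bar> < \<omega>" using osc[OF i] by (simp add: x_def)
      moreover have "0 < \<epsilon>" "\<epsilon> < \<omega>" using elim by auto
      ultimately show ?thesis
        using u(4)[OF i] d[of i] P(2)[of i] \<Delta>(1)[OF i(1)] \<omega>(2) by linarith
    qed
    ultimately show ?case using u(1,2) by blast
  qed
qed

end

section \<open>Gamma-convergence\<close>

lemma topspace_C_curves:
  "topspace (C_curves T) = {q \<in> extensional {0..T}. continuous_on {0..T} q}"
proof -
  have "bounded (q ` {0..T})" if "continuous_on {0..T} q" for q :: "real \<Rightarrow> real"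
    using compact_continuous_image[OF that] compact_imp_bounded by blast
  then show ?thesis
    by (auto simp: C_curves_def mtopology_of_euclidean continuous_map_iff_continuous)
qed

lemma C_curves_mdist_le:
  assumes "q \<in> topspace (C_curves T)" "u \<in> topspace (C_curves T)" "0 \<le> T"
  shows "mdist (cfunspace (top_of_set {0..T}) euclidean_metric) u q \<le> e \<longleftrightarrow> (\<forall>t\<in>{0..T}. \<bar>u t - q t\<bar> \<le> e)"
proof -
  have "{0..T} \<noteq> {}" using assms(3) by simp
  then show ?thesis
    using cfunspace_mdist_le[of u "top_of_set {0..T}" euclidean_metric q e] assms
    by (simp add: C_curves_def dist_real_def)
qed

lemma limitin_C_curves_iff:
  "limitin (C_curves T) u q F \<longleftrightarrow> q \<in> topspace (C_curves T) \<and>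
    (\<forall>e>0. \<forall>\<^sub>F x in F. u x \<in> topspace (C_curves T) \<and> mdist (cfunspace (top_of_set {0..T}) euclidean_metric) (u x) q < e)"
proof -
  have "topspace (C_curves T) = mspace (cfunspace (top_of_set {0..T}) euclidean_metric)"
    unfolding C_curves_def by (rule topspace_mtopology_of)
  then show ?thesis
    unfolding C_curves_def mtopology_of_def
    using Metric_space.limitin_metric[OF Metric_space_mspace_mdist, of "cfunspace (top_of_set {0..T}) euclidean_metric" u q F]
    by (simp only: mtopology_of_def)
qed

lemma limitin_C_curvesD:
  assumes "limitin (C_curves T) u q F" "0 \<le> T" "e > 0"
  shows "\<forall>\<^sub>F x in F. u x \<in> topspace (C_curves T) \<and> (\<forall>t\<in>{0..T}. \<bar>u x t - q t\<bar> \<le> e)"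
proof -
  have q: "q \<in> topspace (C_curves T)" and
    "\<forall>\<^sub>F x in F. u x \<in> topspace (C_curves T) \<and> mdist (cfunspace (top_of_set {0..T}) euclidean_metric) (u x) q < e"
    using assms unfolding limitin_C_curves_iff by auto
  from this(2) show ?thesis
    by eventually_elim (use C_curves_mdist_le[OF q _ \<open>0 \<le> T\<close>] less_imp_le in blast)
qed

lemma limitin_C_curvesI:
  assumes q: "q \<in> topspace (C_curves T)" and "0 \<le> T"
    and ev: "\<And>e. e > 0 \<Longrightarrow> \<forall>\<^sub>F x in F. u x \<in> topspace (C_curves T) \<and> (\<forall>t\<in>{0..T}. \<bar>u x t - q t\<bar> \<le> e)"
  shows "limitin (C_curves T) u q F"
  unfolding limitin_C_curves_iff
proof (intro conjI allI impI q)
  fix e :: real assume "e > 0"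
  then have "e / 2 > 0" "e / 2 < e" by auto
  show "\<forall>\<^sub>F x in F. u x \<in> topspace (C_curves T) \<and> mdist (cfunspace (top_of_set {0..T}) euclidean_metric) (u x) q < e"
    using ev[OF \<open>e / 2 > 0\<close>]
    by eventually_elim (use C_curves_mdist_le[OF q _ \<open>0 \<le> T\<close>] le_less_trans[OF _ \<open>e / 2 < e\<close>] in blast)
qed

lemma time_integral_ereal:
  "time_integral T (\<lambda>t. ereal (f t)) = enn2ereal (\<integral>\<^sup>+t. ennreal (f t) \<partial>lebesgue_on {0..T})"
  by (simp add: time_integral_def)

lemma deriv_cong_interior:
  fixes u v :: "real \<Rightarrow> real"
  assumes "\<And>t. t \<in> {0..T} \<Longrightarrow> u t = v t" "t \<in> {0<..<T}"
  shows "deriv u t = deriv v t"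
proof (rule deriv_cong_ev[OF _ refl])
  show "\<forall>\<^sub>F x in nhds t. u x = v x"
    unfolding eventually_nhds using assms by (intro exI[of _ "{0<..<T}"]) auto
qed

text \<open>For each \<open>\<epsilon>\<close> the largest solvable level is used; the cap
  \<open>1 / \<epsilon>\<close> keeps the set of levels finite, and \<open>anti\<close> passes from
  it to every lower level.\<close>

lemma diagonal_family:
  fixes G :: "nat \<Rightarrow> real \<Rightarrow> 'a \<Rightarrow> bool"
  assumes ev: "\<And>n. \<forall>\<^sub>F \<epsilon> in at_right 0. \<exists>u. G n \<epsilon> u"
    and anti: "\<And>n k \<epsilon> u. G n \<epsilon> u \<Longrightarrow> k \<le> n \<Longrightarrow> G k \<epsilon> u"
  shows "\<exists>u. \<forall>n. \<forall>\<^sub>F \<epsilon> in at_right 0. G n \<epsilon> (u \<epsilon>)"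
proof -
  define S where "S \<epsilon> = {k. real k \<le> 1 / \<epsilon> \<and> (\<exists>u. G k \<epsilon> u)}" for \<epsilon>
  define u where "u \<epsilon> = (SOME u. G (Max (S \<epsilon>)) \<epsilon> u)" for \<epsilon>
  show ?thesis
  proof (intro exI[of _ u] allI)
    fix n :: nat
    have "\<forall>\<^sub>F \<epsilon> in at_right (0::real). 0 < \<epsilon> \<and> \<epsilon> < 1 / (real n + 1)"
      by (auto simp: eventually_at_right[of 0 1] intro!: exI[of _ "1 / (real n + 1)"])
    then show "\<forall>\<^sub>F \<epsilon> in at_right 0. G n \<epsilon> (u \<epsilon>)"
      using ev[of n]
    proof eventually_elim
      case (elim \<epsilon>)
      have "real n + 1 \<le> 1 / \<epsilon>" using elim(1) by (simp add: field_simps)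
      then have n: "n \<in> S \<epsilon>" using elim(2) by (simp add: S_def)
      have "S \<epsilon> \<subseteq> {..nat \<lfloor>1 / \<epsilon>\<rfloor>}" by (auto simp: S_def le_nat_floor)
      then have fin: "finite (S \<epsilon>)" by (rule finite_subset) simp
      then have "Max (S \<epsilon>) \<in> S \<epsilon>" using n by (intro Max_in) auto
      then have "G (Max (S \<epsilon>)) \<epsilon> (u \<epsilon>)" unfolding u_def S_def by (auto intro: someI_ex)
      then show ?case using anti Max_ge[OF fin n] by blast
    qed
  qed
qed

context oscillating_coeff
begin

text \<open>By contradiction: if the bound fails, energies at most \<open>y\<close> occur for
  arbitrarily small \<open>\<epsilon>\<close>, which yields a sequence for
  \<open>liminf_inequality\<close>.\<close>

lemma gamma_liminf:
  assumes "T > 0" and lim: "limitin (C_curves T) u q (at_right 0)"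
  shows "ext_AC T (\<lambda>q. time_integral T (\<lambda>t. ereal (eff_rate q t))) q
    \<le> Liminf (at_right 0) (\<lambda>\<epsilon>. ext_AC T (\<lambda>u. time_integral T (\<lambda>t. ereal (rate \<epsilon> u t))) (u \<epsilon>))"
  unfolding le_Liminf_iff
proof (intro allI impI, rule ccontr)
  let ?lim = "ext_AC T (\<lambda>q. time_integral T (\<lambda>t. ereal (eff_rate q t)))"
  let ?osc = "\<lambda>\<epsilon>. ext_AC T (\<lambda>u. time_integral T (\<lambda>t. ereal (rate \<epsilon> u t)))"
  fix y assume y: "y < ?lim q" and "\<not> (\<forall>\<^sub>F \<epsilon> in at_right 0. y < ?osc \<epsilon> (u \<epsilon>))"
  then have freq: "\<exists>\<^sub>F \<epsilon> in at_right 0. ?osc \<epsilon> (u \<epsilon>) \<le> y" by (simp add: frequently_def not_le)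
  have "\<exists>\<epsilon>. 0 < \<epsilon> \<and> \<epsilon> < 1 / Suc n \<and> (\<forall>t\<in>{0..T}. \<bar>u \<epsilon> t - q t\<bar> \<le> 1 / Suc n) \<and> ?osc \<epsilon> (u \<epsilon>) \<le> y" for n
  proof -
    have "\<forall>\<^sub>F \<epsilon> in at_right (0::real). 0 < \<epsilon> \<and> \<epsilon> < 1 / Suc n"
      by (auto simp: eventually_at_right[of 0 1] intro!: exI[of _ "1 / Suc n"])
    moreover have "\<forall>\<^sub>F \<epsilon> in at_right 0. u \<epsilon> \<in> topspace (C_curves T) \<and> (\<forall>t\<in>{0..T}. \<bar>u \<epsilon> t - q t\<bar> \<le> 1 / Suc n)"
      using limitin_C_curvesD[OF lim, of "1 / Suc n"] \<open>T > 0\<close> by simp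
    ultimately have "\<forall>\<^sub>F \<epsilon> in at_right 0. 0 < \<epsilon> \<and> \<epsilon> < 1 / Suc n \<and> (\<forall>t\<in>{0..T}. \<bar>u \<epsilon> t - q t\<bar> \<le> 1 / Suc n)"
      by eventually_elim blast
    from frequently_ex[OF frequently_eventually_frequently[OF freq this]] show ?thesis by blast
  qed
  then obtain \<epsilon> where \<epsilon>: "\<And>n. 0 < \<epsilon> n" "\<And>n. \<epsilon> n < 1 / Suc n"
    "\<And>n t. t \<in> {0..T} \<Longrightarrow> \<bar>u (\<epsilon> n) t - q t\<bar> \<le> 1 / Suc n" "\<And>n. ?osc (\<epsilon> n) (u (\<epsilon> n)) \<le> y"
    by metis
  have "y \<noteq> \<infinity>" using y by auto
  then have AC: "u (\<epsilon> n) \<in> AC_curves T" for n using \<epsilon>(4)[of n] by (auto simp: ext_AC_def split: if_splits)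
  have le: "enn2ereal (\<integral>\<^sup>+t. ennreal (rate (\<epsilon> n) (u (\<epsilon> n)) t) \<partial>lebesgue_on {0..T}) \<le> y" for n
    using \<epsilon>(4)[of n] AC[of n] by (simp add: ext_AC_def time_integral_ereal)
  have "0 \<le> y" using le[of 0] by (rule order_trans[OF enn2ereal_nonneg])
  then obtain K where K: "y = ereal K" "0 \<le> K" using \<open>y \<noteq> \<infinity>\<close> by (cases y) auto
  have "\<exists>I. (rate (\<epsilon> n) (u (\<epsilon> n)) has_integral I) {0..T} \<and> I \<le> K" for n
  proof -
    have b: "(\<integral>\<^sup>+t. ennreal (rate (\<epsilon> n) (u (\<epsilon> n)) t) \<partial>lebesgue_on {0..T}) \<le> ennreal K"
      using le[of n] K by (simp add: less_eq_ennreal.rep_eq)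
    then have "(\<integral>\<^sup>+t. ennreal (rate (\<epsilon> n) (u (\<epsilon> n)) t) \<partial>lebesgue_on {0..T}) < \<infinity>"
      using ennreal_less_top le_less_trans by (metis infinity_ennreal_def)
    from finite_nn_integral_has_integral[OF rate_measurable[OF AC \<epsilon>(1)] rate_nonneg this]
    show ?thesis using b K(2) by (auto simp: ennreal_le_iff)
  qed
  then obtain I where I: "\<And>n. (rate (\<epsilon> n) (u (\<epsilon> n)) has_integral I n) {0..T}" "\<And>n. I n \<le> K" by metis
  have inv: "(\<lambda>n. 1 / real (Suc n)) \<longlonglongrightarrow> 0" using LIMSEQ_inverse_real_of_nat by (simp add: inverse_eq_divide)
  have lim0: "\<epsilon> \<longlonglongrightarrow> 0"
    by (rule tendsto_sandwich[OF _ _ tendsto_const inv]) (use \<epsilon>(1,2) in \<open>auto simp: less_imp_le\<close>)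
  have unif: "\<forall>\<^sub>F n in sequentially. \<forall>t\<in>{0..T}. \<bar>u (\<epsilon> n) t - q t\<bar> < e" if "e > 0" for e
    using order_tendstoD(2)[OF inv that] by eventually_elim (use \<epsilon>(3) le_less_trans in blast)
  have q: "q \<in> AC_curves T" and "(\<integral>\<^sup>+t. ennreal (eff_rate q t) \<partial>lebesgue_on {0..T}) \<le> ennreal K"
    by (rule liminf_inequality[OF AC I \<epsilon>(1) lim0 unif \<open>T > 0\<close>]; assumption)+
  then have "?lim q \<le> y" using K by (simp add: ext_AC_def time_integral_ereal less_eq_ennreal.rep_eq)
  then show False using y by simp
qed

text \<open>\<open>recovery_exists\<close> with tolerance \<open>1 / Suc n\<close> for every
  \<open>n\<close>, joined by \<open>diagonal_family\<close>. A curve with infinite limit value is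
  its own recovery family.\<close>

lemma gamma_recovery:
  assumes "T > 0" and q: "q \<in> topspace (C_curves T)"
  shows "\<exists>u. limitin (C_curves T) u q (at_right 0) \<and>
    Limsup (at_right 0) (\<lambda>\<epsilon>. ext_AC T (\<lambda>u. time_integral T (\<lambda>t. ereal (rate \<epsilon> u t))) (u \<epsilon>))
      \<le> ext_AC T (\<lambda>q. time_integral T (\<lambda>t. ereal (eff_rate q t))) q"
proof (cases "ext_AC T (\<lambda>q. time_integral T (\<lambda>t. ereal (eff_rate q t))) q = \<infinity>")
  case True
  have "limitin (C_curves T) (\<lambda>_. q) q (at_right 0)" using q by (simp add: limitin_const_iff)
  then show ?thesis using True by (intro exI[of _ "\<lambda>_. q"]) simp
next
  case False
  let ?lim = "ext_AC T (\<lambda>q. time_integral T (\<lambda>t. ereal (eff_rate q t)))"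
  let ?osc = "\<lambda>\<epsilon>. ext_AC T (\<lambda>u. time_integral T (\<lambda>t. ereal (rate \<epsilon> u t)))"
  from False have AC: "q \<in> AC_curves T" by (auto simp: ext_AC_def split: if_splits)
  then have "enn2ereal (\<integral>\<^sup>+t. ennreal (eff_rate q t) \<partial>lebesgue_on {0..T}) \<noteq> \<infinity>"
    using False by (simp add: ext_AC_def time_integral_ereal)
  then have "(\<integral>\<^sup>+t. ennreal (eff_rate q t) \<partial>lebesgue_on {0..T}) < \<infinity>"
    by (metis enn2ereal_top infinity_ennreal_def less_top)
  then obtain X where X: "0 \<le> X" "(eff_rate q has_integral X) {0..T}"
    "(\<integral>\<^sup>+t. ennreal (eff_rate q t) \<partial>lebesgue_on {0..T}) = ennreal X"
    using finite_nn_integral_has_integral[OF eff_rate_measurable[OF AC] eff_rate_nonneg] by blast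
  have f0: "?lim q = ereal X" using AC X by (simp add: ext_AC_def time_integral_ereal)
  define G where "G n \<epsilon> v \<longleftrightarrow> v \<in> topspace (C_curves T) \<and> v \<in> AC_curves T \<and>
    (\<exists>J. (rate \<epsilon> v has_integral J) {0..T} \<and> J \<le> X + 1 / Suc n) \<and> (\<forall>t\<in>{0..T}. \<bar>v t - q t\<bar> \<le> 1 / Suc n)"
    for n :: nat and \<epsilon> v
  have ev: "\<forall>\<^sub>F \<epsilon> in at_right 0. \<exists>v. G n \<epsilon> v" for n
  proof -
    have "0 < 1 / real (Suc n)" by simp
    from recovery_exists[OF AC \<open>T > 0\<close> X(2) this] show ?thesis
    proof eventually_elim
      case (elim \<epsilon>)
      then obtain u J where u: "u \<in> AC_curves T" "(rate \<epsilon> u has_integral J) {0..T}" "J \<le> X + 1 / Suc n"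
        "\<forall>t\<in>{0..T}. \<bar>u t - q t\<bar> \<le> 1 / Suc n" by blast
      \<comment> \<open>Members of \<open>C_curves\<close> are undefined outside
        \<open>{0..T}\<close>; within \<open>{0..T}\<close> the restriction can change derivatives
        only at the two endpoints.\<close>
      define v where "v = restrict u {0..T}"
      have uv: "u t = v t" if "t \<in> {0..T}" for t using that by (simp add: v_def)
      have "v \<in> AC_curves T" by (rule AC_curves_cong[OF uv u(1)])
      moreover from this have "v \<in> topspace (C_curves T)"
        unfolding topspace_C_curves by (simp add: AC_curves_continuous) (simp add: v_def)
      moreover have "(rate \<epsilon> v has_integral J) {0..T}"
        using u(2) unfolding cbox_interval[symmetric]
      proof (rule has_integral_spike_interior)
        fix t assume "t \<in> box 0 T"
        then have "deriv u t = deriv v t" "u t = v t" using deriv_cong_interior[of T u v t] uv by auto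
        then show "rate \<epsilon> v t = rate \<epsilon> u t" by (simp add: rate_def)
      qed
      ultimately show ?case using u(3,4) uv unfolding G_def by (intro exI[of _ v]) auto
    qed
  qed
  have anti: "G k \<epsilon> v" if Gn: "G n \<epsilon> v" "k \<le> n" for n k \<epsilon> v
  proof -
    have le: "1 / real (Suc n) \<le> 1 / real (Suc k)" using that(2) by (simp add: frac_le)
    obtain J where "(rate \<epsilon> v has_integral J) {0..T}" "J \<le> X + 1 / Suc n" using Gn(1) unfolding G_def by blast
    then have "\<exists>J. (rate \<epsilon> v has_integral J) {0..T} \<and> J \<le> X + 1 / Suc k" using le by (intro exI[of _ J]) auto
    moreover have "\<forall>t\<in>{0..T}. \<bar>v t - q t\<bar> \<le> 1 / Suc k"
      using that(1) le unfolding G_def by (meson order_trans)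
    ultimately show ?thesis using that(1) unfolding G_def by blast
  qed
  have "\<exists>u. \<forall>n. \<forall>\<^sub>F \<epsilon> in at_right 0. G n \<epsilon> (u \<epsilon>)" by (rule diagonal_family[OF ev]) (rule anti)
  then obtain u where u: "\<And>n. \<forall>\<^sub>F \<epsilon> in at_right 0. G n \<epsilon> (u \<epsilon>)" by blast
  have "limitin (C_curves T) u q (at_right 0)"
  proof (rule limitin_C_curvesI[OF q])
    fix e :: real assume "e > 0"
    then obtain n where n: "1 / Suc n < e" by (metis nat_approx_posE)
    show "\<forall>\<^sub>F \<epsilon> in at_right 0. u \<epsilon> \<in> topspace (C_curves T) \<and> (\<forall>t\<in>{0..T}. \<bar>u \<epsilon> t - q t\<bar> \<le> e)"
      using u[of n] by eventually_elim (use n in \<open>auto simp: G_def intro: order_trans[OF _ less_imp_le]\<close>)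
  qed (use \<open>T > 0\<close> in simp)
  moreover have "Limsup (at_right 0) (\<lambda>\<epsilon>. ?osc \<epsilon> (u \<epsilon>)) \<le> ereal X"
  proof (rule ereal_le_epsilon2)
    fix e :: real assume "e > 0"
    then obtain n where n: "1 / Suc n < e" by (metis nat_approx_posE)
    show "Limsup (at_right 0) (\<lambda>\<epsilon>. ?osc \<epsilon> (u \<epsilon>)) \<le> ereal X + ereal e"
    proof (rule Limsup_bounded)
      show "\<forall>\<^sub>F \<epsilon> in at_right 0. ?osc \<epsilon> (u \<epsilon>) \<le> ereal X + ereal e"
        using u[of n]
      proof eventually_elim
        case (elim \<epsilon>)
        then obtain J where J: "u \<epsilon> \<in> AC_curves T" "(rate \<epsilon> (u \<epsilon>) has_integral J) {0..T}" "J \<le> X + 1 / Suc n"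
          unfolding G_def by blast
        have "J \<ge> 0" using has_integral_nonneg[OF J(2)] rate_nonneg by blast
        then show ?case
          using J n has_integral_imp_nn_integral[OF J(2) rate_nonneg]
          by (simp add: ext_AC_def time_integral_ereal)
      qed
    qed
  qed
  ultimately show ?thesis using f0 by auto
qed

theorem gamma_convergence:
  assumes "T > 0"
  shows "gamma_converges (C_curves T)
    (\<lambda>\<epsilon>. ext_AC T (\<lambda>u. time_integral T (\<lambda>t. ereal (rate \<epsilon> u t))))
    (ext_AC T (\<lambda>q. time_integral T (\<lambda>t. ereal (eff_rate q t))))"
  unfolding gamma_converges_def using gamma_liminf[OF assms] gamma_recovery[OF assms] by blast

end

text \<open>A recovery family for one limit is tested in the liminf inequality of the other.\<close>

lemma gamma_limit_unique:
  assumes "gamma_converges X f f0" "gamma_converges X f f1" "x \<in> topspace X"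
  shows "f0 x = f1 x"
proof -
  have "f0 x \<le> f1 x" if conv: "gamma_converges X f f0" "gamma_converges X f f1" for f0 f1
  proof -
    obtain u where u: "limitin X u x (at_right 0)" "Limsup (at_right 0) (\<lambda>\<epsilon>. f \<epsilon> (u \<epsilon>)) \<le> f1 x"
      using conv(2) assms(3) unfolding gamma_converges_def by blast
    have "f0 x \<le> Liminf (at_right 0) (\<lambda>\<epsilon>. f \<epsilon> (u \<epsilon>))"
      using conv(1) assms(3) u(1) unfolding gamma_converges_def by blast
    also have "\<dots> \<le> Limsup (at_right 0) (\<lambda>\<epsilon>. f \<epsilon> (u \<epsilon>))" by (rule Liminf_le_Limsup) simp
    finally show ?thesis using u(2) by simp
  qed
  then show ?thesis using assms(1,2) by (simp add: antisym)
qed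

text \<open>A constant family of a continuous function converges to it; uniqueness of the limit
  gives the converse, which identifies \<open>E0\<close> when tilt convergence is refuted.\<close>

lemma energies_gamma_converge_const_iff:
  assumes "continuous_on UNIV E"
  shows "energies_gamma_converge (\<lambda>\<epsilon>. E) E0 \<longleftrightarrow> E0 = E"
proof -
  have lim: "((\<lambda>\<epsilon>. ereal (E (u \<epsilon>))) \<longlongrightarrow> ereal (E x)) (at_right 0)" if "limitin euclidean u x (at_right 0)" for u :: "real \<Rightarrow> real" and x
  proof -
    have "isCont E x" using assms continuous_on_eq_continuous_at by blast
    moreover have "(u \<longlongrightarrow> x) (at_right 0)" using that by simp
    ultimately have "((\<lambda>\<epsilon>. E (u \<epsilon>)) \<longlongrightarrow> E x) (at_right 0)" by (rule isCont_tendsto_compose)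
    then show ?thesis by (rule tendsto_ereal)
  qed
  have conv: "gamma_converges euclidean (\<lambda>\<epsilon> q. ereal (E q)) (\<lambda>q. ereal (E q))"
    unfolding gamma_converges_def
  proof (intro ballI conjI allI impI)
    fix x and u :: "real \<Rightarrow> real" assume "limitin euclidean u x (at_right 0)"
    then show "ereal (E x) \<le> Liminf (at_right 0) (\<lambda>\<epsilon>. ereal (E (u \<epsilon>)))"
      using lim_imp_Liminf[OF _ lim] by simp
  next
    fix x :: real
    have "limitin euclidean (\<lambda>_. x) x (at_right (0::real))" by simp
    moreover from lim[OF this] have "Limsup (at_right 0) (\<lambda>_::real. ereal (E x)) \<le> ereal (E x)"
      by (intro Limsup_bounded) simp
    ultimately show "\<exists>u. limitin euclidean u x (at_right 0) \<and> Limsup (at_right 0) (\<lambda>\<epsilon>::real. ereal (E (u \<epsilon>))) \<le> ereal (E x)"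
      by (intro exI[of _ "\<lambda>_. x"]) simp
  qed
  show ?thesis
  proof
    assume "energies_gamma_converge (\<lambda>\<epsilon>. E) E0"
    then have "ereal (E0 x) = ereal (E x)" for x
      using gamma_limit_unique[OF _ conv, of "\<lambda>q. ereal (E0 q)" x] by (simp add: energies_gamma_converge_def)
    then show "E0 = E" by auto
  qed (use conv in \<open>simp add: energies_gamma_converge_def\<close>)
qed

section \<open>Notions of convergence of gradient systems\<close>

lemma C1_continuous_deriv:
  fixes E :: "real \<Rightarrow> real"
  assumes "E C1_differentiable_on UNIV"
  shows "(E has_real_derivative deriv E x) (at x)" "continuous_on UNIV (deriv E)" "continuous_on UNIV E"
proof -
  obtain D where D: "\<And>x. (E has_vector_derivative D x) (at x)" "continuous_on UNIV D"
    using assms unfolding C1_differentiable_on_def by auto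
  have d: "(E has_real_derivative D x) (at x)" for x
    using D(1) by (simp add: has_real_derivative_iff_has_vector_derivative)
  then have eq: "deriv E = D" using DERIV_imp_deriv by blast
  show "(E has_real_derivative deriv E x) (at x)" "continuous_on UNIV (deriv E)"
    using d D(2) unfolding eq by auto
  show "continuous_on UNIV E" using d DERIV_isCont continuous_at_imp_continuous_on by blast
qed

lemma C1_realI:
  fixes E :: "real \<Rightarrow> real"
  assumes "\<And>x. (E has_real_derivative D x) (at x)" "continuous_on UNIV D"
  shows "E C1_differentiable_on UNIV"
  using assms unfolding C1_differentiable_on_def by (auto simp: has_real_derivative_iff_has_vector_derivative)

section \<open>Convexity, semicontinuity and duality of potentials\<close>

lemma quadratic_econvex:
  assumes "0 \<le> c"
  shows "econvex (\<lambda>v. ereal (c / 2 * v\<^sup>2))"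
  unfolding econvex_def
proof (intro allI impI)
  fix v w t :: real assume t: "0 < t \<and> t < 1"
  have "(1 - t) * (c / 2 * v\<^sup>2) + t * (c / 2 * w\<^sup>2) - c / 2 * ((1 - t) * v + t * w)\<^sup>2
      = c / 2 * (t * (1 - t)) * (v - w)\<^sup>2"
    by (simp add: power2_eq_square field_simps)
  moreover have "0 \<le> c / 2 * (t * (1 - t)) * (v - w)\<^sup>2" using assms t by simp
  ultimately show "ereal (c / 2 * ((1 - t) * v + t * w)\<^sup>2) \<le> ereal (1 - t) * ereal (c / 2 * v\<^sup>2) + ereal t * ereal (c / 2 * w\<^sup>2)"
    by simp
qed

lemma continuous_lsc:
  fixes f :: "real \<Rightarrow> real"
  assumes "continuous_on UNIV f"
  shows "lsc (\<lambda>v. ereal (f v))"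
  unfolding lsc_def
proof
  fix v
  have "isCont f v" using assms continuous_on_eq_continuous_at by blast
  then have "((\<lambda>v. ereal (f v)) \<longlongrightarrow> ereal (f v)) (at v)" by (intro tendsto_ereal) (simp add: isCont_def)
  then have "Liminf (at v) (\<lambda>v. ereal (f v)) = ereal (f v)" by (intro lim_imp_Liminf) auto
  then show "ereal (f v) \<le> Liminf (at v) (\<lambda>v. ereal (f v))" by simp
qed

lemma convex_econvex:
  fixes f :: "real \<Rightarrow> real"
  assumes "convex_on UNIV f"
  shows "econvex (\<lambda>v. ereal (f v))"
  unfolding econvex_def
proof (intro allI impI)
  fix v w t :: real assume "0 < t \<and> t < 1"
  then have "f ((1 - t) *\<^sub>R v + t *\<^sub>R w) \<le> (1 - t) * f v + t * f w"
    using assms by (intro convex_onD[OF assms]) auto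
  then show "ereal (f ((1 - t) * v + t * w)) \<le> ereal (1 - t) * ereal (f v) + ereal t * ereal (f w)" by simp
qed

lemma quadratic_potential:
  assumes "\<And>q. 0 \<le> c q"
  shows "dissipation_potential (\<lambda>q v. ereal (c q / 2 * v\<^sup>2))"
  unfolding dissipation_potential_def
proof (intro allI conjI)
  fix q v
  show "econvex (\<lambda>v. ereal (c q / 2 * v\<^sup>2))" by (rule quadratic_econvex[OF assms])
  show "lsc (\<lambda>v. ereal (c q / 2 * v\<^sup>2))" by (intro continuous_lsc continuous_intros)
  show "0 \<le> ereal (c q / 2 * v\<^sup>2)" using assms[of q] by simp
qed simp

lemma quadratic_dual:
  assumes "0 < c q" and R: "\<And>v. R q v = ereal (c q / 2 * v\<^sup>2)"
  shows "dual_potential R q \<xi> = ereal (\<xi>\<^sup>2 / (2 * c q))"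
  unfolding dual_potential_def
proof (rule antisym)
  have "ereal (\<xi> * v) - R q v \<le> ereal (\<xi>\<^sup>2 / (2 * c q))" for v
  proof -
    have "\<xi>\<^sup>2 / (2 * c q) - (\<xi> * v - c q / 2 * v\<^sup>2) = (c q * v - \<xi>)\<^sup>2 / (2 * c q)"
      using assms(1) by (simp add: power2_eq_square field_simps)
    moreover have "0 \<le> (c q * v - \<xi>)\<^sup>2 / (2 * c q)" using assms(1) by simp
    ultimately show ?thesis by (simp add: R)
  qed
  then show "(SUP v. ereal (\<xi> * v) - R q v) \<le> ereal (\<xi>\<^sup>2 / (2 * c q))" by (intro SUP_least)
  have "ereal (\<xi>\<^sup>2 / (2 * c q)) = ereal (\<xi> * (\<xi> / c q)) - R q (\<xi> / c q)"
    using assms(1) by (simp add: R power2_eq_square field_simps)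
  then show "ereal (\<xi>\<^sup>2 / (2 * c q)) \<le> (SUP v. ereal (\<xi> * v) - R q v)"
    by (intro SUP_upper2[of "\<xi> / c q"]) auto
qed

lemma quadratic_subdifferential:
  assumes "0 < c"
  shows "\<xi> \<in> subdifferential (\<lambda>v. ereal (c / 2 * v\<^sup>2)) v \<longleftrightarrow> \<xi> = c * v"
proof
  assume "\<xi> \<in> subdifferential (\<lambda>v. ereal (c / 2 * v\<^sup>2)) v"
  then have "c / 2 * v\<^sup>2 + \<xi> * (w - v) \<le> c / 2 * w\<^sup>2" for w by (simp add: subdifferential_def)
  \<comment> \<open>\<open>w = \<xi> / c\<close> minimizes
    \<open>c / 2 * w\<^sup>2 - \<xi> * w\<close>, so the inequality is sharpest there and says that
    a square is nonpositive.\<close>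
  from this[of "\<xi> / c"] have "c / 2 * v\<^sup>2 + \<xi> * (\<xi> / c - v) - c / 2 * (\<xi> / c)\<^sup>2 \<le> 0" by simp
  moreover have "c / 2 * v\<^sup>2 + \<xi> * (\<xi> / c - v) - c / 2 * (\<xi> / c)\<^sup>2 = (\<xi> - c * v)\<^sup>2 / (2 * c)"
    using assms by (simp add: power2_eq_square field_simps)
  ultimately have "(\<xi> - c * v)\<^sup>2 / (2 * c) \<le> 0" by linarith
  then show "\<xi> = c * v" using assms by (simp add: divide_le_0_iff)
next
  assume "\<xi> = c * v"
  moreover have "c / 2 * v\<^sup>2 + c * v * (w - v) \<le> c / 2 * w\<^sup>2" for w
  proof -
    have "c / 2 * w\<^sup>2 - (c / 2 * v\<^sup>2 + c * v * (w - v)) = c / 2 * (w - v)\<^sup>2"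
      by (simp add: power2_eq_square field_simps)
    moreover have "0 \<le> c / 2 * (w - v)\<^sup>2" using assms by simp
    ultimately show ?thesis by linarith
  qed
  ultimately show "\<xi> \<in> subdifferential (\<lambda>v. ereal (c / 2 * v\<^sup>2)) v" by (simp add: subdifferential_def)
qed

context oscillating_coeff
begin

section \<open>From dissipation potentials to the rates of the locale\<close>

lemma diss_rate_R_osc:
  assumes "\<And>q. \<Xi> q = - deriv E q - deriv F q"
  shows "diss_rate E (R_osc \<mu> \<epsilon>) F u = (\<lambda>t. ereal (rate \<epsilon> u t))"
proof
  fix t
  have "\<mu> p y > 0" for p y using bounds[of p y] m_pos by linarith
  then have "dual_potential (R_osc \<mu> \<epsilon>) (u t) (\<Xi> (u t)) = ereal ((\<Xi> (u t))\<^sup>2 / (2 * \<mu> (u t) (u t / \<epsilon>)))"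
    using quadratic_dual[of "\<lambda>q. \<mu> q (q / \<epsilon>)" "u t" "R_osc \<mu> \<epsilon>"] by (simp add: R_osc_def)
  then show "diss_rate E (R_osc \<mu> \<epsilon>) F u t = ereal (rate \<epsilon> u t)"
    unfolding diss_rate_def assms[symmetric] by (simp add: R_osc_def rate_def local_cost_def)
qed

lemma diss_measurable_R_osc:
  assumes "\<And>q. \<Xi> q = - deriv E q - deriv F q" "\<epsilon> > 0"
  shows "diss_measurable E (R_osc \<mu> \<epsilon>) F"
  unfolding diss_measurable_def diss_rate_R_osc[OF assms(1)]
  using rate_measurable[OF _ assms(2)] by (auto intro: borel_measurable_ereal)

lemma gamma_convergence_R_osc:
  assumes "\<And>q. \<Xi> q = - deriv E q - deriv F q" "T > 0"
  shows "gamma_converges (C_curves T) (\<lambda>\<epsilon>. ext_AC T (diss_functional E (R_osc \<mu> \<epsilon>) T F))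
    (ext_AC T (\<lambda>q. time_integral T (\<lambda>t. ereal (eff_rate q t))))"
  using gamma_convergence[OF assms(2)] by (simp add: diss_functional_def[abs_def] diss_rate_R_osc[OF assms(1)])

end

text \<open>The coefficient without a force, since energy and tilt now vary; each choice of them
  instantiates \<open>oscillating_coeff\<close>.\<close>

locale wiggly =
  fixes \<mu> :: "real \<Rightarrow> real \<Rightarrow> real" and m M :: real
  assumes cont: "continuous_on UNIV (\<lambda>(q, y). \<mu> q y)"
    and per: "\<And>q y. \<mu> q (y + 1) = \<mu> q y"
    and m_pos: "0 < m"
    and bounds: "\<And>q y. m \<le> \<mu> q y \<and> \<mu> q y \<le> M"
begin

lemma osc: "continuous_on UNIV \<Xi> \<Longrightarrow> oscillating_coeff \<mu> m M \<Xi>"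
  using cont per m_pos bounds by unfold_locales auto

sublocale coeff: periodic_coeff "\<mu> q" m M for q
  by (rule oscillating_coeff.\<mu>_coeff[OF osc[OF continuous_on_const[of _ 0]]])

lemma gradient_system_R_osc:
  "E C1_differentiable_on UNIV \<Longrightarrow> gradient_system E (R_osc \<mu> \<epsilon>)"
  using quadratic_potential[of "\<lambda>q. \<mu> q (q / \<epsilon>)"] coeff.a_pos
  by (simp add: gradient_system_def R_osc_def[abs_def] less_imp_le)

text \<open>The last argument is \<open>- deriv F q\<close> in the functionals, so the derivative of
  the energy is subtracted to obtain the total force; \<open>M_of\<close> cancels exactly this
  shift.\<close>

definition N_eff :: "(real \<Rightarrow> real) \<Rightarrow> real \<Rightarrow> real \<Rightarrow> real \<Rightarrow> ereal" where
  "N_eff E q v \<eta> = ereal (eff_density (\<mu> q) v (\<eta> - deriv E q))"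

lemma M_of_N_eff: "M_of E (N_eff E) q v \<xi> = ereal (eff_density (\<mu> q) v \<xi>)"
  by (simp add: M_of_def N_eff_def)

lemma basic_assumptions_N_eff:
  assumes E: "E C1_differentiable_on UNIV"
  shows "basic_assumptions (\<lambda>\<epsilon>. E) (R_osc \<mu>) E (N_eff E)"
  unfolding basic_assumptions_def
proof (intro conjI)
  have osc': "oscillating_coeff \<mu> m M (\<lambda>q. - deriv E q - deriv F q)" if "F C1_differentiable_on UNIV" for F
    by (intro osc continuous_intros C1_continuous_deriv[OF E] C1_continuous_deriv[OF that])
  show "\<forall>\<epsilon>>0. gradient_system E (R_osc \<mu> \<epsilon>) \<and> (\<forall>F. F C1_differentiable_on UNIV \<longrightarrow> diss_measurable E (R_osc \<mu> \<epsilon>) F)"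
    using gradient_system_R_osc[OF E] oscillating_coeff.diss_measurable_R_osc[OF osc'] by blast
  show "energies_gamma_converge (\<lambda>\<epsilon>. E) E"
    using energies_gamma_converge_const_iff C1_continuous_deriv(3)[OF E] by blast
  show "\<forall>q v \<eta>. 0 \<le> N_eff E q v \<eta>" by (simp add: N_eff_def coeff.eff_nonneg)
  show "\<exists>D0. \<forall>T>0. \<forall>F. F C1_differentiable_on UNIV \<longrightarrow>
        gamma_converges (C_curves T) (\<lambda>\<epsilon>. ext_AC T (diss_functional E (R_osc \<mu> \<epsilon>) T F))
          (ext_AC T (\<lambda>q. D0 T q F)) \<and>
        (\<forall>q\<in>AC_curves T.
          (\<lambda>t. N_eff E (q t) (deriv q t) (- deriv F (q t))) \<in> borel_measurable (lebesgue_on {0..T}) \<and>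
          D0 T q F = time_integral T (\<lambda>t. N_eff E (q t) (deriv q t) (- deriv F (q t))))"
  proof (intro exI[of _ "\<lambda>T q F. time_integral T (\<lambda>t. N_eff E (q t) (deriv q t) (- deriv F (q t)))"] allI impI conjI ballI refl)
    fix T :: real and F :: "real \<Rightarrow> real" assume T: "T > 0" and F: "F C1_differentiable_on UNIV"
    interpret o: oscillating_coeff \<mu> m M "\<lambda>q. - deriv E q - deriv F q" by (rule osc'[OF F])
    have N: "(\<lambda>t. N_eff E (q t) (deriv q t) (- deriv F (q t))) = (\<lambda>t. ereal (o.eff_rate q t))" for q
    proof
      have "- deriv F p - deriv E p = - deriv E p - deriv F p" for p by simp
      then show "N_eff E (q t) (deriv q t) (- deriv F (q t)) = ereal (o.eff_rate q t)" for t
        by (simp only: N_eff_def o.eff_rate_def)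
    qed
    show "gamma_converges (C_curves T) (\<lambda>\<epsilon>. ext_AC T (diss_functional E (R_osc \<mu> \<epsilon>) T F))
          (ext_AC T (\<lambda>q. time_integral T (\<lambda>t. N_eff E (q t) (deriv q t) (- deriv F (q t)))))"
      unfolding N by (rule o.gamma_convergence_R_osc[OF refl T])
    show "(\<lambda>t. N_eff E (q t) (deriv q t) (- deriv F (q t))) \<in> borel_measurable (lebesgue_on {0..T})"
      if "q \<in> AC_curves T" for q
      unfolding N using o.eff_rate_measurable[OF that] by (rule borel_measurable_ereal)
  qed
  show "\<forall>q \<eta>. econvex (\<lambda>v. N_eff E q v \<eta>) \<and> lsc (\<lambda>v. N_eff E q v \<eta>)"
    unfolding N_eff_def using convex_econvex[OF coeff.eff_convex] continuous_lsc[OF coeff.eff_continuous] by blast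
  show "\<forall>q v \<xi>. M_of E (N_eff E) q v \<xi> \<ge> ereal (\<xi> * v)"
    unfolding M_of_N_eff using coeff.eff_ge_abs by (auto simp: mult.commute intro: order_trans[OF abs_ge_self])
  show "\<forall>q v \<xi>. M_of E (N_eff E) q v \<xi> \<ge> M_of E (N_eff E) q 0 \<xi>"
    unfolding M_of_N_eff by (simp add: coeff.eff_mono)
qed

text \<open>Both sets are the line on which \<open>\<xi>\<close> equals the mean of
  \<open>\<mu> q\<close> times \<open>v\<close>.\<close>

lemma contact_convergence:
  assumes E: "E C1_differentiable_on UNIV"
  shows "contact_EDP_converges (\<lambda>\<epsilon>. E) (R_osc \<mu>) E (R_eff \<mu>)"
  unfolding contact_EDP_converges_def
proof (intro conjI exI[of _ "N_eff E"] allI basic_assumptions_N_eff[OF E])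
  have pos: "0 < integral {0..1} (\<mu> q)" for q using coeff.mean_a_bounds(1)[of q] m_pos by linarith
  show "gradient_system E (R_eff \<mu>)"
    using quadratic_potential[of "\<lambda>q. integral {0..1} (\<mu> q)"] pos E
    by (simp add: gradient_system_def R_eff_def[abs_def] less_imp_le)
  show "{(v, \<xi>). M_of E (N_eff E) q v \<xi> = ereal (\<xi> * v)} = {(v, \<xi>). \<xi> \<in> subdifferential (R_eff \<mu> q) v}" for q
    using quadratic_subdifferential[OF pos[of q]] coeff.eff_contact_iff[of q]
    by (simp add: M_of_N_eff R_eff_def[abs_def])
qed

text \<open>The untilted functional sees at \<open>q\<close> only the force
  \<open>- deriv E q\<close>. The density at that force is split into its value at rest and the
  remainder, and the value at rest turns out to be the dual of the remainder at that force.\<close>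

definition R_simple :: "(real \<Rightarrow> real) \<Rightarrow> real \<Rightarrow> real \<Rightarrow> ereal" where
  "R_simple E q v = ereal (eff_density (\<mu> q) v (- deriv E q) - eff_density (\<mu> q) 0 (- deriv E q))"

text \<open>The bound of the density by \<open>\<xi> * v\<close> gives one inequality; the velocity
  in contact with the force attains the supremum.\<close>

lemma dual_R_simple: "dual_potential (R_simple E) q (- deriv E q) = ereal (eff_density (\<mu> q) 0 (- deriv E q))"
  unfolding dual_potential_def
proof (rule antisym)
  let ?\<xi> = "- deriv E q"
  have "ereal (?\<xi> * v) - R_simple E q v \<le> ereal (eff_density (\<mu> q) 0 ?\<xi>)" for v
    using coeff.eff_ge_abs[of v ?\<xi> q] by (simp add: R_simple_def) (simp add: mult.commute abs_le_iff)
  then show "(SUP v. ereal (?\<xi> * v) - R_simple E q v) \<le> ereal (eff_density (\<mu> q) 0 ?\<xi>)" by (intro SUP_least)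
  have "integral {0..1} (\<mu> q) > 0" using coeff.mean_a_bounds(1)[of q] m_pos by linarith
  then obtain v where "?\<xi> = integral {0..1} (\<mu> q) * v"
    by (metis less_irrefl nonzero_mult_div_cancel_left times_divide_eq_right)
  then have "eff_density (\<mu> q) v ?\<xi> = ?\<xi> * v" using coeff.eff_contact_iff[of q v ?\<xi>] by blast
  then have "ereal (eff_density (\<mu> q) 0 ?\<xi>) = ereal (?\<xi> * v) - R_simple E q v" by (simp add: R_simple_def)
  then show "ereal (eff_density (\<mu> q) 0 ?\<xi>) \<le> (SUP v. ereal (?\<xi> * v) - R_simple E q v)"
    by (intro SUP_upper2[of v]) auto
qed

lemma dissipation_potential_R_simple: "dissipation_potential (R_simple E)"
  unfolding dissipation_potential_def
proof (intro allI conjI)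
  fix q v
  have "convex_on UNIV (\<lambda>v. eff_density (\<mu> q) v (- deriv E q) + - eff_density (\<mu> q) 0 (- deriv E q))"
    by (intro convex_on_add coeff.eff_convex) (simp add: convex_on_const)
  from convex_econvex[OF this] show "econvex (R_simple E q)" by (simp add: R_simple_def[abs_def])
  show "lsc (R_simple E q)" unfolding R_simple_def[abs_def]
    by (intro continuous_lsc continuous_intros coeff.eff_continuous)
  show "R_simple E q 0 = 0" by (simp add: R_simple_def)
  show "0 \<le> R_simple E q v" by (simp add: R_simple_def coeff.eff_mono)
qed

lemma simple_convergence:
  assumes E: "E C1_differentiable_on UNIV"
  shows "simple_EDP_converges (\<lambda>\<epsilon>. E) (R_osc \<mu>) E (R_simple E)"
proof -
  interpret o: oscillating_coeff \<mu> m M "\<lambda>q. - deriv E q"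
    by (intro osc continuous_intros C1_continuous_deriv[OF E])
  have force: "- deriv E q = - deriv E q - deriv (\<lambda>_. 0::real) q" for q by simp
  have r: "diss_rate E (R_simple E) (\<lambda>_. 0) q = (\<lambda>t. ereal (o.eff_rate q t))" for q
    unfolding diss_rate_def force[symmetric] dual_R_simple by (simp add: R_simple_def o.eff_rate_def)
  show ?thesis
    unfolding simple_EDP_converges_def
  proof (intro conjI allI impI)
    fix \<epsilon> :: real assume "\<epsilon> > 0"
    then show "gradient_system E (R_osc \<mu> \<epsilon>)" "diss_measurable E (R_osc \<mu> \<epsilon>) (\<lambda>_. 0)"
      using gradient_system_R_osc[OF E] o.diss_measurable_R_osc[OF force] by auto
  next
    fix T :: real assume "T > 0"
    then show "gamma_converges (C_curves T) (\<lambda>\<epsilon>. ext_AC T (diss_functional E (R_osc \<mu> \<epsilon>) T (\<lambda>_. 0)))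
      (ext_AC T (diss_functional E (R_simple E) T (\<lambda>_. 0)))"
      unfolding diss_functional_def[of E "R_simple E", abs_def] r
      by (rule o.gamma_convergence_R_osc[OF force])
  next
    show "gradient_system E (R_simple E)"
      using E dissipation_potential_R_simple by (simp add: gradient_system_def)
    show "diss_measurable E (R_simple E) (\<lambda>_. 0)"
      unfolding diss_measurable_def r using o.eff_rate_measurable by (auto intro: borel_measurable_ereal)
    show "energies_gamma_converge (\<lambda>\<epsilon>. E) E"
      using energies_gamma_converge_const_iff C1_continuous_deriv(3)[OF E] by blast
  qed
qed

text \<open>For a nonzero force the density has a kink at \<open>v = 0\<close>, whose slope is the mean momentum at
  the largest admissible multiplier.\<close>

lemma R_simple_not_quadratic:
  assumes "\<not> \<mu> q constant_on UNIV" "deriv E q \<noteq> 0"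
  shows "\<not> is_quadratic (R_simple E q)"
proof
  assume "is_quadratic (R_simple E q)"
  then obtain c where c: "\<And>v. eff_density (\<mu> q) v (- deriv E q) - eff_density (\<mu> q) 0 (- deriv E q) = c / 2 * v\<^sup>2"
    unfolding is_quadratic_def R_simple_def by auto
  let ?\<xi> = "- deriv E q"
  obtain y0 where max: "\<And>y. \<mu> q y \<le> \<mu> q y0" using coeff.max_a[of q] by blast
  define \<nu> where "\<nu> = ?\<xi>\<^sup>2 / (2 * \<mu> q y0)"
  define k where "k = mean_momentum (\<mu> q) ?\<xi> \<nu>"
  have "k > 0" unfolding k_def \<nu>_def using assms(2) by (intro coeff.mean_momentum_pos[OF assms(1) _ max]) simp
  have e0: "eff_density (\<mu> q) 0 ?\<xi> = \<nu>" unfolding \<nu>_def by (rule coeff.eff_zero[OF max])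
  have adm: "\<nu> \<in> admissible (\<mu> q) ?\<xi>" unfolding \<nu>_def by (rule coeff.max_admissible[OF max])
  have le: "v * k \<le> c / 2 * v\<^sup>2" if "v > 0" for v
    using coeff.eff_upper[OF adm, of v] c[of v] that unfolding e0 k_def[symmetric] by simp
  \<comment> \<open>\<open>c\<close> may be nonpositive; the positive \<open>b \<ge> c\<close>
    allows the choice \<open>v = k / b\<close>, for which the quadratic is at most half of the
    linear lower bound.\<close>
  define b where "b = \<bar>c\<bar> + 1"
  have b: "b > 0" "c \<le> b" by (auto simp: b_def)
  define v where "v = k / b"
  have "v > 0" using \<open>k > 0\<close> b by (simp add: v_def)
  have "v * k \<le> v * (c / 2 * v)" using le[OF \<open>v > 0\<close>] by (simp add: power2_eq_square mult_ac)
  then have "k \<le> c / 2 * v" using \<open>v > 0\<close> by simp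
  also have "\<dots> \<le> b / 2 * v" using \<open>v > 0\<close> b by (intro mult_right_mono) auto
  also have "\<dots> = k / 2" using b by (simp add: v_def)
  finally show False using \<open>k > 0\<close> by simp
qed

section \<open>Impossibility of one potential for several forces\<close>

lemma time_integral_ae_const:
  assumes "0 \<le> T" "0 \<le> k" "\<And>t. t \<in> {0<..<T} \<Longrightarrow> f t = k"
  shows "time_integral T f = enn2ereal (e2ennreal k * ennreal T)"
proof -
  have "AE t in lebesgue_on {0..T}. e2ennreal (f t) = e2ennreal k"
    by (rule AE_lebesgue_on_negligible[of "{0, T}"]) (use assms(3) in auto)
  then have "(\<integral>\<^sup>+t. e2ennreal (f t) \<partial>lebesgue_on {0..T}) = (\<integral>\<^sup>+t. e2ennreal k \<partial>lebesgue_on {0..T})"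
    by (rule nn_integral_cong_AE)
  also have "\<dots> = e2ennreal k * ennreal T"
    using assms(1) by (simp add: space_restrict_space emeasure_restrict_space)
  finally show ?thesis by (simp add: time_integral_def)
qed

text \<open>No potential \<open>R0\<close> serves two forces at once: the curve \<open>t \<mapsto> q + t\<close> at zero force determines
  \<open>R0 q 1\<close>, constant curves determine the dual potential, and the resulting sum violates the
  lower bound \<open>\<xi> * v\<close> at the contact force \<open>\<xi> = r\<close>.\<close>

lemma no_common_potential:
  assumes nc: "\<not> \<mu> q0 constant_on UNIV" and R0: "dissipation_potential R0"
    and meas: "\<And>r T q. T > 0 \<Longrightarrow> q \<in> topspace (C_curves T) \<Longrightarrow> q \<in> AC_curves T \<Longrightarrow>
      (\<lambda>t. R0 (q t) (deriv q t) + dual_potential R0 (q t) r) \<in> borel_measurable (lebesgue_on {0..T})"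
    and eq: "\<And>r T q. T > 0 \<Longrightarrow> q \<in> topspace (C_curves T) \<Longrightarrow> q \<in> AC_curves T \<Longrightarrow>
      time_integral T (\<lambda>t. R0 (q t) (deriv q t) + dual_potential R0 (q t) r)
        = time_integral T (\<lambda>t. ereal (eff_density (\<mu> (q t)) (deriv q t) r))"
  shows False
proof -
  have R00: "R0 c 0 = 0" and R0pos: "0 \<le> R0 c v" for c v using R0 by (auto simp: dissipation_potential_def)
  have dual_pos: "0 \<le> dual_potential R0 c r" for c r
    unfolding dual_potential_def by (rule SUP_upper2[of 0]) (auto simp: R00)
  have affine: "restrict (\<lambda>t. c + b * t) {0..T} \<in> topspace (C_curves T)"
    "restrict (\<lambda>t. c + b * t) {0..T} \<in> AC_curves T"
    "t \<in> {0<..<T} \<Longrightarrow> deriv (restrict (\<lambda>t. c + b * t) {0..T}) t = b" for c b t T :: real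
  proof -
    have r: "restrict (\<lambda>t. c + b * t) {0..T} t = c + b * t" if "t \<in> {0..T}" for t using that by simp
    have "continuous_on {0..T} (restrict (\<lambda>t. c + b * t) {0..T})"
      by (rule continuous_on_eq[of _ "\<lambda>t. c + b * t"]) (auto intro!: continuous_intros)
    then show "restrict (\<lambda>t. c + b * t) {0..T} \<in> topspace (C_curves T)" by (simp add: topspace_C_curves)
    have "\<bar>b\<bar>-lipschitz_on {0..T} (restrict (\<lambda>t. c + b * t) {0..T})"
      by (rule lipschitz_onI) (auto simp: dist_real_def abs_mult[symmetric] right_diff_distrib)
    then show "restrict (\<lambda>t. c + b * t) {0..T} \<in> AC_curves T" by (rule lipschitz_AC_curves)
    have "((\<lambda>t. c + b * t) has_real_derivative b) (at t)" by (auto intro!: derivative_eq_intros)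
    then have "deriv (\<lambda>t. c + b * t) t = b" by (rule DERIV_imp_deriv)
    then show "deriv (restrict (\<lambda>t. c + b * t) {0..T}) t = b" if "t \<in> {0<..<T}"
      using deriv_cong_interior[of T "restrict (\<lambda>t. c + b * t) {0..T}" "\<lambda>t. c + b * t" t] that r by simp
  qed
  \<comment> \<open>On a constant curve \<open>R0\<close> contributes \<open>R0 c 0 = 0\<close>, so
    the integral identity isolates the dual.\<close>
  have dual: "dual_potential R0 c r = ereal (eff_density (\<mu> c) 0 r)" for c r
  proof -
    define q where "q = restrict (\<lambda>t. c + 0 * t) {0..1::real}"
    have q: "q \<in> topspace (C_curves 1)" "q \<in> AC_curves 1" "\<And>t. t \<in> {0<..<1} \<Longrightarrow> deriv q t = 0"
      "\<And>t. t \<in> {0<..<1} \<Longrightarrow> q t = c"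
      unfolding q_def using affine[where b = 0 and c = c and T = 1] by auto
    have "time_integral 1 (\<lambda>t. R0 (q t) (deriv q t) + dual_potential R0 (q t) r) = enn2ereal (e2ennreal (dual_potential R0 c r) * ennreal 1)"
      by (rule time_integral_ae_const) (use q(3,4) R00 dual_pos in auto)
    moreover have "time_integral 1 (\<lambda>t. ereal (eff_density (\<mu> (q t)) (deriv q t) r)) = enn2ereal (e2ennreal (ereal (eff_density (\<mu> c) 0 r)) * ennreal 1)"
      by (rule time_integral_ae_const) (use q(3,4) coeff.eff_nonneg in auto)
    ultimately have "enn2ereal (e2ennreal (dual_potential R0 c r)) = enn2ereal (e2ennreal (ereal (eff_density (\<mu> c) 0 r)))"
      using eq[OF _ q(1,2), of r] by simp
    then show ?thesis using dual_pos coeff.eff_nonneg by (simp add: enn2ereal_e2ennreal del: e2ennreal_ereal)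
  qed
  define r where "r = integral {0..1} (\<mu> q0)"
  have "r > 0" using coeff.mean_a_bounds(1)[of q0] m_pos by (simp add: r_def)
  define S1 where "S1 = eff_density (\<mu> q0) 1 0"
  define S2 where "S2 = eff_density (\<mu> q0) 0 r"
  have S: "0 \<le> S1" "0 \<le> S2" by (auto simp: S1_def S2_def coeff.eff_nonneg)
  \<comment> \<open>\<open>S1\<close> is below \<open>r / 2\<close> by the strict inequality for the
    mean of the root, and \<open>S2\<close> is at most \<open>r / 2\<close> because the mean is at
    most the maximum.\<close>
  have "S1 + S2 < r"
  proof -
    have "S1 \<le> 1\<^sup>2 / 2 * (integral {0..1} (\<lambda>y. sqrt (\<mu> q0 y)))\<^sup>2"
      unfolding S1_def by (rule coeff.eff_no_force_le)
    then have 1: "S1 < r / 2" using coeff.mean_sqrt_less[OF nc] by (simp add: r_def)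
    obtain y0 where max: "\<And>y. \<mu> q0 y \<le> \<mu> q0 y0" using coeff.max_a[of q0] by blast
    have "S2 = r * r / (2 * \<mu> q0 y0)" unfolding S2_def coeff.eff_zero[OF max] by (simp add: power2_eq_square)
    moreover have "r \<le> \<mu> q0 y0"
      unfolding r_def
      using has_integral_le[OF integrable_integral[OF coeff.a_integrable] has_integral_const_real[of "\<mu> q0 y0" 0 1]] max by simp
    then have "r * r / (2 * \<mu> q0 y0) \<le> r / 2"
      using \<open>r > 0\<close> coeff.a_pos[of q0 y0] by (simp add: field_simps)
    ultimately show ?thesis using 1 by linarith
  qed
  \<comment> \<open>Hypothesis \<open>eq\<close> fixes \<open>R0\<close> only after integration, so
    the contradiction at \<open>q0\<close> is spread over a short curve on which
    \<open>\<mu>\<close> varies by at most \<open>\<omega>\<close>; \<open>F\<close> is the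
    resulting perturbation of \<open>S1 + S2\<close>.\<close>
  define F where "F \<omega> = (1 + \<omega> / m) * (S1 + S2) + 2 * (\<omega> / (2 * m))" for \<omega>
  have "(F \<longlongrightarrow> (1 + 0 / m) * (S1 + S2) + 2 * (0 / (2 * m))) (at_right 0)"
    unfolding F_def using m_pos by (intro tendsto_intros) auto
  then have "\<forall>\<^sub>F \<omega> in at_right 0. F \<omega> < r" using \<open>S1 + S2 < r\<close> by (intro order_tendstoD(2)[of F "S1 + S2"]) auto
  moreover have "\<forall>\<^sub>F \<omega> in at_right (0::real). \<omega> > 0" by (simp add: eventually_at_right_less)
  ultimately have "\<forall>\<^sub>F \<omega> in at_right 0. F \<omega> < r \<and> \<omega> > 0" by (rule eventually_conj)
  then obtain \<omega> where \<omega>: "F \<omega> < r" "\<omega> > 0" using eventually_happens'[OF trivial_limit_at_right_real] by blast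
  interpret o: oscillating_coeff \<mu> m M "\<lambda>_. 0" by (rule osc) simp
  obtain \<delta> where \<delta>: "\<delta> > 0" "\<And>q c. \<bar>q\<bar> \<le> \<bar>q0\<bar> + 1 \<Longrightarrow> \<bar>c\<bar> \<le> \<bar>q0\<bar> + 1 \<Longrightarrow> \<bar>q - c\<bar> < \<delta> \<Longrightarrow>
    (\<forall>y. \<bar>\<mu> q y - \<mu> c y\<bar> \<le> \<omega>) \<and> \<bar>(0::real)\<^sup>2 - 0\<^sup>2\<bar> \<le> \<omega>"
    using o.modulus[OF \<omega>(2), of "\<bar>q0\<bar> + 1"] by blast
  define T where "T = min (\<delta> / 2) 1"
  have T: "T > 0" "T < \<delta>" "T \<le> 1" using \<delta>(1) by (auto simp: T_def)
  define \<theta> where "\<theta> = 1 + \<omega> / m"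
  define C where "C = \<omega> / (2 * m)"
  have \<theta>C: "\<theta> > 0" "C \<ge> 0" using m_pos \<omega>(2) by (auto simp: \<theta>_def C_def add_pos_pos)
  have near: "eff_density (\<mu> c) v \<xi> \<le> \<theta> * eff_density (\<mu> q0) v \<xi> + C" if "c \<in> {q0..q0 + T}" for c v \<xi>
    unfolding \<theta>_def C_def
  proof (rule eff_density_compare[OF coeff.periodic_coeff_axioms coeff.periodic_coeff_axioms])
    show "\<bar>\<mu> c y - \<mu> q0 y\<bar> \<le> \<omega>" for y using \<delta>(2)[of c q0] that T by auto
  qed (use \<omega>(2) in simp)
  define q where "q = restrict (\<lambda>t. q0 + 1 * t) {0..T}"
  have q: "q \<in> topspace (C_curves T)" "q \<in> AC_curves T" "\<And>t. t \<in> {0<..<T} \<Longrightarrow> deriv q t = 1"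
    "\<And>t. t \<in> {0<..<T} \<Longrightarrow> q t \<in> {q0..q0 + T}"
    unfolding q_def using affine[where b = 1 and c = q0 and T = T] by auto
  define f where "f t = e2ennreal (R0 (q t) (deriv q t))" for t
  have dual0: "dual_potential R0 c 0 = 0" for c
  proof -
    obtain y0 where max: "\<And>y. \<mu> c y \<le> \<mu> c y0" using coeff.max_a[of c] by blast
    show ?thesis unfolding dual coeff.eff_zero[OF max] by simp
  qed
  \<comment> \<open>At zero force the dual vanishes, so the measurability assumption isolates
    \<open>R0\<close> along the curve; the integral of the sum can then be split.\<close>
  have f: "f \<in> borel_measurable (lebesgue_on {0..T})"
    using meas[OF T(1) q(1,2), of 0] unfolding f_def[abs_def] dual0 by (simp add: measurable_compose[OF _ measurable_e2ennreal])
  have g: "(\<lambda>t. ennreal (eff_density (\<mu> (q t)) 0 r)) \<in> borel_measurable (lebesgue_on {0..T})"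
  proof -
    interpret oscillating_coeff \<mu> m M "\<lambda>_. r" by (rule osc) simp
    show ?thesis using eff_measurable[OF AC_curves_measurable[OF q(2)], of "\<lambda>_. 0"] by simp
  qed
  have const: "(\<integral>\<^sup>+t. ennreal k \<partial>lebesgue_on {0..T}) = ennreal (k * T)" if "k \<ge> 0" for k
    using T(1) that by (simp add: space_restrict_space emeasure_restrict_space ennreal_mult)
  have "(\<integral>\<^sup>+t. f t \<partial>lebesgue_on {0..T}) = (\<integral>\<^sup>+t. ennreal (eff_density (\<mu> (q t)) (deriv q t) 0) \<partial>lebesgue_on {0..T})"
    using eq[OF T(1) q(1,2), of 0] unfolding dual0 time_integral_ereal by (simp add: time_integral_def f_def enn2ereal_inject)
  also have "\<dots> \<le> (\<integral>\<^sup>+t. ennreal (\<theta> * S1 + C) \<partial>lebesgue_on {0..T})"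
  proof (intro nn_integral_mono_AE AE_lebesgue_on_negligible[of "{0, T}"] ennreal_leI)
    fix t assume "t \<in> {0..T} - {0, T}"
    then have "t \<in> {0<..<T}" by auto
    then show "eff_density (\<mu> (q t)) (deriv q t) 0 \<le> \<theta> * S1 + C"
      using near[OF q(4), of t 1 0] q(3)[of t] by (simp add: S1_def)
  qed auto
  also have "\<dots> = ennreal ((\<theta> * S1 + C) * T)" using S \<theta>C by (intro const) auto
  finally have If: "(\<integral>\<^sup>+t. f t \<partial>lebesgue_on {0..T}) \<le> ennreal ((\<theta> * S1 + C) * T)" .
  have "(\<integral>\<^sup>+t. ennreal (eff_density (\<mu> (q t)) 0 r) \<partial>lebesgue_on {0..T}) \<le> (\<integral>\<^sup>+t. ennreal (\<theta> * S2 + C) \<partial>lebesgue_on {0..T})"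
  proof (intro nn_integral_mono_AE AE_lebesgue_on_negligible[of "{0, T}"] ennreal_leI)
    fix t assume "t \<in> {0..T} - {0, T}"
    then have "t \<in> {0<..<T}" by auto
    then show "eff_density (\<mu> (q t)) 0 r \<le> \<theta> * S2 + C"
      using near[OF q(4), of t 0 r] by (simp add: S2_def)
  qed auto
  also have "\<dots> = ennreal ((\<theta> * S2 + C) * T)" using S \<theta>C by (intro const) auto
  finally have Ig: "(\<integral>\<^sup>+t. ennreal (eff_density (\<mu> (q t)) 0 r) \<partial>lebesgue_on {0..T}) \<le> ennreal ((\<theta> * S2 + C) * T)" .
  \<comment> \<open>The integral of the density at speed 1 and force \<open>r\<close> is bounded
    from below by \<open>r * T\<close> and, through the supposed splitting, from above by
    \<open>F \<omega> * T\<close>.\<close>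
  have "ennreal (r * T) = (\<integral>\<^sup>+t. ennreal r \<partial>lebesgue_on {0..T})" using \<open>r > 0\<close> by (intro const[symmetric]) simp
  also have "\<dots> \<le> (\<integral>\<^sup>+t. ennreal (eff_density (\<mu> (q t)) (deriv q t) r) \<partial>lebesgue_on {0..T})"
  proof (intro nn_integral_mono_AE AE_lebesgue_on_negligible[of "{0, T}"] ennreal_leI)
    fix t assume "t \<in> {0..T} - {0, T}"
    then have "t \<in> {0<..<T}" by auto
    then show "r \<le> eff_density (\<mu> (q t)) (deriv q t) r"
      using coeff.eff_ge_abs[of 1 r "q t"] q(3)[of t] by simp
  qed auto
  also have "\<dots> = (\<integral>\<^sup>+t. e2ennreal (R0 (q t) (deriv q t) + dual_potential R0 (q t) r) \<partial>lebesgue_on {0..T})"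
    using eq[OF T(1) q(1,2), of r] unfolding time_integral_ereal by (simp add: time_integral_def enn2ereal_inject)
  also have "\<dots> = (\<integral>\<^sup>+t. f t + ennreal (eff_density (\<mu> (q t)) 0 r) \<partial>lebesgue_on {0..T})"
  proof (rule nn_integral_cong)
    fix t
    have "e2ennreal (R0 (q t) (deriv q t) + ereal (eff_density (\<mu> (q t)) 0 r))
        = e2ennreal (R0 (q t) (deriv q t)) + e2ennreal (ereal (eff_density (\<mu> (q t)) 0 r))"
      using R0pos coeff.eff_nonneg by (intro plus_ennreal.abs_eq[symmetric]) (auto simp: eq_onp_def)
    then show "e2ennreal (R0 (q t) (deriv q t) + dual_potential R0 (q t) r) = f t + ennreal (eff_density (\<mu> (q t)) 0 r)"
      by (simp add: dual f_def)
  qed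
  also have "\<dots> = (\<integral>\<^sup>+t. f t \<partial>lebesgue_on {0..T}) + (\<integral>\<^sup>+t. ennreal (eff_density (\<mu> (q t)) 0 r) \<partial>lebesgue_on {0..T})"
    by (rule nn_integral_add[OF f g])
  also have "\<dots> \<le> ennreal ((\<theta> * S1 + C) * T) + ennreal ((\<theta> * S2 + C) * T)" by (rule add_mono[OF If Ig])
  also have "\<dots> = ennreal ((\<theta> * S1 + C) * T + (\<theta> * S2 + C) * T)"
    using S \<theta>C T(1) by (intro ennreal_plus[symmetric] mult_nonneg_nonneg add_nonneg_nonneg) auto
  also have "(\<theta> * S1 + C) * T + (\<theta> * S2 + C) * T = F \<omega> * T"
    unfolding F_def \<theta>_def[symmetric] C_def[symmetric] by (simp add: algebra_simps)
  finally have "ennreal (r * T) \<le> ennreal (F \<omega> * T)" .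
  moreover have "0 \<le> F \<omega> * T"
    unfolding F_def \<theta>_def[symmetric] C_def[symmetric] using S \<theta>C T(1)
    by (intro mult_nonneg_nonneg add_nonneg_nonneg) auto
  ultimately have "r * T \<le> F \<omega> * T" by (simp add: ennreal_le_iff)
  then show False using \<omega>(1) T(1) by simp
qed

text \<open>A potential that serves all energies serves in particular \<open>- r * q\<close>, whose
  force is the constant \<open>r\<close>.\<close>

lemma no_force_independent_potential:
  assumes nc: "\<not> \<mu> q0 constant_on UNIV"
  shows "\<not> (\<exists>R0. \<forall>E. E C1_differentiable_on UNIV \<longrightarrow> simple_EDP_converges (\<lambda>\<epsilon>. E) (R_osc \<mu>) E R0)"
proof
  assume "\<exists>R0. \<forall>E. E C1_differentiable_on UNIV \<longrightarrow> simple_EDP_converges (\<lambda>\<epsilon>. E) (R_osc \<mu>) E R0"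
  then obtain R0 where R0: "\<And>E. E C1_differentiable_on UNIV \<Longrightarrow> simple_EDP_converges (\<lambda>\<epsilon>. E) (R_osc \<mu>) E R0" by blast
  define E where "E r q = - r * q" for r q :: real
  have E: "(E r has_real_derivative - r) (at q)" for r q unfolding E_def by (auto intro!: derivative_eq_intros)
  have dE: "deriv (E r) q = - r" for r q by (rule DERIV_imp_deriv[OF E])
  have C1: "E r C1_differentiable_on UNIV" for r by (rule C1_realI[OF E continuous_on_const])
  have rate: "diss_rate (E r) R0 (\<lambda>_. 0) q = (\<lambda>t. R0 (q t) (deriv q t) + dual_potential R0 (q t) r)" for r q
    by (simp add: diss_rate_def[abs_def] dE)
  show False
  proof (rule no_common_potential[OF nc, of R0])
    show "dissipation_potential R0"
      using R0[OF C1] by (auto simp: simple_EDP_converges_def gradient_system_def)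
    fix r T :: real and q assume T: "T > 0" and q: "q \<in> topspace (C_curves T)" "q \<in> AC_curves T"
    have "diss_measurable (E r) R0 (\<lambda>_. 0)" using R0[OF C1[of r]] by (simp add: simple_EDP_converges_def)
    then show "(\<lambda>t. R0 (q t) (deriv q t) + dual_potential R0 (q t) r) \<in> borel_measurable (lebesgue_on {0..T})"
      using T q(2) unfolding diss_measurable_def rate by blast
    interpret o: oscillating_coeff \<mu> m M "\<lambda>_. r" by (rule osc) simp
    have "ext_AC T (diss_functional (E r) R0 T (\<lambda>_. 0)) q = ext_AC T (\<lambda>q. time_integral T (\<lambda>t. ereal (o.eff_rate q t))) q"
    proof (rule gamma_limit_unique[OF _ o.gamma_convergence_R_osc q(1)])
      show "gamma_converges (C_curves T) (\<lambda>\<epsilon>. ext_AC T (diss_functional (E r) (R_osc \<mu> \<epsilon>) T (\<lambda>_. 0)))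
          (ext_AC T (diss_functional (E r) R0 T (\<lambda>_. 0)))"
        using R0[OF C1[of r]] T by (simp add: simple_EDP_converges_def)
    qed (simp_all add: dE T)
    then show "time_integral T (\<lambda>t. R0 (q t) (deriv q t) + dual_potential R0 (q t) r)
        = time_integral T (\<lambda>t. ereal (eff_density (\<mu> (q t)) (deriv q t) r))"
      using q(2) by (simp add: ext_AC_def diss_functional_def rate o.eff_rate_def)
  qed
qed

text \<open>For a single energy the tilts already reach every constant force: the tilt cancels the
  energy and adds \<open>- r * q\<close>.\<close>

lemma no_tilt_convergence:
  assumes nc: "\<not> \<mu> q0 constant_on UNIV" and E: "E C1_differentiable_on UNIV"
  shows "\<not> tilt_EDP_converges (\<lambda>\<epsilon>. E) (R_osc \<mu>) E0 R0"
proof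
  assume "tilt_EDP_converges (\<lambda>\<epsilon>. E) (R_osc \<mu>) E0 R0"
  then obtain N0 where N0: "dissipation_potential R0" "basic_assumptions (\<lambda>\<epsilon>. E) (R_osc \<mu>) E0 N0"
    "\<And>q v \<xi>. M_of E0 N0 q v \<xi> = R0 q v + dual_potential R0 q \<xi>"
    unfolding tilt_EDP_converges_def gradient_system_def by blast
  have "energies_gamma_converge (\<lambda>\<epsilon>. E) E0" using N0(2) by (simp add: basic_assumptions_def)
  \<comment> \<open>The derivative of \<open>E0\<close> enters through \<open>M_of\<close>; the
    cancellation by the tilt requires it to be that of \<open>E\<close>.\<close>
  then have E0: "E0 = E" using energies_gamma_converge_const_iff C1_continuous_deriv(3)[OF E] by blast
  obtain D0 where lim: "\<forall>T>0. \<forall>F. F C1_differentiable_on UNIV \<longrightarrow>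
        gamma_converges (C_curves T) (\<lambda>\<epsilon>. ext_AC T (diss_functional E (R_osc \<mu> \<epsilon>) T F)) (ext_AC T (\<lambda>q. D0 T q F)) \<and>
        (\<forall>q\<in>AC_curves T.
          (\<lambda>t. N0 (q t) (deriv q t) (- deriv F (q t))) \<in> borel_measurable (lebesgue_on {0..T}) \<and>
          D0 T q F = time_integral T (\<lambda>t. N0 (q t) (deriv q t) (- deriv F (q t))))"
    using N0(2) unfolding basic_assumptions_def by (elim conjE exE)
  have D0: "gamma_converges (C_curves T) (\<lambda>\<epsilon>. ext_AC T (diss_functional E (R_osc \<mu> \<epsilon>) T F)) (ext_AC T (\<lambda>q. D0 T q F))"
    "q \<in> AC_curves T \<Longrightarrow> (\<lambda>t. N0 (q t) (deriv q t) (- deriv F (q t))) \<in> borel_measurable (lebesgue_on {0..T}) \<and>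
      D0 T q F = time_integral T (\<lambda>t. N0 (q t) (deriv q t) (- deriv F (q t)))"
    if "T > 0" "F C1_differentiable_on UNIV" for T F q
    using lim that by blast+
  define F where "F r q = - E q - r * q" for r q :: real
  have F: "(F r has_real_derivative (- deriv E q - r)) (at q)" for r q
    unfolding F_def by (auto intro!: derivative_eq_intros C1_continuous_deriv(1)[OF E])
  have dF: "deriv (F r) q = - deriv E q - r" for r q by (rule DERIV_imp_deriv[OF F])
  have C1: "F r C1_differentiable_on UNIV" for r
    by (rule C1_realI[OF F]) (intro continuous_intros C1_continuous_deriv(2)[OF E])
  have N: "N0 q v (- deriv (F r) q) = R0 q v + dual_potential R0 q r" for q v r
    using N0(3)[of q v r] by (simp add: M_of_def E0 dF add.commute)
  show False
  proof (rule no_common_potential[OF nc N0(1)])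
    fix r T :: real and q assume T: "T > 0" and q: "q \<in> topspace (C_curves T)" "q \<in> AC_curves T"
    show "(\<lambda>t. R0 (q t) (deriv q t) + dual_potential R0 (q t) r) \<in> borel_measurable (lebesgue_on {0..T})"
      using D0(2)[OF T C1[of r] q(2)] unfolding N by blast
    interpret o: oscillating_coeff \<mu> m M "\<lambda>_. r" by (rule osc) simp
    have "ext_AC T (\<lambda>q. D0 T q (F r)) q = ext_AC T (\<lambda>q. time_integral T (\<lambda>t. ereal (o.eff_rate q t))) q"
      by (rule gamma_limit_unique[OF D0(1)[OF T C1] o.gamma_convergence_R_osc q(1)]) (simp_all add: dF T)
    then show "time_integral T (\<lambda>t. R0 (q t) (deriv q t) + dual_potential R0 (q t) r)
        = time_integral T (\<lambda>t. ereal (eff_density (\<mu> (q t)) (deriv q t) r))"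
      using q(2) D0(2)[OF T C1[of r] q(2)] by (simp add: ext_AC_def N o.eff_rate_def)
  qed
qed

end

text \<open>Non-quadraticity is stated where the force is nonzero: at zero force the density is the
  quadratic \<open>S\<^sup>2 / 2 * v\<^sup>2\<close> with \<open>S\<close> the mean of the root of
  \<open>\<mu> q\<close>. Dependence on the energy takes the form that no single potential serves
  all energies.\<close>

theorem theorem3p1:
  fixes \<mu> :: "real \<Rightarrow> real \<Rightarrow> real" and E :: "real \<Rightarrow> real" and m M :: real
  assumes "continuous_on UNIV (\<lambda>(q, y). \<mu> q y)"
    and "\<And>q y. \<mu> q (y + 1) = \<mu> q y"
    and "0 < m" and "m \<le> M"
    and "\<And>q y. m \<le> \<mu> q y \<and> \<mu> q y \<le> M"
    and "E C1_differentiable_on UNIV"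
  shows "contact_EDP_converges (\<lambda>\<epsilon>. E) (R_osc \<mu>) E (R_eff \<mu>) \<and>
    (\<forall>q. is_quadratic (R_eff \<mu> q)) \<and>
    ((\<exists>q. \<not> (\<mu> q) constant_on UNIV) \<longrightarrow>
      (\<exists>R0. simple_EDP_converges (\<lambda>\<epsilon>. E) (R_osc \<mu>) E R0 \<and>
         (\<forall>q. \<not> (\<mu> q) constant_on UNIV \<and> deriv E q \<noteq> 0 \<longrightarrow> \<not> is_quadratic (R0 q))) \<and>
      \<not> (\<exists>R0. \<forall>E'. E' C1_differentiable_on UNIV \<longrightarrow>
           simple_EDP_converges (\<lambda>\<epsilon>. E') (R_osc \<mu>) E' R0) \<and>
      \<not> (\<exists>E0 R0. tilt_EDP_converges (\<lambda>\<epsilon>. E) (R_osc \<mu>) E0 R0))"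
proof -
  interpret wiggly \<mu> m M using assms by unfold_locales auto
  have "is_quadratic (R_eff \<mu> q)" for q unfolding is_quadratic_def R_eff_def by blast
  then show ?thesis
    using contact_convergence[OF assms(6)] simple_convergence[OF assms(6)] R_simple_not_quadratic
      no_force_independent_potential no_tilt_convergence[OF _ assms(6)] by blast
qed

end
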